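(* Let $p$ be an odd prime, $q$ a power of $p$, and $d>2$ an integer prime to $p$. Let $K=\mathbb{F}_q(t^{1/d})$ and let $E$ be the elliptic curve $y^2=x(x+1)(x+t)$. Let $O$ be the set of orbits for multiplication by $q$ on $\mathbb{Z}/d\mathbb{Z}$, with the orbit $\{0\}$ and (when $d$ is even) the orbit $\{d/2\}$ omitted. For each $o\in O$, let $|o|$ be the cardinality of $o$ and let $J_o$ be the associated Jacobi sum. Then the Hasse-Weil $L$-function of $E$ over $K$ is $$L(E/K,T)=\prod_{o\in O}\left(1-J_o^2T^{|o|}\right).$$ In particular, when $q\equiv 1\pmod d$ we have $$L(E/K,T)=\prod_{\substack{i=1\\ i\neq d/2}}^{d-1}\left(1-J(\lambda,\chi_i)^2T\right).$$
   Context: $K=\mathbb{F}_q(t^{1/d})$ denotes $\mathbb{F}_q(u)$ with $u^d=t$, an extension of $\mathbb{F}_p(t)$. The Hasse-Weil $L$-function is $L(E/K,T)=\prod_{v\text{ good}}(1-a_vT^{\deg v}+q_vT^{2\deg v})^{-1}\prod_{v\text{ bad}}(1-a_vT^{\deg v})^{-1}$, over places $v$ of $K$ of good, resp. bad, reduction of $E$; here $q_v$ is the cardinality of the residue field at $v$ and $|E(\mathbb{F}_{q_v})|=q_v+1-a_v$, the count being of points on the (minimal) plane cubic model of $E$ at $v$, so that $a_v=1,-1,0$ when $E$ has split multiplicative, non-split multiplicative, or additive reduction, respectively. Jacobi sums. Fix a prime $\mathfrak{p}$ of the ring $\mathcal{O}_{\overline{\mathbb{Q}}}$ of algebraic integers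 over $p$, and put $\overline{\mathbb{F}}_p=\mathcal{O}_{\overline{\mathbb{Q}}}/\mathfrak{p}$; all finite fields of characteristic $p$ are taken inside this $\overline{\mathbb{F}}_p$. Reduction modulo $\mathfrak p$ is an isomorphism from the group of roots of unity of order prime to $p$ in $\overline{\mathbb{Q}}$ to $\overline{\mathbb{F}}_p^\times$; let $\theta:\overline{\mathbb{F}}_p^\times\to\overline{\mathbb{Q}}^\times$ be its inverse. A multiplicative character $\chi$ of a finite field $k$ is extended to $k$ by $\chi(0)=0$ if $\chi$ is non-trivial and by $\chi(0)=1$ if $\chi$ is trivial. For characters $\chi_1,\chi_2:k^\times\to\overline{\mathbb{Q}}^\times$ set $$J(\chi_1,\chi_2)=\sum_{\substack{u,v\in k\\ u+v+1=0}}\chi_1(u)\chi_2(v).$$ For an orbit $o\subset\mathbb{Z}/d\mathbb{Z}$ of multiplication by $q$, with $o\ne\{0\}$ and $o\neq\{d/2\}$ (if $d$ is even), and $i\in o$, let $\chi_i$ be the restriction of $\theta^{(q^{|o|}-1)i/d}$ to $\mathbb{F}_{q^{|o|}}^\times$ (the exponent $(q^{|o|}-1)i/d$ is an integer), let $\lambda$ be the non-trivial quadratic character of $\mathbb{F}_{q^{|o|}}^\times$, and set $J_o=J(\lambda,\chi_i)$ (a sum over $\mathbb{F}_{q^{|o|}}$). This is independent of the choice of $i\in o$. *)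

theory Defs
  imports
    Complex_Main
    "HOL-Library.Cardinality"
    "HOL-Algebra.Embedded_Algebras"
    "HOL-Algebra.QuotRing"
    "HOL-Algebra.Multiplicative_Group"
    "HOL-Computational_Algebra.Formal_Power_Series"
    "HOL-Computational_Algebra.Polynomial_Factorial"
    "HOL-Number_Theory.Cong"
begin

text \<open>\<open>Weierstrass a1 a2 a3 a4 a6\<close> stands for
  \<open>y^2 + a1 x y + a3 y = x^3 + a2 x^2 + a4 x + a6\<close>.\<close>

datatype 'a weierstrass = Weierstrass 'a 'a 'a 'a 'a

fun discriminant :: "'a::comm_ring_1 weierstrass \<Rightarrow> 'a" where
  "discriminant (Weierstrass a1 a2 a3 a4 a6) =
    (let b2 = a1^2 + 4*a2;
         b4 = 2*a4 + a1*a3;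
         b6 = a3^2 + 4*a6;
         b8 = a1^2*a6 + 4*a2*a6 - a1*a3*a4 + a2*a3^2 - a4^2
     in - (b2^2*b8) - 8*b4^3 - 27*b6^2 + 9*b2*b4*b6)"

text \<open>The equation in \<open>x', y'\<close> obtained by the substitution
  \<open>x = u^2 x' + r\<close>, \<open>y = u^3 y' + s u^2 x' + t\<close>.\<close>

fun change_coords :: "'a::field \<Rightarrow> 'a \<Rightarrow> 'a \<Rightarrow> 'a \<Rightarrow> 'a weierstrass \<Rightarrow> 'a weierstrass" where
  "change_coords u r s t (Weierstrass a1 a2 a3 a4 a6) =
    Weierstrass
      ((a1 + 2 * s) / u)
      ((a2 - s * a1 + 3*r - s^2) / u^2)
      ((a3 + r*a1 + 2*t) / u^3)
      ((a4 - s * a3 + 2*r*a2 - (t + r * s)*a1 + 3*r^2 - 2 * s*t) / u^4)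
      ((a6 + r*a4 + r^2*a2 + r^3 - t*a3 - t^2 - r*t*a1) / u^6)"

definition weierstrass_isomorphic :: "'a::field weierstrass \<Rightarrow> 'a weierstrass \<Rightarrow> bool" where
  "weierstrass_isomorphic W W' \<longleftrightarrow> (\<exists>u r s t. u \<noteq> 0 \<and> W' = change_coords u r s t W)"

fun affine_points :: "('a, 'b) ring_scheme \<Rightarrow> 'a weierstrass \<Rightarrow> ('a \<times> 'a) set" where
  "affine_points R (Weierstrass a1 a2 a3 a4 a6) =
    {(x, y). x \<in> carrier R \<and> y \<in> carrier R \<and>
      y \<otimes>\<^bsub>R\<^esub> y \<oplus>\<^bsub>R\<^esub> a1 \<otimes>\<^bsub>R\<^esub> x \<otimes>\<^bsub>R\<^esub> y \<oplus>\<^bsub>R\<^esub> a3 \<otimes>\<^bsub>R\<^esub> y =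
      x \<otimes>\<^bsub>R\<^esub> x \<otimes>\<^bsub>R\<^esub> x \<oplus>\<^bsub>R\<^esub> a2 \<otimes>\<^bsub>R\<^esub> x \<otimes>\<^bsub>R\<^esub> x \<oplus>\<^bsub>R\<^esub> a4 \<otimes>\<^bsub>R\<^esub> x \<oplus>\<^bsub>R\<^esub> a6}"

text \<open>The projective closure has exactly one further point \<open>[0 : 1 : 0]\<close>, on the line at infinity.\<close>

definition num_points :: "('a, 'b) ring_scheme \<Rightarrow> 'a weierstrass \<Rightarrow> nat" where
  "num_points R W = card (affine_points R W) + 1"

text \<open>Places are normalized discrete valuations. The value \<open>0\<close> at \<open>0\<close> is a convention which makes
  the function representing a place unique; it replaces the usual infinite value.\<close>

definition is_place :: "('a::field \<Rightarrow> int) \<Rightarrow> bool" where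
  "is_place v \<longleftrightarrow>
    v 0 = 0 \<and>
    (\<forall>x y. x \<noteq> 0 \<longrightarrow> y \<noteq> 0 \<longrightarrow> v (x * y) = v x + v y) \<and>
    (\<forall>x y. x \<noteq> 0 \<longrightarrow> y \<noteq> 0 \<longrightarrow> x + y \<noteq> 0 \<longrightarrow> min (v x) (v y) \<le> v (x + y)) \<and>
    v ` (UNIV - {0}) = UNIV"

definition valuation_ring :: "('a::field \<Rightarrow> int) \<Rightarrow> 'a ring" where
  "valuation_ring v =
    \<lparr>carrier = {x. x = 0 \<or> 0 \<le> v x}, monoid.mult = (*), one = 1, zero = 0, add = (+)\<rparr>"

definition valuation_ideal :: "('a::field \<Rightarrow> int) \<Rightarrow> 'a set" where
  "valuation_ideal v = {x. x = 0 \<or> 0 < v x}"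

definition residue_field :: "('a::field \<Rightarrow> int) \<Rightarrow> 'a set ring" where
  "residue_field v = valuation_ring v Quot valuation_ideal v"

definition residue :: "('a::field \<Rightarrow> int) \<Rightarrow> 'a \<Rightarrow> 'a set" where
  "residue v x = valuation_ideal v +>\<^bsub>valuation_ring v\<^esub> x"

definition residue_card :: "('a::field \<Rightarrow> int) \<Rightarrow> nat" where
  "residue_card v = card (carrier (residue_field v))"

text \<open>The degree over the constant field \<open>'k\<close> of a place of the rational function field \<open>'k(u)\<close>,
  which is represented by the type \<open>'k poly fract\<close>.\<close>

definition place_degree :: "('k::field poly fract \<Rightarrow> int) \<Rightarrow> nat" where
  "place_degree v =
    ring.dim (residue_field v) (range (\<lambda>c. residue v (to_fract [:c:]))) (carrier (residue_field v))"

definition minimal_model ::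
  "('a::field \<Rightarrow> int) \<Rightarrow> 'a weierstrass \<Rightarrow> 'a weierstrass \<Rightarrow> bool" where
  "minimal_model v W W' \<longleftrightarrow>
    weierstrass_isomorphic W W' \<and>
    set_weierstrass W' \<subseteq> carrier (valuation_ring v) \<and>
    (\<forall>W''. weierstrass_isomorphic W W'' \<longrightarrow> set_weierstrass W'' \<subseteq> carrier (valuation_ring v) \<longrightarrow>
      v (discriminant W') \<le> v (discriminant W''))"

text \<open>Minimal models at a place are unique up to a change of coordinates over the valuation ring,
  so the following notions do not depend on the choice made here.\<close>

definition min_model :: "('a::field \<Rightarrow> int) \<Rightarrow> 'a weierstrass \<Rightarrow> 'a weierstrass" where
  "min_model v W = (SOME W'. minimal_model v W W')"

definition good_reduction :: "('a::field \<Rightarrow> int) \<Rightarrow> 'a weierstrass \<Rightarrow> bool" where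
  "good_reduction v W \<longleftrightarrow> v (discriminant (min_model v W)) = 0"

definition frobenius_trace :: "('a::field \<Rightarrow> int) \<Rightarrow> 'a weierstrass \<Rightarrow> int" where
  "frobenius_trace v W =
    int (residue_card v) + 1 -
    int (num_points (residue_field v) (map_weierstrass (residue v) (min_model v W)))"

definition euler_factor ::
  "('k::field poly fract \<Rightarrow> int) \<Rightarrow> 'k poly fract weierstrass \<Rightarrow> complex fps" where
  "euler_factor v W =
    (if good_reduction v W
     then 1 - of_int (frobenius_trace v W) * fps_X ^ place_degree v
            + of_nat (residue_card v) * fps_X ^ (2 * place_degree v)
     else 1 - of_int (frobenius_trace v W) * fps_X ^ place_degree v)"

text \<open>The infinite product is the limit of the finite partial products, in the metric topology on
  formal power series, which is the one given by the powers of the ideal generated by the variable.\<close>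

definition hasse_weil_L :: "'k::field poly fract weierstrass \<Rightarrow> complex fps" where
  "hasse_weil_L W =
    Lim (finite_subsets_at_top {v. is_place v}) (\<lambda>S. \<Prod>v\<in>S. inverse (euler_factor v W))"

text \<open>\<open>y^2 = x (x + 1) (x + t)\<close> over \<open>'k(u)\<close>, where \<open>t = u^d\<close> and \<open>u\<close> is \<open>to_fract [:0, 1:]\<close>.\<close>

definition legendre_curve :: "nat \<Rightarrow> 'k::field poly fract weierstrass" where
  "legendre_curve d =
    (let t = to_fract [:0, 1:] ^ d in Weierstrass 0 (1 + t) 0 t 0)"

definition algebraic_integers :: "complex ring" where
  "algebraic_integers =
    \<lparr>carrier = {z. algebraic_int z}, monoid.mult = (*), one = 1, zero = 0, add = (+)\<rparr>"

text \<open>For a prime \<open>P\<close> over \<open>p\<close>, the quotient by \<open>P\<close> is an algebraic closure of the prime field, and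
  \<open>subfield_of_card P Q\<close> is its subfield with \<open>Q\<close> elements, for \<open>Q\<close> a power of \<open>p\<close>.\<close>

definition Fp_bar :: "complex set \<Rightarrow> complex set ring" where
  "Fp_bar P = algebraic_integers Quot P"

definition subfield_of_card :: "complex set \<Rightarrow> nat \<Rightarrow> complex set ring" where
  "subfield_of_card P Q =
    Fp_bar P \<lparr>carrier := {x \<in> carrier (Fp_bar P). x [^]\<^bsub>Fp_bar P\<^esub> Q = x}\<rparr>"

definition teichmueller :: "nat \<Rightarrow> complex set \<Rightarrow> complex set \<Rightarrow> complex" where
  "teichmueller p P =
    inv_into {z. \<exists>n>0. coprime n p \<and> z ^ n = 1} (\<lambda>z. P +>\<^bsub>algebraic_integers\<^esub> z)"

text \<open>Characters are functions on the whole type; only their values at the non-zero elements of the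
  field are relevant, and \<open>extend_char\<close> supplies the value at zero.\<close>

definition mult_character :: "('a, 'b) ring_scheme \<Rightarrow> ('a \<Rightarrow> complex) \<Rightarrow> bool" where
  "mult_character R \<chi> \<longleftrightarrow>
    (\<forall>x \<in> carrier (mult_of R). \<chi> x \<noteq> 0) \<and>
    (\<forall>x \<in> carrier (mult_of R). \<forall>y \<in> carrier (mult_of R). \<chi> (x \<otimes>\<^bsub>R\<^esub> y) = \<chi> x * \<chi> y)"

definition trivial_character :: "('a, 'b) ring_scheme \<Rightarrow> ('a \<Rightarrow> complex) \<Rightarrow> bool" where
  "trivial_character R \<chi> \<longleftrightarrow> (\<forall>x \<in> carrier (mult_of R). \<chi> x = 1)"

definition extend_char :: "('a, 'b) ring_scheme \<Rightarrow> ('a \<Rightarrow> complex) \<Rightarrow> 'a \<Rightarrow> complex" where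
  "extend_char R \<chi> x =
    (if x = \<zero>\<^bsub>R\<^esub> then (if trivial_character R \<chi> then 1 else 0) else \<chi> x)"

definition jacobi_sum ::
  "('a, 'b) ring_scheme \<Rightarrow> ('a \<Rightarrow> complex) \<Rightarrow> ('a \<Rightarrow> complex) \<Rightarrow> complex" where
  "jacobi_sum R \<chi>1 \<chi>2 =
    (\<Sum>(u, v) \<in> {(u, v). u \<in> carrier R \<and> v \<in> carrier R \<and> u \<oplus>\<^bsub>R\<^esub> v \<oplus>\<^bsub>R\<^esub> \<one>\<^bsub>R\<^esub> = \<zero>\<^bsub>R\<^esub>}.
      extend_char R \<chi>1 u * extend_char R \<chi>2 v)"

text \<open>The group of units of a finite field of odd characteristic is cyclic of even order, so the
  values of this character at the non-zero elements are uniquely determined.\<close>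

definition quadratic_character :: "('a, 'b) ring_scheme \<Rightarrow> 'a \<Rightarrow> complex" where
  "quadratic_character R =
    (SOME \<chi>. mult_character R \<chi> \<and> \<not> trivial_character R \<chi> \<and>
      (\<forall>x \<in> carrier (mult_of R). \<chi> x ^ 2 = 1))"

text \<open>\<open>J(\<lambda>, \<chi>_i)\<close> over the field with \<open>Q\<close> elements, for \<open>d\<close> dividing \<open>(Q - 1) i\<close>.\<close>

definition J_lambda_chi :: "nat \<Rightarrow> complex set \<Rightarrow> nat \<Rightarrow> nat \<Rightarrow> nat \<Rightarrow> complex" where
  "J_lambda_chi p P d Q i =
    jacobi_sum (subfield_of_card P Q) (quadratic_character (subfield_of_card P Q))
      (\<lambda>x. teichmueller p P x ^ ((Q - 1) * i div d))"

text \<open>\<open>\<int>/d\<int>\<close> is represented by \<open>{0..<d}\<close>.\<close>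

definition mult_orbits :: "nat \<Rightarrow> nat \<Rightarrow> nat set set" where
  "mult_orbits q d = (\<lambda>i. range (\<lambda>n. (q ^ n * i) mod d)) ` {0..<d}"

definition admissible_orbits :: "nat \<Rightarrow> nat \<Rightarrow> nat set set" where
  "admissible_orbits q d =
    {orb \<in> mult_orbits q d. orb \<noteq> {0} \<and> \<not> (even d \<and> orb = {d div 2})}"

definition J_orbit :: "nat \<Rightarrow> complex set \<Rightarrow> nat \<Rightarrow> nat \<Rightarrow> nat set \<Rightarrow> complex" where
  "J_orbit p P q d orb = J_lambda_chi p P d (q ^ card orb) (SOME i. i \<in> orb)"

end

theory Submission
  imports Defs "HOL-Algebra.Algebraic_Closure_Type" "HOL-Number_Theory.Number_Theory"
begin

hide_const (open) Polynomials.degree Polynomials.lead_coeff up_ring.monom up_ring.coeff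
  Divisibility.prime Ring_Divisibility.mult_of

text \<open>Both sides are power series with constant term 1, so it suffices to compare their logarithmic
  derivatives. Summing those of the Euler factors over the places, with a place of degree \<open>m\<close> seen as
  an orbit of \<open>m\<close> elements of the algebraic closure, turns the coefficient at \<open>n\<close> on the left into
  the double sum of \<open>\<lambda>(z (z + 1) (z + x ^ d))\<close> over \<open>x\<close> and \<open>z\<close> in the field with \<open>q ^ n\<close> elements,
  minus a contribution of the place at infinity, which is 1 if \<open>d\<close> is even and 0 otherwise. Expanding
  the number of solutions of \<open>x ^ d = w\<close> in characters gives the sum of \<open>J(\<lambda>, \<chi>_i)^2\<close> over all
  \<open>i \<noteq> 0\<close> for which \<open>\<chi>_i\<close> is defined over that field; the term at \<open>i = d/2\<close> is 1 and cancels against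
  infinity. By the Hasse-Davenport relation this is the coefficient on the right.

  The relation between the local sums over extension fields and the quadratic Euler factor, and the
  Hasse-Davenport relation, both come from multiplicative functions \<open>\<psi>\<close> on monic polynomials: the
  series of \<open>\<psi> g * T ^ degree g\<close> is an Euler product, and it is a polynomial of degree at most 2
  because \<open>\<psi>\<close> sums to zero along suitable lines.\<close>

section \<open>Finite fields and the quadratic character\<close>

text \<open>Three kinds of finite fields meet here: quotients of valuation rings, quotients of the
  ring of algebraic integers by \<open>P\<close>, and fixed fields of Frobenius in one algebraic
  closure of \<open>'k\<close>. All sums are evaluated in the last kind, where the fields with
  \<open>q ^ n\<close> elements are subsets of one type and norms are powers. Residue fields are
  carried there by reduction maps. From the quotient by \<open>P\<close> only a multiplicative
  bijection of roots of unity is carried over, together with the relation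
  \<open>x + y + 1 = 0\<close>; a Jacobi sum sees nothing else. Its order
  \<open>q ^ fact d - 1\<close> is chosen so that a single bijection serves every orbit, since
  orbits have at most \<open>d\<close> elements.

  Squares of Jacobi sums arise from \<open>z (z + 1) (z + z w) = z^2 (1 + z) (1 + w)\<close>: the
  substitution splits a double character sum into two equal factors. Squaring also removes the
  factor \<open>\<lambda>(-1)\<close> and the sign in the Hasse-Davenport relation.

  At the finite places with singular reduction the sums over extension fields are computed directly
  and fit the formula of the smooth ones; only infinity requires another integral model.\<close>

lemma order_prod_mset_linear:
  fixes A :: "'a::idom multiset"
  shows "Polynomial.order z (\<Prod>x\<in>#A. [:- x, 1:]) = count A z"
proof (induction A)
  case (add x A)
  have "(\<Prod>x\<in>#A. [:- x, 1:]) \<noteq> (0 :: 'a poly)"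
    by (auto simp: prod_mset_zero_iff)
  then show ?case
    using add order_power_n_n[of x 1] by (auto simp: order_mult order_0I simp del: mult_pCons_left)
qed auto

lemma sum_order_roots:
  fixes f :: "'a::alg_closed_field poly"
  assumes "f \<noteq> 0"
  shows "(\<Sum>z | poly f z = 0. Polynomial.order z f) = degree f"
proof -
  obtain A where A: "size A = degree f" "f = smult (lead_coeff f) (\<Prod>x\<in>#A. [:-x, 1:])"
    using alg_closed_imp_factorization[OF assms] by blast
  have ord: "Polynomial.order z f = count A z" for z
    by (subst A(2)) (use assms in \<open>simp add: order_smult order_prod_mset_linear\<close>)
  have "{z. poly f z = 0} = set_mset A"
    using assms by (auto simp: order_root ord)
  then show ?thesis
    unfolding ord A(1)[symmetric] by (simp add: size_multiset_overloaded_eq)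
qed

text \<open>A root of order at least 2 is also a root of the derivative. So all orders are 1, and
  their sum, the degree, counts the roots.\<close>

lemma card_roots_separable:
  fixes f :: "'a::alg_closed_field poly"
  assumes "f \<noteq> 0" and "\<And>z. poly f z = 0 \<Longrightarrow> poly (pderiv f) z \<noteq> 0"
  shows "card {z. poly f z = 0} = degree f"
proof -
  have "Polynomial.order z f = 1" if z: "poly f z = 0" for z
  proof (rule ccontr)
    assume "Polynomial.order z f \<noteq> 1"
    moreover have "Polynomial.order z f \<noteq> 0"
      using z assms(1) order_root by blast
    ultimately have "[:- z, 1:] ^ 2 dvd f"
      by (simp add: order_divides)
    then obtain g where "f = [:- z, 1:] ^ 2 * g"
      by (rule dvdE)
    then have "poly (pderiv f) z = 0"
      by (simp add: power2_eq_square pderiv_mult del: mult_pCons_left mult_pCons_right)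
    with assms(2) z show False
      by blast
  qed
  then show ?thesis
    using sum_order_roots[OF assms(1)] by simp
qed

text \<open>For \<open>Q\<close> a power of the characteristic and an algebraically closed type, the
  fixed points of this power of Frobenius form the subfield with \<open>Q\<close> elements.
  Extensions of finite fields thereby become inclusions of sets.\<close>

definition GF :: "nat \<Rightarrow> 'a::field set" where
  "GF Q = {x. x ^ Q = x}"

text \<open>Euler's criterion serves as the definition. As the formula is total, the compatibility
  with norms in \<open>quad_char_norm\<close> is a mere identity of exponents.\<close>

definition quad_char :: "nat \<Rightarrow> 'a::field \<Rightarrow> complex" where
  "quad_char Q x = (if x = 0 then 0 else if x ^ ((Q - 1) div 2) = 1 then 1 else - 1)"

lemma quad_char_0 [simp]: "quad_char Q 0 = 0"
  by (simp add: quad_char_def)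

lemma quad_char_1 [simp]: "quad_char Q 1 = 1"
  by (simp add: quad_char_def)

locale galois_field =
  fixes Q :: nat and ty :: "'a::alg_closed_field itself"
  assumes prime_char: "prime CHAR('a)" and odd_Q: "odd Q"
    and Q_power: "\<exists>e>0. Q = CHAR('a) ^ e"
begin

lemma Q_ge: "Q \<ge> 3"
proof -
  obtain e where e: "e > 0" "Q = CHAR('a) ^ e"
    using Q_power by auto
  have "Q > 1"
    unfolding e(2) using e(1) prime_char by (meson one_less_power prime_gt_1_nat)
  then show ?thesis
    using odd_Q by presburger
qed

lemma Q_pos [simp]: "Q > 0"
  using Q_ge by simp

lemma of_nat_Q: "of_nat Q = (0::'a)"
proof -
  obtain e where "e > 0" "Q = CHAR('a) ^ e"
    using Q_power by auto
  then have "CHAR('a) dvd Q"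
    by (simp add: dvd_power)
  then show ?thesis
    using of_nat_eq_0_iff_char_dvd by blast
qed

lemma odd_char: "odd CHAR('a)"
  using Q_power odd_Q by auto

lemma two_nz: "(2::'a) \<noteq> 0"
proof
  assume "(2::'a) = 0"
  then have "of_nat 2 = (0::'a)"
    by simp
  then have "CHAR('a) dvd 2"
    using of_nat_eq_0_iff_char_dvd by blast
  then have "CHAR('a) = 2"
    using prime_char by (metis primes_dvd_imp_eq two_is_prime_nat)
  then show False
    using odd_char by simp
qed

lemma frob_add: "(x + y :: 'a) ^ Q = x ^ Q + y ^ Q"
  using Q_power prime_char freshmans_dream'[of Q _ x y] by auto

lemma frob_minus: "(- x :: 'a) ^ Q = - (x ^ Q)"
  using odd_Q by (simp add: power_minus_odd)

lemma frob_diff: "(x - y :: 'a) ^ Q = x ^ Q - y ^ Q"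
  using frob_add[of x "- y"] by (simp add: frob_minus)

lemma frob_inj: "(x :: 'a) ^ Q = y ^ Q \<Longrightarrow> x = y"
  using frob_diff[of x y] by simp

abbreviation F :: "'a set" where
  "F \<equiv> GF Q"

lemma GF_0 [simp]: "0 \<in> F" and GF_1 [simp]: "1 \<in> F"
  by (auto simp: GF_def power_0_left)

lemma GF_add [intro]: "x \<in> F \<Longrightarrow> y \<in> F \<Longrightarrow> x + y \<in> F"
  by (simp add: GF_def frob_add)

lemma GF_minus [intro]: "x \<in> F \<Longrightarrow> - x \<in> F"
  by (simp add: GF_def frob_minus)

lemma GF_diff [intro]: "x \<in> F \<Longrightarrow> y \<in> F \<Longrightarrow> x - y \<in> F"
  by (simp add: GF_def frob_diff)

lemma GF_mult [intro]: "x \<in> F \<Longrightarrow> y \<in> F \<Longrightarrow> x * y \<in> F"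
  by (simp add: GF_def power_mult_distrib)

lemma GF_divide [intro]: "x \<in> F \<Longrightarrow> y \<in> F \<Longrightarrow> x / y \<in> F"
  by (simp add: GF_def power_divide)

lemma GF_power [intro]: "x \<in> F \<Longrightarrow> x ^ n \<in> F"
  by (simp add: GF_def flip: power_mult) (simp add: mult.commute[of n] power_mult)

lemmas GF_closed = GF_0 GF_1 GF_add GF_minus GF_diff GF_mult GF_divide GF_power

lemma card_GF: "card F = Q"
proof -
  define f :: "'a poly" where "f = monom 1 Q - monom 1 1"
  have deg: "degree f = Q"
    unfolding f_def diff_conv_add_uminus using Q_ge
    by (subst degree_add_eq_left) (auto simp: degree_monom_eq)
  have "F = {z. poly f z = 0}"
    by (auto simp: f_def GF_def poly_monom)
  \<comment> \<open>The derivative of \<open>X^Q - X\<close> is the constant -1, because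
    \<open>Q\<close> is zero in this characteristic.\<close>
  moreover have "poly (pderiv f) z \<noteq> 0" for z
    by (simp add: f_def pderiv_diff pderiv_monom of_nat_Q poly_monom)
  moreover have "f \<noteq> 0"
    using deg Q_ge by auto
  ultimately show ?thesis
    using card_roots_separable[of f] deg by simp
qed

lemma finite_GF [simp]: "finite F"
  using card_GF Q_pos by (metis card.infinite less_irrefl)

lemma GF_nz_power: "x \<in> F \<Longrightarrow> x \<noteq> 0 \<Longrightarrow> x ^ (Q - 1) = 1"
proof -
  assume x: "x \<in> F" "x \<noteq> 0"
  have "x * x ^ (Q - 1) = x * 1"
    using x Q_pos by (simp add: GF_def flip: power_Suc)
  then show ?thesis
    using x by simp
qed

lemma GF_nz_iff: "x \<noteq> 0 \<Longrightarrow> x \<in> F \<longleftrightarrow> x ^ (Q - 1) = 1"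
proof -
  assume x: "x \<noteq> 0"
  have "x ^ Q = x * x ^ (Q - 1)"
    by (simp flip: power_Suc)
  then show ?thesis
    using x by (auto simp: GF_def)
qed

lemma half: "2 * ((Q - 1) div 2) = Q - 1"
  using odd_Q by simp

lemma half_power_cases:
  assumes "x \<in> F" "x \<noteq> 0"
  shows "x ^ ((Q - 1) div 2) = 1 \<or> x ^ ((Q - 1) div 2) = - 1"
proof -
  have "(x ^ ((Q - 1) div 2)) ^ 2 = 1"
    using GF_nz_power[OF assms] by (metis half mult.commute power_mult)
  then show ?thesis
    by (simp add: power2_eq_1_iff)
qed

lemma minus_one_neq_one: "(- 1 :: 'a) \<noteq> 1"
  using two_nz by (metis add.right_inverse one_add_one)

lemma quad_char_mult:
  assumes "x \<in> F" "y \<in> F"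
  shows "quad_char Q (x * y) = quad_char Q x * quad_char Q y"
proof (cases "x = 0 \<or> y = 0")
  case False
  then show ?thesis
    using half_power_cases[OF assms(1)] half_power_cases[OF assms(2)] minus_one_neq_one
    by (auto simp: quad_char_def power_mult_distrib)
qed auto

lemma quad_char_power: "x \<in> F \<Longrightarrow> quad_char Q (x ^ n) = quad_char Q x ^ n"
  by (induction n) (auto simp: quad_char_mult GF_power)

lemma quad_char_square: "x \<noteq> 0 \<Longrightarrow> quad_char Q x ^ 2 = 1"
  by (simp add: quad_char_def)

lemma quad_char_of_square:
  assumes "x \<in> F" "x \<noteq> 0"
  shows "quad_char Q (x * x) = 1"
  using assms quad_char_square[of x] by (simp add: quad_char_mult power2_eq_square)

text \<open>A square root \<open>y\<close> always exists in the closure. It lies in \<open>F\<close>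
  exactly when \<open>y ^ (Q - 1)\<close>, which is the half power of \<open>x\<close>, equals 1;
  and \<open>y\<close>, \<open>- y\<close> differ as the characteristic is odd.\<close>

lemma card_square_roots:
  assumes x: "x \<in> F"
  shows "of_nat (card {y \<in> F. y ^ 2 = x}) = 1 + quad_char Q x"
proof (cases "x = 0")
  case True
  then have "{y \<in> F. y ^ 2 = x} = {0}"
    by auto
  with True show ?thesis
    by simp
next
  case False
  obtain y where y: "y ^ 2 = x"
    using nth_root_exists[of 2 x] by auto
  with False have y0: "y \<noteq> 0"
    by auto
  have yy: "y \<noteq> - y"
    using y0 two_nz by (metis add_eq_0_iff mult_2 mult_eq_0_iff)
  have sq: "z ^ 2 = x \<longleftrightarrow> z = y \<or> z = - y" for z
    using y power2_eq_iff[of z y] by simp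
  have inF: "y \<in> F \<longleftrightarrow> x ^ ((Q - 1) div 2) = 1"
    unfolding GF_nz_iff[OF y0] y[symmetric] power_mult[symmetric] half ..
  show ?thesis
  proof (cases "y \<in> F")
    case True
    then have "{y \<in> F. y ^ 2 = x} = {y, - y}"
      by (auto simp: sq)
    with True inF False yy show ?thesis
      by (simp add: quad_char_def)
  next
    case nF: False
    then have "- y \<notin> F"
      using GF_minus by fastforce
    with nF have "{y \<in> F. y ^ 2 = x} = {}"
      by (auto simp: sq)
    with nF inF False show ?thesis
      by (simp only: quad_char_def) auto
  qed
qed

lemma sum_reindex_add:
  assumes "c \<in> F"
  shows "(\<Sum>x\<in>F. g (x + c)) = (\<Sum>x\<in>F. g x)"
  by (rule sum.reindex_bij_witness[of _ "\<lambda>x. x - c" "\<lambda>x. x + c"]) (use assms in auto)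

lemma sum_reindex_minus: "(\<Sum>x\<in>F. g (- x)) = (\<Sum>x\<in>F. g x)"
  by (rule sum.reindex_bij_witness[of _ uminus uminus]) auto

lemma sum_reindex_mult:
  assumes "c \<in> F" "c \<noteq> 0"
  shows "(\<Sum>x\<in>F. g (c * x)) = (\<Sum>x\<in>F. g x)"
  by (rule sum.reindex_bij_witness[of _ "\<lambda>x. x / c" "\<lambda>x. c * x"]) (use assms in auto)

text \<open>The polynomial \<open>X^((Q-1)/2) - 1\<close> has fewer roots than \<open>F\<close> has
  units, so some unit \<open>c\<close> has value -1. Multiplication by \<open>c\<close> permutes
  \<open>F\<close> and negates the sum.\<close>

lemma sum_quad_char: "(\<Sum>x\<in>F. quad_char Q x) = 0"
proof -
  have "\<exists>c\<in>F. c \<noteq> 0 \<and> quad_char Q c \<noteq> 1"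
  proof (rule ccontr)
    assume "\<not> ?thesis"
    then have sub: "F - {0} \<subseteq> {x. poly (monom 1 ((Q - 1) div 2) - 1) x = 0}"
      by (auto simp: quad_char_def poly_monom split: if_splits)
    have deg: "degree (monom 1 ((Q - 1) div 2) - 1 :: 'a poly) = (Q - 1) div 2"
      unfolding diff_conv_add_uminus using Q_ge
      by (subst degree_add_eq_left) (auto simp: degree_monom_eq)
    have nz: "(monom 1 ((Q - 1) div 2) - 1 :: 'a poly) \<noteq> 0"
    proof
      assume "(monom 1 ((Q - 1) div 2) - 1 :: 'a poly) = 0"
      then have "(Q - 1) div 2 = 0"
        using deg by simp
      then show False
        using half Q_ge by simp
    qed
    have "card (F - {0}) \<le> (Q - 1) div 2"
      using card_mono[OF poly_roots_finite[OF nz] sub] card_poly_roots_bound[OF nz] deg by simp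
    moreover have "card (F - {0}) = Q - 1"
      by (simp add: card_GF)
    ultimately show False
      using half Q_ge by linarith
  qed
  then obtain c where c: "c \<in> F" "c \<noteq> 0" "quad_char Q c \<noteq> 1"
    by auto
  then have "quad_char Q c = - 1"
    by (simp add: quad_char_def split: if_splits)
  then have "(\<Sum>x\<in>F. quad_char Q (c * x)) = - (\<Sum>x\<in>F. quad_char Q x)"
    using c by (simp add: quad_char_mult sum_negf)
  then show ?thesis
    using sum_reindex_mult[OF c(1,2), of "quad_char Q"] by (simp add: eq_neg_iff_add_eq_0)
qed

lemma sum_quad_char_linear:
  assumes "b \<in> F" "c \<in> F" "c \<noteq> 0"
  shows "(\<Sum>x\<in>F. quad_char Q (b + c * x)) = 0"
  using sum_reindex_add[OF assms(1), of "quad_char Q"]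
    sum_reindex_mult[OF assms(2,3), of "\<lambda>x. quad_char Q (x + b)"]
  by (simp add: sum_quad_char add.commute)

text \<open>Division by the square \<open>x * x\<close> turns the argument into
  \<open>1 + c / x\<close>, which runs over \<open>F\<close> without 1. The full sum is zero, so
  minus the term at 1 remains.\<close>

lemma sum_quad_char_quadratic:
  assumes c: "c \<in> F" "c \<noteq> 0"
  shows "(\<Sum>x\<in>F. quad_char Q (x * (x + c))) = - 1"
proof -
  have "(\<Sum>x\<in>F. quad_char Q (x * (x + c))) = (\<Sum>x\<in>F-{0}. quad_char Q (x * (x + c)))"
    by (simp add: sum.remove[of F 0])
  also have "\<dots> = (\<Sum>x\<in>F-{1}. quad_char Q x)"
  proof (rule sum.reindex_bij_witness[of _ "\<lambda>y. c / (y - 1)" "\<lambda>x. 1 + c / x"])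
    fix x assume x: "x \<in> F - {0}"
    then have "x * (x + c) = (x * x) * (1 + c / x)"
      by (simp add: field_simps)
    also have "quad_char Q \<dots> = quad_char Q (x * x) * quad_char Q (1 + c / x)"
      using x c by (intro quad_char_mult) auto
    also have "quad_char Q (x * x) = 1"
      using x by (intro quad_char_of_square) auto
    finally show "quad_char Q (1 + c / x) = quad_char Q (x * (x + c))"
      by simp
  qed (use c in \<open>auto simp: field_simps intro!: GF_divide GF_add GF_diff\<close>)
  also have "\<dots> = (\<Sum>x\<in>F. quad_char Q x) - 1"
    by (simp add: sum.remove[of F 1])
  finally show ?thesis
    by (simp add: sum_quad_char)
qed

lemma extension: "r > 0 \<Longrightarrow> galois_field TYPE('a) (Q ^ r)"
proof
  assume r: "r > 0"
  obtain e where e: "e > 0" "Q = CHAR('a) ^ e"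
    using Q_power by auto
  show "\<exists>e>0. Q ^ r = CHAR('a) ^ e"
    by (rule exI[of _ "e * r"]) (use e r in \<open>simp add: power_mult\<close>)
qed (use prime_char odd_Q in auto)

lemma norm_exponent: "(Q - 1) * (\<Sum>j<r. Q ^ j) = Q ^ r - 1"
proof -
  have "int ((Q - 1) * (\<Sum>j<r. Q ^ j)) = int (Q ^ r - 1)"
    using power_diff_1_eq[of "int Q" r] Q_ge by (simp add: of_nat_diff)
  then show ?thesis
    by linarith
qed

text \<open>The exponent \<open>1 + Q + ... + Q^(r-1)\<close> is that of the norm from
  \<open>GF (Q ^ r)\<close> to \<open>GF Q\<close>. Multiplied by \<open>(Q - 1) div 2\<close> it
  gives \<open>(Q ^ r - 1) div 2\<close>, so the two Euler criteria coincide.\<close>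

lemma quad_char_norm:
  assumes "r > 0"
  shows "quad_char Q (z ^ (\<Sum>j<r. Q ^ j)) = quad_char (Q ^ r) (z :: 'a)"
proof -
  define s where "s = (\<Sum>j<r. Q ^ j)"
  have "2 * (s * ((Q - 1) div 2)) = Q ^ r - 1"
    unfolding s_def using half norm_exponent[of r] by (metis mult.commute mult.left_commute)
  then have "s * ((Q - 1) div 2) = (Q ^ r - 1) div 2"
    by linarith
  moreover have "s > 0"
    unfolding s_def using assms by (intro sum_pos) auto
  ultimately show ?thesis
    unfolding quad_char_def s_def[symmetric] power_mult[symmetric] by simp
qed

lemma GF_subset_ext: "z \<in> F \<Longrightarrow> z \<in> GF (Q ^ r)"
  by (induction r) (auto simp: GF_def power_mult)

end

section \<open>Multiplicative functions on monic polynomials\<close>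

lemma map_poly_mult_hom:
  fixes f :: "'a::comm_semiring_0 \<Rightarrow> 'b::comm_semiring_0"
  assumes "f 0 = 0" "\<And>x y. f (x + y) = f x + f y" "\<And>x y. f (x * y) = f x * f y"
  shows "map_poly f (g * h) = map_poly f g * map_poly f h"
proof -
  have f_sum: "f (sum c A) = (\<Sum>i\<in>A. f (c i))" for c :: "nat \<Rightarrow> 'a" and A
    by (induction A rule: infinite_finite_induct) (auto simp: assms)
  show ?thesis
    by (intro poly_eqI) (simp add: coeff_map_poly coeff_mult assms f_sum)
qed

lemma poly_map_poly_hom:
  fixes f :: "'a::comm_semiring_0 \<Rightarrow> 'b::comm_semiring_0"
  assumes "f 0 = 0" "\<And>x y. f (x + y) = f x + f y" "\<And>x y. f (x * y) = f x * f y"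
  shows "poly (map_poly f g) (f x) = f (poly g x)"
  by (induction g) (auto simp: assms map_poly_pCons)

lemma prod_linear_dvd:
  fixes g :: "'a::idom poly"
  assumes "finite S" "\<And>s. s \<in> S \<Longrightarrow> poly g s = 0"
  shows "(\<Prod>s\<in>S. [:- s, 1:]) dvd g"
  using assms
proof (induction S)
  case (insert s S)
  then obtain h where h: "g = (\<Prod>s\<in>S. [:- s, 1:]) * h"
    by (auto elim: dvdE)
  moreover have "poly (\<Prod>s\<in>S. [:- s, 1:]) s \<noteq> 0"
    using insert by (auto simp: poly_prod)
  ultimately have "poly h s = 0"
    using insert.prems[of s] by auto
  then obtain h' where "h = [:- s, 1:] * h'"
    unfolding poly_eq_0_iff_dvd by (rule dvdE)
  then have "g = (\<Prod>s\<in>insert s S. [:- s, 1:]) * h'"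
    using insert.hyps by (simp add: h mult_ac del: mult_pCons_left mult_pCons_right)
  then show ?case
    by (rule dvdI)
qed auto

lemma order_prod_linear:
  fixes z :: "'a::idom"
  assumes "finite S"
  shows "Polynomial.order z (\<Prod>s\<in>S. [:- s, 1:]) = (if z \<in> S then 1 else 0)"
proof -
  have "(\<Prod>s\<in>S. [:- s, 1:]) = (\<Prod>s\<in>#mset_set S. [:- s, 1:])"
    by (simp add: prod_unfold_prod_mset)
  then show ?thesis
    using assms by (simp add: order_prod_mset_linear count_mset_set')
qed

section \<open>Frobenius on coefficients and monic polynomials over the field with \<open>Q\<close>
  elements\<close>

context galois_field
begin

text \<open>Polynomials over \<open>GF Q\<close> are represented as the polynomials over the closure
  that this map fixes, so that they share a type with their linear factors.\<close>

definition frob_poly :: "'a poly \<Rightarrow> 'a poly" where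
  "frob_poly = map_poly (\<lambda>x. x ^ Q)"

lemma coeff_frob_poly: "coeff (frob_poly g) i = coeff g i ^ Q"
  by (simp add: frob_poly_def coeff_map_poly power_0_left)

lemma frob_poly_mult: "frob_poly (g * h) = frob_poly g * frob_poly h"
  unfolding frob_poly_def
  by (rule map_poly_mult_hom) (auto simp: power_0_left frob_add power_mult_distrib)

lemma poly_frob_poly: "poly (frob_poly g) (x ^ Q) = poly g x ^ Q"
  unfolding frob_poly_def
  by (rule poly_map_poly_hom) (auto simp: power_0_left frob_add power_mult_distrib)

lemma frob_poly_pCons: "frob_poly (pCons a g) = pCons (a ^ Q) (frob_poly g)"
  unfolding frob_poly_def by (rule map_poly_pCons) (auto simp: power_0_left)

lemma frob_poly_0 [simp]: "frob_poly 0 = 0" and frob_poly_1 [simp]: "frob_poly 1 = 1"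
  by (auto simp: frob_poly_def)

lemma frob_poly_add: "frob_poly (g + h) = frob_poly g + frob_poly h"
  by (intro poly_eqI) (simp add: coeff_frob_poly frob_add)

lemma frob_poly_smult: "c \<in> F \<Longrightarrow> frob_poly (Polynomial.smult c g) = Polynomial.smult c (frob_poly g)"
  by (intro poly_eqI) (simp add: coeff_frob_poly power_mult_distrib GF_def)

lemma frob_poly_prod: "frob_poly (prod f A) = (\<Prod>i\<in>A. frob_poly (f i))"
  by (induction A rule: infinite_finite_induct) (auto simp: frob_poly_mult)

lemma frob_poly_fixed_iff: "frob_poly g = g \<longleftrightarrow> (\<forall>i. coeff g i \<in> F)"
  by (auto simp: poly_eq_iff coeff_frob_poly GF_def)

lemma poly_fixed: "frob_poly g = g \<Longrightarrow> poly g (x ^ Q) = poly g x ^ Q"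
  using poly_frob_poly[of g x] by simp

lemma poly_fixed_power: "frob_poly g = g \<Longrightarrow> poly g (x ^ (Q ^ n)) = poly g x ^ (Q ^ n)"
  by (induction n) (auto simp: power_mult poly_fixed mult.commute[of Q])

lemma poly_fixed_GF: "frob_poly g = g \<Longrightarrow> x \<in> F \<Longrightarrow> poly g x \<in> F"
  using poly_fixed[of g x] by (simp add: GF_def)

definition monics :: "nat \<Rightarrow> 'a poly set" where
  "monics n = {g. degree g = n \<and> lead_coeff g = 1 \<and> frob_poly g = g}"

lemma monics_nz: "g \<in> monics n \<Longrightarrow> g \<noteq> 0"
  by (auto simp: monics_def)

lemma monics_fixed: "g \<in> monics n \<Longrightarrow> frob_poly g = g"
  by (auto simp: monics_def)

lemma monics_degree: "g \<in> monics n \<Longrightarrow> degree g = n"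
  by (auto simp: monics_def)

lemma monics_coeff: "g \<in> monics n \<Longrightarrow> coeff g n = 1"
  unfolding monics_def by auto

lemma finite_monics [simp]: "finite (monics n)"
proof (rule finite_imageD)
  have "coeffs ` monics n \<subseteq> {xs. set xs \<subseteq> F \<and> length xs = Suc n}"
  proof (intro image_subsetI CollectI conjI)
    fix g assume g: "g \<in> monics n"
    show "length (coeffs g) = Suc n"
      using monics_nz[OF g] monics_degree[OF g] by (simp add: length_coeffs)
    show "set (coeffs g) \<subseteq> F"
      using monics_fixed[OF g] by (auto simp: frob_poly_fixed_iff coeffs_def split: if_splits)
  qed
  then show "finite (coeffs ` monics n)"
    by (rule finite_subset) (rule finite_lists_length_eq[OF finite_GF])
  show "inj_on coeffs (monics n)"
    by (auto intro: inj_onI simp: coeffs_eq_iff)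
qed

lemma monics_0: "monics 0 = {1}"
  by (auto simp: monics_def elim!: degree_eq_zeroE)

lemma monics_mult:
  assumes "g \<in> monics m" "h \<in> monics n"
  shows "g * h \<in> monics (m + n)"
proof -
  have "degree (g * h) = m + n"
    using assms by (subst degree_mult_eq) (auto simp: monics_degree monics_nz dest: monics_nz)
  moreover have "lead_coeff (g * h) = 1"
  proof -
    have "lead_coeff g = 1" "lead_coeff h = 1"
      using assms by (auto simp: monics_def)
    then show ?thesis
      by (simp only: lead_coeff_mult) simp
  qed
  ultimately show ?thesis
    using assms unfolding monics_def by (simp add: frob_poly_mult)
qed

lemma monics_divide:
  assumes "c \<in> monics m" "c * g \<in> monics n"
  shows "g \<in> monics (n - m)" "m \<le> n"
proof -
  have nz: "c \<noteq> 0" "g \<noteq> 0"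
    using assms monics_nz by fastforce+
  have "c * frob_poly g = c * g"
    using assms by (metis monics_fixed frob_poly_mult)
  then have "frob_poly g = g"
    using nz by simp
  moreover have "degree g = n - m" "m \<le> n"
    using assms nz by (auto simp: monics_def degree_mult_eq)
  moreover have "lead_coeff g = 1"
    using assms lead_coeff_mult[of c g] unfolding monics_def mem_Collect_eq by (metis mult_1_left)
  ultimately show "g \<in> monics (n - m)" "m \<le> n"
    by (auto simp: monics_def)
qed

text \<open>For \<open>z\<close> in the field with \<open>Q ^ r\<close> elements this is the characteristic polynomial of \<open>z\<close> over the
  field with \<open>Q\<close> elements.\<close>

definition cpoly :: "nat \<Rightarrow> 'a \<Rightarrow> 'a poly" where
  "cpoly r z = (\<Prod>j<r. [:- (z ^ (Q ^ j)), 1:])"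

lemma cpoly_add: "cpoly (a + b) z = cpoly a z * cpoly b (z ^ (Q ^ a))"
  unfolding cpoly_def
  by (induction b) (simp_all add: power_add mult.assoc flip: power_mult del: mult_pCons_left mult_pCons_right)

lemma cpoly_monics:
  assumes "z \<in> GF (Q ^ r)"
  shows "cpoly r z \<in> monics r"
proof -
  define f where "f j = [:- (z ^ (Q ^ j)), 1:]" for j
  have "frob_poly (f j) = f (Suc j)" for j
    by (simp add: f_def frob_poly_pCons frob_minus mult.commute[of Q] flip: power_mult)
  then have "frob_poly (cpoly r z) = (\<Prod>j<r. f (Suc j))"
    by (simp add: cpoly_def frob_poly_prod flip: f_def)
  \<comment> \<open>Frobenius shifts the factors by one place. With \<open>f 0\<close> in front, the
    shifted product is the one over \<open>j < Suc r\<close>, and \<open>f r = f 0\<close> by the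
    hypothesis on \<open>z\<close>; afterwards \<open>f 0\<close> cancels.\<close>
  also have "f 0 * \<dots> = f 0 * (\<Prod>j<r. f j)"
    using assms prod.lessThan_Suc_shift[of f r] prod.lessThan_Suc[of f r]
    by (simp add: f_def GF_def mult.commute del: mult_pCons_left mult_pCons_right)
  then have "(\<Prod>j<r. f (Suc j)) = (\<Prod>j<r. f j)"
    by (metis f_def mult_left_cancel pCons_eq_0_iff zero_neq_one)
  also have "\<dots> = cpoly r z"
    by (simp add: cpoly_def f_def)
  finally have "frob_poly (cpoly r z) = cpoly r z" .
  moreover have "degree (cpoly r z) = r"
    unfolding cpoly_def by (subst degree_prod_eq_sum_degree) auto
  moreover have "lead_coeff (cpoly r z) = 1"
    unfolding cpoly_def by (subst lead_coeff_prod) auto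
  ultimately show ?thesis
    by (simp add: monics_def)
qed

lemma poly_cpoly: "poly (cpoly r z) x = (\<Prod>j<r. x - z ^ (Q ^ j))"
  by (simp add: cpoly_def poly_prod)

text \<open>Frobenius fixes \<open>x\<close>, so the factors are the conjugates of
  \<open>x - z\<close> and their product is its norm. Values at points of \<open>F\<close> are thus
  the way in which characters of norms become multiplicative functions of polynomials.\<close>

lemma poly_cpoly_fixed:
  assumes "x \<in> F"
  shows "poly (cpoly r z) x = (x - z) ^ (\<Sum>j<r. Q ^ j)"
proof -
  have "x - z ^ (Q ^ j) = (x - z) ^ (Q ^ j)" for j
  proof (induction j)
    case (Suc j)
    have "(x - z) ^ (Q ^ Suc j) = ((x - z) ^ (Q ^ j)) ^ Q"
      by (simp add: mult.commute flip: power_mult)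
    also have "\<dots> = x ^ Q - (z ^ (Q ^ j)) ^ Q"
      by (simp only: Suc[symmetric] frob_diff)
    also have "\<dots> = x - z ^ (Q ^ Suc j)"
      using assms by (simp add: GF_def mult.commute flip: power_mult)
    finally show ?case ..
  qed simp
  then show ?thesis
    by (simp add: poly_cpoly power_sum)
qed

text \<open>For \<open>z\<close> algebraic over \<open>GF Q\<close> this is its degree, equivalently
  the length of its Frobenius orbit.\<close>

definition period :: "'a \<Rightarrow> nat" where
  "period z = (LEAST m. m > 0 \<and> z ^ (Q ^ m) = z)"

lemma frob_power_inj: "(x::'a) ^ (Q ^ n) = y ^ (Q ^ n) \<Longrightarrow> x = y"
  by (induction n) (auto simp: power_mult mult.commute[of Q] dest: frob_inj)

lemma power_shift:
  assumes "z ^ (Q ^ i) = z ^ (Q ^ j)" "i \<le> j"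
  shows "z ^ (Q ^ (j - i)) = (z::'a)"
proof (rule frob_power_inj[of _ i])
  have "(z ^ (Q ^ (j - i))) ^ (Q ^ i) = z ^ (Q ^ j)"
    using assms(2) by (simp flip: power_mult power_add)
  with assms(1) show "(z ^ (Q ^ (j - i))) ^ (Q ^ i) = z ^ (Q ^ i)"
    by simp
qed

context
  fixes z :: 'a
  assumes alg: "\<exists>m>0. z ^ (Q ^ m) = z"
begin

lemma period_pos: "period z > 0" and power_period: "z ^ (Q ^ period z) = z"
  using LeastI_ex[OF alg] unfolding period_def by auto

lemma period_le: "m > 0 \<Longrightarrow> z ^ (Q ^ m) = z \<Longrightarrow> period z \<le> m"
  unfolding period_def by (intro Least_le) auto

lemma power_period_mult: "z ^ (Q ^ (period z * k)) = z"
  by (induction k) (simp_all add: power_add power_mult power_period)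

lemma period_dvd_iff: "z ^ (Q ^ r) = z \<longleftrightarrow> period z dvd r"
proof
  assume r: "z ^ (Q ^ r) = z"
  have "z ^ (Q ^ r) = (z ^ (Q ^ (period z * (r div period z)))) ^ (Q ^ (r mod period z))"
    by (simp flip: power_mult power_add)
  then have "z ^ (Q ^ (r mod period z)) = z"
    using r by (simp add: power_period_mult)
  then have "r mod period z = 0"
    using period_le[of "r mod period z"] period_pos mod_less_divisor[of "period z" r] by linarith
  then show "period z dvd r"
    by auto
qed (auto simp: power_period_mult)

lemma inj_on_period: "inj_on (\<lambda>j. z ^ (Q ^ j)) {..<period z}"
proof (rule linorder_inj_onI')
  fix i j assume ij: "i \<in> {..<period z}" "j \<in> {..<period z}" "i < j"
  show "z ^ (Q ^ i) \<noteq> z ^ (Q ^ j)"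
  proof
    assume "z ^ (Q ^ i) = z ^ (Q ^ j)"
    then have "z ^ (Q ^ (j - i)) = z"
      using ij by (intro power_shift) auto
    then show False
      using period_le[of "j - i"] ij by auto
  qed
qed

text \<open>Below the period the conjugates are distinct. So this is the minimal polynomial of
  \<open>z\<close>, and its roots are simple.\<close>

lemma cpoly_period_eq: "cpoly (period z) z = (\<Prod>s\<in>(\<lambda>j. z ^ (Q ^ j)) ` {..<period z}. [:- s, 1:])"
  unfolding cpoly_def by (subst prod.reindex[OF inj_on_period]) simp

lemma order_cpoly_period: "Polynomial.order z (cpoly (period z) z) = 1"
proof -
  have "z \<in> (\<lambda>j. z ^ (Q ^ j)) ` {..<period z}"
    using period_pos by (intro image_eqI[of _ _ 0]) auto
  then show ?thesis
    unfolding cpoly_period_eq by (subst order_prod_linear) auto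
qed

lemma cpoly_period_monics: "cpoly (period z) z \<in> monics (period z)"
  by (rule cpoly_monics) (simp add: GF_def power_period)

lemma cpoly_period_dvd:
  assumes "frob_poly g = g" "poly g z = 0"
  shows "cpoly (period z) z dvd g"
  unfolding cpoly_period_eq
  by (rule prod_linear_dvd) (auto simp: poly_fixed_power assms power_0_left)

lemma cpoly_period_mult: "cpoly (period z * k) z = cpoly (period z) z ^ k"
proof (induction k)
  case (Suc k)
  then show ?case
    using cpoly_add[of "period z" "period z * k" z] by (simp add: power_period)
qed (simp add: cpoly_def)

text \<open>The minimal polynomial divides every such polynomial that vanishes at \<open>z\<close>
  and has a simple zero there, so each division lowers the order at \<open>z\<close> by exactly
  one.\<close>

lemma cpoly_power_dvd_iff:
  assumes "g \<in> monics n"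
  shows "cpoly (period z) z ^ k dvd g \<longleftrightarrow> k \<le> Polynomial.order z g"
proof
  assume "cpoly (period z) z ^ k dvd g"
  moreover have "[:- z, 1:] dvd cpoly (period z) z"
    using order_cpoly_period order_divides[of z 1 "cpoly (period z) z"] by simp
  ultimately have "[:- z, 1:] ^ k dvd g"
    using dvd_power_same dvd_trans by blast
  then show "k \<le> Polynomial.order z g"
    using monics_nz[OF assms] by (simp add: order_divides)
next
  show "k \<le> Polynomial.order z g \<Longrightarrow> cpoly (period z) z ^ k dvd g"
    using assms
  proof (induction k arbitrary: g n)
    case (Suc k)
    have nz: "g \<noteq> 0"
      using Suc.prems(2) by (rule monics_nz)
    then have "poly g z = 0"
      using Suc.prems order_root by (metis Suc_le_D nat.distinct(1))
    then obtain h where h: "g = cpoly (period z) z * h"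
      using cpoly_period_dvd monics_fixed[OF Suc.prems(2)] by (auto elim: dvdE)
    then have "h \<in> monics (n - period z)"
      using Suc.prems(2) cpoly_period_monics monics_divide by blast
    moreover have "k \<le> Polynomial.order z h"
      using Suc.prems(1) nz order_mult[of "cpoly (period z) z" h z] h order_cpoly_period by simp
    ultimately show ?case
      using Suc.IH h by auto
  qed auto
qed

text \<open>The \<open>r\<close> with \<open>z\<close> in \<open>GF (Q ^ r)\<close> are the
  multiples \<open>period z * k\<close>. There \<open>cpoly\<close> is the \<open>k\<close>-th power
  of the minimal polynomial, and divisibility bounds \<open>k\<close> by the order.\<close>

lemma card_cpoly_dvd:
  assumes g: "g \<in> monics n"
  shows "card {r \<in> {1..n}. z \<in> GF (Q ^ r) \<and> cpoly r z dvd g} = Polynomial.order z g"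
proof -
  have "{r \<in> {1..n}. z \<in> GF (Q ^ r) \<and> cpoly r z dvd g} = (\<lambda>k. period z * k) ` {1..Polynomial.order z g}"
  proof (intro equalityI subsetI)
    fix r assume r: "r \<in> {r \<in> {1..n}. z \<in> GF (Q ^ r) \<and> cpoly r z dvd g}"
    then obtain k where k: "r = period z * k"
      by (auto simp: GF_def period_dvd_iff)
    with r have "k \<le> Polynomial.order z g"
      using cpoly_power_dvd_iff[OF g] by (simp add: cpoly_period_mult)
    with k r show "r \<in> (\<lambda>k. period z * k) ` {1..Polynomial.order z g}"
      by (intro image_eqI[of _ _ k]) (auto simp: Suc_le_eq intro: Nat.gr0I)
  next
    fix r assume "r \<in> (\<lambda>k. period z * k) ` {1..Polynomial.order z g}"
    then obtain k where k: "r = period z * k" "1 \<le> k" "k \<le> Polynomial.order z g"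
      by (elim imageE) (metis atLeastAtMost_iff)
    then have dvd: "cpoly r z dvd g"
      using cpoly_power_dvd_iff[OF g] by (simp add: cpoly_period_mult)
    have zr: "z \<in> GF (Q ^ r)"
      by (simp add: GF_def k power_period_mult)
    have "r \<le> n"
      using dvd_imp_degree_le[OF dvd monics_nz[OF g]] monics_degree[OF g]
        monics_degree[OF cpoly_monics[OF zr]] by simp
    with k dvd zr period_pos show "r \<in> {r \<in> {1..n}. z \<in> GF (Q ^ r) \<and> cpoly r z dvd g}"
      by auto
  qed
  moreover have "inj_on (\<lambda>k. period z * k) {1..Polynomial.order z g}"
    using period_pos by (auto intro: inj_onI)
  ultimately show ?thesis
    by (simp add: card_image)
qed

end

text \<open>Frobenius maps the finite root set of \<open>g\<close> into itself, so two iterates of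
  \<open>z\<close> coincide; injectivity removes the smaller number of iterations.\<close>

lemma root_periodic:
  assumes "g \<in> monics n" "poly g z = 0"
  shows "\<exists>m>0. z ^ (Q ^ m) = z"
proof -
  have "range (\<lambda>j. z ^ (Q ^ j)) \<subseteq> {x. poly g x = 0}"
    using assms by (auto simp: poly_fixed_power monics_fixed power_0_left)
  then have "finite (range (\<lambda>j. z ^ (Q ^ j)))"
    using poly_roots_finite[OF monics_nz[OF assms(1)]] finite_subset by blast
  then have "\<not> inj (\<lambda>j. z ^ (Q ^ j))"
    using range_inj_infinite by blast
  then obtain i j where "i < j" "z ^ (Q ^ i) = z ^ (Q ^ j)"
    by (metis injI linorder_neqE_nat)
  then show ?thesis
    using power_shift[of z i j] by (intro exI[of _ "j - i"]) auto
qed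

lemma finite_GF_ext: "finite (GF (Q ^ r) :: 'a set)" if "r > 0"
  using galois_field.finite_GF[OF extension[OF that]] .

text \<open>This is the analogue of log n being the sum of the von Mangoldt function over the
  divisors of n. Exchanging the sums over \<open>r\<close> and \<open>z\<close> counts the roots of
  \<open>g\<close> with multiplicity.\<close>

lemma sum_card_cpoly_dvd:
  assumes g: "g \<in> monics n"
  shows "(\<Sum>r=1..n. card {z \<in> GF (Q ^ r). cpoly r z dvd g}) = n"
proof -
  define R where "R = {z. poly g z = 0}"
  have fin: "finite R"
    unfolding R_def by (rule poly_roots_finite[OF monics_nz[OF g]])
  have "poly (cpoly r z) z = 0" if "r > 0" for r z
    using that by (auto simp: poly_cpoly intro!: bexI[of _ 0])
  then have sub: "{z \<in> GF (Q ^ r). cpoly r z dvd g} = {z \<in> R. z \<in> GF (Q ^ r) \<and> cpoly r z dvd g}" if "r > 0" for r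
    using that by (auto simp: R_def elim!: dvdE)
  have "(\<Sum>r=1..n. card {z \<in> GF (Q ^ r). cpoly r z dvd g}) =
      (\<Sum>r=1..n. \<Sum>z\<in>R. if z \<in> GF (Q ^ r) \<and> cpoly r z dvd g then 1 else 0)"
    by (intro sum.cong refl) (simp add: sub sum.If_cases fin Int_def)
  also have "\<dots> = (\<Sum>z\<in>R. \<Sum>r=1..n. if z \<in> GF (Q ^ r) \<and> cpoly r z dvd g then 1 else 0)"
    by (rule sum.swap)
  also have "\<dots> = (\<Sum>z\<in>R. card {r \<in> {1..n}. z \<in> GF (Q ^ r) \<and> cpoly r z dvd g})"
    by (intro sum.cong refl) (simp add: sum.If_cases Int_def)
  also have "\<dots> = (\<Sum>z\<in>R. Polynomial.order z g)"
    by (intro sum.cong refl card_cpoly_dvd root_periodic g) (use g in \<open>auto simp: R_def\<close>)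
  also have "\<dots> = n"
    unfolding R_def using sum_order_roots[OF monics_nz[OF g]] monics_degree[OF g] by simp
  finally show ?thesis .
qed

text \<open>The logarithmic derivative of the Euler product of \<open>\<psi>\<close>: both sides count each \<open>g\<close> once for every
  pair of a root \<open>z\<close> of \<open>g\<close> and an \<open>r\<close> for which the characteristic polynomial of \<open>z\<close> divides \<open>g\<close>.\<close>

lemma monics_power_sum_recurrence:
  fixes \<psi> :: "'a poly \<Rightarrow> complex"
  assumes mult: "\<And>m n g h. g \<in> monics m \<Longrightarrow> h \<in> monics n \<Longrightarrow> \<psi> (g * h) = \<psi> g * \<psi> h"
  shows "of_nat n * (\<Sum>g\<in>monics n. \<psi> g) =
    (\<Sum>r=1..n. (\<Sum>z\<in>GF (Q ^ r). \<psi> (cpoly r z)) * (\<Sum>g\<in>monics (n - r). \<psi> g))"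
proof -
  have inner: "(\<Sum>g\<in>{g \<in> monics n. cpoly r z dvd g}. \<psi> g) = \<psi> (cpoly r z) * (\<Sum>g\<in>monics (n - r). \<psi> g)"
    if r: "r \<in> {1..n}" and z: "z \<in> GF (Q ^ r)" for r z
  proof -
    note c = cpoly_monics[OF z]
    have "(\<Sum>g\<in>{g \<in> monics n. cpoly r z dvd g}. \<psi> g) = (\<Sum>h\<in>monics (n - r). \<psi> (cpoly r z * h))"
    proof (rule sum.reindex_bij_witness[of _ "\<lambda>h. cpoly r z * h" "\<lambda>g. g div cpoly r z"])
      fix h assume "h \<in> monics (n - r)"
      then show "cpoly r z * h \<in> {g \<in> monics n. cpoly r z dvd g}"
        using monics_mult[OF c, of h "n - r"] r by auto
    qed (use c monics_divide[OF c] monics_nz[OF c] in \<open>auto elim!: dvdE\<close>)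
    also have "\<dots> = (\<Sum>h\<in>monics (n - r). \<psi> (cpoly r z) * \<psi> h)"
      by (intro sum.cong refl mult[OF c])
    finally show ?thesis
      by (simp add: sum_distrib_left)
  qed
  have "of_nat n * (\<Sum>g\<in>monics n. \<psi> g) =
      (\<Sum>g\<in>monics n. (\<Sum>r=1..n. of_nat (card {z \<in> GF (Q ^ r). cpoly r z dvd g})) * \<psi> g)"
    unfolding sum_distrib_left
    by (intro sum.cong refl) (simp only: sum_card_cpoly_dvd flip: of_nat_sum)
  also have "\<dots> = (\<Sum>g\<in>monics n. \<Sum>r=1..n. \<Sum>z\<in>GF (Q ^ r). if cpoly r z dvd g then \<psi> g else 0)"
    unfolding sum_distrib_right
    by (intro sum.cong refl) (simp add: sum.If_cases finite_GF_ext Int_def)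
  also have "\<dots> = (\<Sum>r=1..n. \<Sum>z\<in>GF (Q ^ r). \<Sum>g\<in>monics n. if cpoly r z dvd g then \<psi> g else 0)"
    by (subst sum.swap) (intro sum.cong refl sum.swap)
  also have "\<dots> = (\<Sum>r=1..n. \<Sum>z\<in>GF (Q ^ r). \<psi> (cpoly r z) * (\<Sum>g\<in>monics (n - r). \<psi> g))"
    by (intro sum.cong refl) (simp add: sum.If_cases Int_def inner)
  finally show ?thesis
    by (simp add: sum_distrib_right)
qed

end

section \<open>Legendre sums and the Hasse-Davenport relation\<close>

context galois_field
begin

lemma monics_1: "monics 1 = (\<lambda>c. [:c, 1:]) ` F"
proof (intro equalityI subsetI)
  fix g assume g: "g \<in> monics 1"
  then have "g = [:coeff g 0, 1:]"
    by (intro poly_eqI) (auto simp: monics_def coeff_pCons coeff_eq_0 split: nat.splits)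
  moreover have "coeff g 0 \<in> F"
    using g by (simp add: monics_def frob_poly_fixed_iff)
  ultimately show "g \<in> (\<lambda>c. [:c, 1:]) ` F"
    by blast
qed (auto simp: monics_def frob_poly_pCons GF_def)

lemma sum_monics_1: "(\<Sum>g\<in>monics 1. \<psi> g) = (\<Sum>c\<in>F. \<psi> [:c, 1:])"
  unfolding monics_1 by (subst sum.reindex) (auto intro: inj_onI)

lemma monics_2: "monics 2 = (\<lambda>(b, c). [:c, b, 1:]) ` (F \<times> F)"
proof (intro equalityI subsetI)
  fix g assume g: "g \<in> monics 2"
  then have "g = [:coeff g 0, coeff g 1, 1:]"
    by (intro poly_eqI) (auto simp: monics_def coeff_pCons coeff_eq_0 numeral_2_eq_2 split: nat.splits)
  moreover have "coeff g 0 \<in> F" "coeff g 1 \<in> F"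
    using g by (auto simp: monics_def frob_poly_fixed_iff)
  ultimately show "g \<in> (\<lambda>(b, c). [:c, b, 1:]) ` (F \<times> F)"
    by (intro image_eqI[of _ _ "(coeff g 1, coeff g 0)"]) auto
qed (auto simp: monics_def frob_poly_pCons GF_def numeral_2_eq_2)

lemma sum_monics_2: "(\<Sum>g\<in>monics 2. \<psi> g) = (\<Sum>b\<in>F. \<Sum>c\<in>F. \<psi> [:c, b, 1:])"
  unfolding monics_2 by (subst sum.reindex) (auto intro!: inj_onI simp: sum.cartesian_product prod.case_distrib)

text \<open>As \<open>w\<close> has degree below \<open>n\<close>, translation by a multiple of it
  permutes the monic polynomials of degree \<open>n\<close>. Averaging over the multiples reduces
  the sum to sums along lines.\<close>

lemma sum_monics_vanish:
  fixes \<psi> :: "'a poly \<Rightarrow> complex"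
  assumes w: "frob_poly w = w" "degree w < n"
    and sum0: "\<And>g. g \<in> monics n \<Longrightarrow> (\<Sum>s\<in>F. \<psi> (g + Polynomial.smult s w)) = 0"
  shows "(\<Sum>g\<in>monics n. \<psi> g) = 0"
proof -
  have closed: "g + Polynomial.smult s w \<in> monics n" if g: "g \<in> monics n" and s: "s \<in> F" for g s
  proof -
    have deg: "degree (Polynomial.smult s w) < degree g"
      using w(2) monics_degree[OF g] by (meson degree_smult_le order_le_less_trans)
    have "degree (g + Polynomial.smult s w) = n"
      using degree_add_eq_left[OF deg] monics_degree[OF g] by simp
    moreover have "lead_coeff (g + Polynomial.smult s w) = 1"
      using monics_coeff[OF g] deg degree_add_eq_left[OF deg] monics_degree[OF g] coeff_eq_0[OF deg] by simp
    moreover have "frob_poly (g + Polynomial.smult s w) = g + Polynomial.smult s w"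
      using g w s by (simp add: frob_poly_add frob_poly_smult monics_fixed)
    ultimately show ?thesis
      by (simp add: monics_def)
  qed
  have shift: "(\<Sum>g\<in>monics n. \<psi> (g + Polynomial.smult s w)) = (\<Sum>g\<in>monics n. \<psi> g)" if "s \<in> F" for s
    by (rule sum.reindex_bij_witness[of _ "\<lambda>g. g + Polynomial.smult (- s) w" "\<lambda>g. g + Polynomial.smult s w"])
      (use closed[OF _ GF_minus[OF that]] closed[OF _ that] in auto)
  have "of_nat Q * (\<Sum>g\<in>monics n. \<psi> g) = (\<Sum>s\<in>F. \<Sum>g\<in>monics n. \<psi> (g + Polynomial.smult s w))"
    by (simp add: shift card_GF)
  also have "\<dots> = (\<Sum>g\<in>monics n. \<Sum>s\<in>F. \<psi> (g + Polynomial.smult s w))"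
    by (rule sum.swap)
  also have "\<dots> = 0"
    by (simp add: sum0)
  finally show ?thesis
    using Q_pos by (simp only: mult_eq_0_iff of_nat_eq_0_iff) simp
qed

lemma odd_norm_exponent: "odd (\<Sum>j<r. Q ^ j) \<longleftrightarrow> odd r"
  by (induction r) (use odd_Q in auto)

lemma minus_one_power_norm: "(- 1 :: 'a) ^ (\<Sum>j<r. Q ^ j) = (- 1) ^ r"
  using odd_norm_exponent[of r] by (auto simp: minus_one_power_iff)

text \<open>Minus the \<open>a_v\<close> of the fibre \<open>y^2 = x (x + 1) (x + t)\<close> over
  \<open>F\<close>: each \<open>x\<close> carries \<open>1 + quad_char\<close> affine
  points.\<close>

definition legendre_sum :: "'a \<Rightarrow> complex" where
  "legendre_sum t = (\<Sum>x\<in>F. quad_char Q (x * (x + 1) * (x + t)))"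

text \<open>For fixed \<open>b\<close> the inner sum is \<open>quad_char Q b\<close> times -1 if
  \<open>b \<noteq> 1\<close>, and \<open>Q - 1\<close> if \<open>b = 1\<close>. The terms
  \<open>- quad_char Q b\<close> cancel over all \<open>b\<close>, and the excess \<open>Q\<close>
  at \<open>b = 1\<close> is left.\<close>

lemma sum_quad_char_two_variables:
  "(\<Sum>b\<in>F. \<Sum>a\<in>F. quad_char Q (b * (a * (a + (b - 1))))) = of_nat Q"
proof -
  have "(\<Sum>a\<in>F. quad_char Q (b * (a * (a + (b - 1))))) =
      - quad_char Q b + (if b = 1 then of_nat Q else 0)" if b: "b \<in> F" for b
  proof -
    have "(\<Sum>a\<in>F. quad_char Q (b * (a * (a + (b - 1))))) =
        quad_char Q b * (\<Sum>a\<in>F. quad_char Q (a * (a + (b - 1))))"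
      unfolding sum_distrib_left
      by (intro sum.cong refl quad_char_mult) (use b in \<open>auto intro!: GF_closed\<close>)
    moreover have "(\<Sum>a\<in>F. quad_char Q (a * (a + (b - 1)))) = - 1" if "b \<noteq> 1"
      using that b by (intro sum_quad_char_quadratic) auto
    moreover have "(\<Sum>a\<in>F. quad_char Q (a * a)) = of_nat Q - 1"
    proof -
      have "(\<Sum>a\<in>F. quad_char Q (a * a)) = (\<Sum>a\<in>F - {0}. quad_char Q (a * a))"
        by (simp add: sum.remove[of F 0])
      also have "\<dots> = (\<Sum>a\<in>F - {0}. 1)"
        by (intro sum.cong refl quad_char_of_square) auto
      finally show ?thesis
        using Q_ge by (simp add: card_GF of_nat_diff)
    qed
    ultimately show ?thesis
      by auto
  qed
  then show ?thesis
    by (simp add: sum.distrib sum_negf sum_subtractf sum_quad_char)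
qed

text \<open>The second coefficient: a monic quadratic polynomial is determined by its values at two of the
  three points, and the value at the third is then an affine function of these.\<close>

lemma sum_quad_char_quadratics:
  assumes t: "t \<in> F" "t \<noteq> 0" "t \<noteq> 1"
  shows "(\<Sum>b\<in>F. \<Sum>c\<in>F. quad_char Q (c * (1 - b + c) * (t * t - b * t + c))) = of_nat Q"
proof -
  \<comment> \<open>Scaling \<open>c\<close> by \<open>t\<close> and \<open>b\<close> by
    \<open>1 - t\<close> below turns the product of the three values into \<open>k * k\<close> times
    an expression free of \<open>t\<close>; the square is invisible to the character.\<close>
  define k where "k = t * (1 - t)"
  have k: "k \<in> F" "k \<noteq> 0"
    unfolding k_def using t by (auto intro!: GF_closed)
  have t1: "1 - t \<in> F" "1 - t \<noteq> 0"
    using t by auto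
  have "(\<Sum>b\<in>F. \<Sum>c\<in>F. quad_char Q (c * (1 - b + c) * (t * t - b * t + c))) =
      (\<Sum>c\<in>F. \<Sum>b\<in>F. quad_char Q (c * (1 - b + c) * (t * t - b * t + c)))"
    by (rule sum.swap)
  \<comment> \<open>The new \<open>b\<close> is \<open>1 - b + c\<close>, the value of the quadratic
    at -1; the value at \<open>- t\<close> is expressed through it and through \<open>c\<close>, the
    value at 0.\<close>
  also have "\<dots> = (\<Sum>c\<in>F. \<Sum>b\<in>F. quad_char Q (c * b * (t * t - t - t * c + t * b + c)))"
  proof (rule sum.cong[OF refl])
    fix c assume c: "c \<in> F"
    show "(\<Sum>b\<in>F. quad_char Q (c * (1 - b + c) * (t * t - b * t + c))) =
        (\<Sum>b\<in>F. quad_char Q (c * b * (t * t - t - t * c + t * b + c)))"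
      by (rule sum.reindex_bij_witness[of _ "\<lambda>b. 1 + c - b" "\<lambda>b. 1 + c - b"])
        (use c in \<open>auto simp: algebra_simps intro!: GF_add GF_diff\<close>)
  qed
  also have "\<dots> = (\<Sum>b\<in>F. \<Sum>c\<in>F. quad_char Q (c * b * (t * t - t - t * c + t * b + c)))"
    by (rule sum.swap)
  also have "\<dots> = (\<Sum>b\<in>F. \<Sum>a\<in>F. quad_char Q ((t * a) * b * (t * t - t - t * (t * a) + t * b + t * a)))"
    by (intro sum.cong refl sum_reindex_mult[symmetric] t)
  also have "\<dots> = (\<Sum>b\<in>F. \<Sum>a\<in>F. quad_char Q ((t * a) * ((1 - t) * b) *
      (t * t - t - t * (t * a) + t * ((1 - t) * b) + t * a)))"
    by (rule sum_reindex_mult[OF t1, symmetric])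
  also have "\<dots> = (\<Sum>b\<in>F. \<Sum>a\<in>F. quad_char Q (b * (a * (a + (b - 1)))))"
  proof (intro sum.cong refl)
    fix a b assume ab: "a \<in> F" "b \<in> F"
    have "(t * a) * ((1 - t) * b) * (t * t - t - t * (t * a) + t * ((1 - t) * b) + t * a) =
        (k * k) * (b * (a * (a + (b - 1))))"
      by (simp add: k_def algebra_simps)
    also have "quad_char Q \<dots> = quad_char Q (k * k) * quad_char Q (b * (a * (a + (b - 1))))"
      by (intro quad_char_mult) (use k ab in \<open>auto intro!: GF_closed\<close>)
    finally show "quad_char Q ((t * a) * ((1 - t) * b) *
        (t * t - t - t * (t * a) + t * ((1 - t) * b) + t * a)) = quad_char Q (b * (a * (a + (b - 1))))"
      using k by (simp add: quad_char_of_square)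
  qed
  finally show ?thesis
    by (simp add: sum_quad_char_two_variables)
qed

text \<open>The values of \<open>h\<close> are the coefficients of \<open>1 - a T + Q T^2\<close>
  with \<open>a = - legendre_sum t\<close>. They arise as sums of a multiplicative function over
  monic polynomials, which ties this Euler factor to the Legendre sums over all extensions.\<close>

lemma legendre_local_recurrence:
  assumes t: "t \<in> F" "t \<noteq> 0" "t \<noteq> 1"
  defines "h \<equiv> \<lambda>n. if n = 0 then 1 else if n = 1 then legendre_sum t else if n = 2 then of_nat Q else (0 :: complex)"
  shows "of_nat n * h n =
    (\<Sum>r=1..n. (\<Sum>z\<in>GF (Q ^ r). quad_char (Q ^ r) (z * (z + 1) * (z + t))) * h (n - r))"
proof -
  \<comment> \<open>At \<open>cpoly r z\<close> the three values are the norms of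
    \<open>- z\<close>, \<open>- 1 - z\<close> and \<open>- t - z\<close>. The sign from the degree
    is the norm of a fourth -1, so that the product is the norm of
    \<open>z * (z + 1) * (z + t)\<close>.\<close>
  define \<phi> where "\<phi> g = (- 1) ^ degree g * poly g 0 * poly g (- 1) * poly g (- t)" for g :: "'a poly"
  define \<psi> where "\<psi> g = quad_char Q (\<phi> g)" for g
  have \<phi>_F: "\<phi> g \<in> F" if "g \<in> monics n" for g n
    unfolding \<phi>_def using t monics_fixed[OF that]
    by (intro GF_mult GF_power GF_minus GF_1 GF_0 poly_fixed_GF)
  have \<phi>_mult: "\<phi> (g * h) = \<phi> g * \<phi> h" if "g \<in> monics m" "h \<in> monics n" for g h m n
    unfolding \<phi>_def using that by (simp add: degree_mult_eq monics_nz power_add)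
  have \<psi>_mult: "\<psi> (g * h) = \<psi> g * \<psi> h" if "g \<in> monics m" "h \<in> monics n" for g h m n
    unfolding \<psi>_def \<phi>_mult[OF that] using that by (intro quad_char_mult \<phi>_F)
  have h: "(\<Sum>g\<in>monics n. \<psi> g) = h n" for n
  proof -
    consider "n = 0" | "n = 1" | "n = 2" | "n \<ge> 3"
      by linarith
    then show ?thesis
    proof cases
      case 1
      then show ?thesis
        by (simp add: monics_0 h_def \<psi>_def \<phi>_def)
    next
      case 2
      have "(\<Sum>g\<in>monics 1. \<psi> g) = (\<Sum>c\<in>F. quad_char Q (- (c * (c - 1) * (c - t))))"
        unfolding sum_monics_1 by (simp add: \<psi>_def \<phi>_def)
      also have "\<dots> = (\<Sum>c\<in>F. quad_char Q (- ((- c) * (- c - 1) * (- c - t))))"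
        by (rule sum_reindex_minus[symmetric])
      also have "\<dots> = legendre_sum t"
        unfolding legendre_sum_def by (intro sum.cong refl) (simp add: algebra_simps)
      finally show ?thesis
        using 2 by (simp add: h_def)
    next
      case 3
      have "(\<Sum>g\<in>monics 2. \<psi> g) = (\<Sum>b\<in>F. \<Sum>c\<in>F. quad_char Q (c * (1 - b + c) * (t * t - b * t + c)))"
        unfolding sum_monics_2 by (intro sum.cong refl) (simp add: \<psi>_def \<phi>_def algebra_simps)
      then show ?thesis
        using 3 sum_quad_char_quadratics[OF t] by (simp add: h_def)
    next
      case 4
      \<comment> \<open>This is \<open>(X + 1) (X + t)\<close>: adding multiples of it keeps the
        values at -1 and \<open>- t\<close>, while the value at 0 moves through all of
        \<open>F\<close>, since \<open>w\<close> is \<open>t\<close> there. Its degree is the reason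
        for \<open>n \<ge> 3\<close>.\<close>
      define w where "w = [:t, 1 + t, 1:]"
      have w: "frob_poly w = w" "degree w < n"
        using t 4 by (auto simp: w_def frob_poly_pCons GF_def frob_add)
      have "(\<Sum>g\<in>monics n. \<psi> g) = 0"
      proof (rule sum_monics_vanish[OF w])
        fix g assume g: "g \<in> monics n"
        define c where "c = (- 1) ^ n * poly g (- 1) * poly g (- t)"
        have c: "c \<in> F"
          unfolding c_def using t monics_fixed[OF g] by (intro GF_mult GF_power GF_minus GF_1 poly_fixed_GF)
        have g0: "poly g 0 \<in> F"
          using monics_fixed[OF g] by (intro poly_fixed_GF) auto
        have "\<psi> (g + Polynomial.smult s w) = quad_char Q c * quad_char Q (poly g 0 + t * s)" if s: "s \<in> F" for s
        proof -
          have "degree (Polynomial.smult s w) < degree g"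
            using w(2) monics_degree[OF g] by (meson degree_smult_le order_le_less_trans)
          then have "degree (g + Polynomial.smult s w) = n"
            using degree_add_eq_left[of "Polynomial.smult s w" g] monics_degree[OF g] by simp
          then have "\<phi> (g + Polynomial.smult s w) = c * (poly g 0 + t * s)"
            by (simp add: \<phi>_def c_def w_def algebra_simps)
          then show ?thesis
            unfolding \<psi>_def using c g0 t s by (simp add: quad_char_mult GF_add GF_mult)
        qed
        then have "(\<Sum>s\<in>F. \<psi> (g + Polynomial.smult s w)) =
            quad_char Q c * (\<Sum>s\<in>F. quad_char Q (poly g 0 + t * s))"
          by (simp add: sum_distrib_left)
        then show "(\<Sum>s\<in>F. \<psi> (g + Polynomial.smult s w)) = 0"
          using sum_quad_char_linear[OF g0 t(1,2)] by simp
      qed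
      then show ?thesis
        using 4 by (simp add: h_def)
    qed
  qed
  have p: "\<psi> (cpoly r z) = quad_char (Q ^ r) (z * (z + 1) * (z + t))" if r: "r \<in> {1..n}" and z: "z \<in> GF (Q ^ r)" for r z
  proof -
    have "\<phi> (cpoly r z) = (- 1) ^ r * (0 - z) ^ (\<Sum>j<r. Q ^ j) * (- 1 - z) ^ (\<Sum>j<r. Q ^ j) * (- t - z) ^ (\<Sum>j<r. Q ^ j)"
      unfolding \<phi>_def using t monics_degree[OF cpoly_monics[OF z]]
      by (simp only: poly_cpoly_fixed[OF GF_0] poly_cpoly_fixed[OF GF_minus[OF GF_1]] poly_cpoly_fixed[OF GF_minus[OF t(1)]])
    also have "\<dots> = ((- 1) * (0 - z) * (- 1 - z) * (- t - z)) ^ (\<Sum>j<r. Q ^ j)"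
      unfolding minus_one_power_norm[of r, symmetric] by (simp only: power_mult_distrib)
    also have "(- 1) * (0 - z) * (- 1 - z) * (- t - z) = z * (z + 1) * (z + t)"
      by (simp add: algebra_simps)
    finally show ?thesis
      unfolding \<psi>_def using r by (simp add: quad_char_norm)
  qed
  show ?thesis
    using monics_power_sum_recurrence[where \<psi> = \<psi> and n = n, OF \<psi>_mult] by (simp add: h p)
qed

text \<open>This is J(\<lambda>, \<chi>) with \<open>u + v + 1 = 0\<close> parametrised by
  \<open>u = - x\<close>, \<open>v = x - 1\<close>. These are the value of the linear polynomial
  with root \<open>x\<close> at 0 and minus its value at 1.\<close>

definition jacobi :: "('a \<Rightarrow> complex) \<Rightarrow> complex" where
  "jacobi \<chi> = (\<Sum>x\<in>F. quad_char Q (- x) * \<chi> (x - 1))"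

text \<open>The left side is the Jacobi sum over \<open>GF (Q ^ n)\<close> for \<chi> composed with
  the norm. The series of \<open>\<psi>\<close> is \<open>1 + J T\<close>, so its power sums satisfy
  \<open>p (n + 1) = - J * p n\<close>.\<close>

lemma hasse_davenport:
  fixes \<chi> :: "'a \<Rightarrow> complex"
  assumes \<chi>_mult: "\<And>x y. x \<in> F \<Longrightarrow> y \<in> F \<Longrightarrow> \<chi> (x * y) = \<chi> x * \<chi> y" and \<chi>_1: "\<chi> 1 = 1"
    and n: "n > 0"
  shows "(\<Sum>z\<in>GF (Q ^ n). quad_char (Q ^ n) (- z) * \<chi> ((z - 1) ^ (\<Sum>j<n. Q ^ j))) =
    (- 1) ^ (n - 1) * jacobi \<chi> ^ n"
proof -
  define \<psi> where "\<psi> g = quad_char Q (poly g 0) * \<chi> ((- 1) ^ degree g * poly g 1)" for g :: "'a poly"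
  define p where "p r = (\<Sum>z\<in>GF (Q ^ r). \<psi> (cpoly r z))" for r
  have \<psi>_mult: "\<psi> (g * h) = \<psi> g * \<psi> h" if "g \<in> monics m" "h \<in> monics n" for g h m n
  proof -
    have 0: "poly g 0 \<in> F" "poly h 0 \<in> F" "poly g 1 \<in> F" "poly h 1 \<in> F"
      using that[THEN monics_fixed] by (auto intro!: poly_fixed_GF)
    have "(- 1) ^ degree (g * h) * poly (g * h) 1 = ((- 1) ^ degree g * poly g 1) * ((- 1) ^ degree h * poly h 1)"
      using that by (simp add: degree_mult_eq monics_nz power_add)
    also have "\<chi> \<dots> = \<chi> ((- 1) ^ degree g * poly g 1) * \<chi> ((- 1) ^ degree h * poly h 1)"
      by (intro \<chi>_mult GF_mult GF_power GF_minus GF_1 0)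
    finally show ?thesis
      using quad_char_mult[OF 0(1,2)] by (simp add: \<psi>_def)
  qed
  have h0: "(\<Sum>g\<in>monics 0. \<psi> g) = 1"
    by (simp add: monics_0 \<psi>_def \<chi>_1)
  have h1: "(\<Sum>g\<in>monics 1. \<psi> g) = jacobi \<chi>"
  proof -
    have "(\<Sum>g\<in>monics 1. \<psi> g) = (\<Sum>c\<in>F. quad_char Q c * \<chi> (- c - 1))"
      unfolding sum_monics_1 by (simp add: \<psi>_def)
    also have "\<dots> = (\<Sum>c\<in>F. quad_char Q (- c) * \<chi> (- (- c) - 1))"
      by (rule sum_reindex_minus[symmetric])
    finally show ?thesis
      by (simp add: jacobi_def)
  qed
  have h2: "(\<Sum>g\<in>monics n. \<psi> g) = 0" if n: "n \<ge> 2" for n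
  proof (rule sum_monics_vanish)
    \<comment> \<open>Multiples of \<open>X - 1\<close> preserve the value at 1 and move the value
      at 0 through \<open>F\<close>, where the quadratic character sums to zero. Being linear,
      \<open>X - 1\<close> serves all \<open>n \<ge> 2\<close>.\<close>
    show "frob_poly [:- 1, 1:] = [:- 1, 1:]" "degree [:- 1, 1 :: 'a:] < n"
      using n by (auto simp: frob_poly_pCons frob_minus)
    fix g assume g: "g \<in> monics n"
    have g0: "poly g 0 \<in> F"
      using monics_fixed[OF g] by (intro poly_fixed_GF) auto
    have "\<psi> (g + Polynomial.smult s [:- 1, 1:]) =
        \<chi> ((- 1) ^ n * poly g 1) * quad_char Q (poly g 0 + (- 1) * s)" for s
    proof -
      have "degree (Polynomial.smult s [:- 1, 1:]) < degree g"
        using n monics_degree[OF g] by simp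
      then have "degree (g + Polynomial.smult s [:- 1, 1:]) = n"
        using degree_add_eq_left[of "Polynomial.smult s [:- 1, 1:]" g] monics_degree[OF g] by simp
      then show ?thesis
        by (simp add: \<psi>_def)
    qed
    then have "(\<Sum>s\<in>F. \<psi> (g + Polynomial.smult s [:- 1, 1:])) =
        \<chi> ((- 1) ^ n * poly g 1) * (\<Sum>s\<in>F. quad_char Q (poly g 0 + (- 1) * s))"
      by (simp add: sum_distrib_left)
    also have "(\<Sum>s\<in>F. quad_char Q (poly g 0 + (- 1) * s)) = 0"
      using g0 by (intro sum_quad_char_linear) auto
    finally show "(\<Sum>s\<in>F. \<psi> (g + Polynomial.smult s [:- 1, 1:])) = 0"
      by simp
  qed
  note rec = monics_power_sum_recurrence[where \<psi> = \<psi>, OF \<psi>_mult, folded p_def]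
  have p1: "p 1 = jacobi \<chi>"
    using rec[where n = 1] h0 h1 by simp
  have pn: "p (Suc n) = - jacobi \<chi> * p n" if "n \<ge> 1" for n
  proof -
    have "(\<Sum>r=1..Suc n. p r * (\<Sum>g\<in>monics (Suc n - r). \<psi> g)) =
        (\<Sum>r\<in>{n, Suc n}. p r * (\<Sum>g\<in>monics (Suc n - r). \<psi> g))"
      by (rule sum.mono_neutral_right) (use that h2 in auto)
    also have "\<dots> = p n * jacobi \<chi> + p (Suc n)"
      using h0 h1 by simp
    finally show ?thesis
      using rec[where n = "Suc n"] h2[of "Suc n"] that by (simp add: add_eq_0_iff2 add.commute)
  qed
  have p_eq: "p n = (- 1) ^ (n - 1) * jacobi \<chi> ^ n"
    using n
  proof (induction n rule: nat_induct_non_zero)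
    case (Suc n)
    then have "p (Suc n) = - jacobi \<chi> * ((- 1) ^ (n - 1) * jacobi \<chi> ^ n)"
      using pn[of n] by simp
    also have "\<dots> = (- 1) ^ (Suc n - 1) * jacobi \<chi> ^ Suc n"
      using Suc.hyps by (cases n) simp_all
    finally show ?case .
  qed (simp add: p1[simplified])
  have "\<psi> (cpoly n z) = quad_char (Q ^ n) (- z) * \<chi> ((z - 1) ^ (\<Sum>j<n. Q ^ j))" if z: "z \<in> GF (Q ^ n)" for z
  proof -
    have "(- 1) ^ n * (1 - z) ^ (\<Sum>j<n. Q ^ j) = ((- 1) * (1 - z)) ^ (\<Sum>j<n. Q ^ j)"
      unfolding minus_one_power_norm[of n, symmetric] by (simp only: power_mult_distrib)
    then show ?thesis
      unfolding \<psi>_def poly_cpoly_fixed[OF GF_0] poly_cpoly_fixed[OF GF_1] monics_degree[OF cpoly_monics[OF z]]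
      using n by (simp add: quad_char_norm)
  qed
  then show ?thesis
    using p_eq by (simp add: p_def)
qed

end

section \<open>Characters of order dividing d\<close>

text \<open>\<open>\<Theta>\<close> stands for the Teichmueller lift, of which only the values at the \<open>d\<close>-th roots of unity matter.\<close>

definition torsion_char :: "nat \<Rightarrow> nat \<Rightarrow> ('a::field \<Rightarrow> complex) \<Rightarrow> nat \<Rightarrow> 'a \<Rightarrow> complex" where
  "torsion_char Q d \<Theta> i y = (if y = 0 then 0 else \<Theta> (y ^ ((Q - 1) * i div d)))"

lemma torsion_char_0 [simp]: "torsion_char Q d \<Theta> i 0 = 0"
  by (simp add: torsion_char_def)

context galois_field
begin

text \<open>Replacing \<open>w\<close> by \<open>z * w\<close> makes the cubic equal to
  \<open>z^2 (1 + z) (1 + w)\<close>, so the double sum is \<open>T * T\<close>. As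
  \<open>jacobi \<chi>\<close> is \<open>quad_char Q (- 1) * T\<close>, the sign is lost on
  squaring.\<close>

lemma sum_char_legendre_sum:
  assumes \<chi>_mult: "\<And>x y. x \<in> F \<Longrightarrow> y \<in> F \<Longrightarrow> \<chi> (x * y) = \<chi> x * \<chi> y" and \<chi>_0: "\<chi> 0 = 0"
  shows "(\<Sum>w\<in>F. \<chi> w * legendre_sum w) = (jacobi \<chi>)\<^sup>2"
proof -
  define T where "T = (\<Sum>w\<in>F. \<chi> w * quad_char Q (1 + w))"
  have "jacobi \<chi> = (\<Sum>x\<in>F. quad_char Q (- (x + 1)) * \<chi> ((x + 1) - 1))"
    unfolding jacobi_def by (rule sum_reindex_add[symmetric]) simp
  also have "\<dots> = (\<Sum>x\<in>F. quad_char Q (- 1 :: 'a) * (\<chi> x * quad_char Q (1 + x)))"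
  proof (intro sum.cong refl)
    fix x assume x: "x \<in> F"
    then have "quad_char Q ((- 1) * (1 + x)) = quad_char Q (- 1 :: 'a) * quad_char Q (1 + x)"
      by (intro quad_char_mult) (auto intro!: GF_closed)
    then show "quad_char Q (- (x + 1)) * \<chi> ((x + 1) - 1) = quad_char Q (- 1 :: 'a) * (\<chi> x * quad_char Q (1 + x))"
      by (simp add: algebra_simps)
  qed
  finally have "jacobi \<chi> = quad_char Q (- 1 :: 'a) * T"
    by (simp add: T_def sum_distrib_left)
  then have J: "(jacobi \<chi>)\<^sup>2 = T * T"
    using quad_char_square[of "- 1 :: 'a"] by (simp add: power2_eq_square algebra_simps)
  have "(\<Sum>w\<in>F. \<chi> w * quad_char Q (z * (z + 1) * (z + w))) = \<chi> z * quad_char Q (1 + z) * T"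
    if z: "z \<in> F" for z
  proof (cases "z = 0")
    case False
    have "(\<Sum>w\<in>F. \<chi> w * quad_char Q (z * (z + 1) * (z + w))) =
        (\<Sum>w\<in>F. \<chi> (z * w) * quad_char Q (z * (z + 1) * (z + z * w)))"
      by (rule sum_reindex_mult[OF z False, symmetric])
    also have "\<dots> = (\<Sum>w\<in>F. \<chi> z * quad_char Q (1 + z) * (\<chi> w * quad_char Q (1 + w)))"
    proof (intro sum.cong refl)
      fix w assume w: "w \<in> F"
      have "z * (z + 1) * (z + z * w) = (z * z) * ((1 + z) * (1 + w))"
        by (simp add: algebra_simps)
      also have "quad_char Q \<dots> = quad_char Q (z * z) * (quad_char Q (1 + z) * quad_char Q (1 + w))"
        using z w by (simp add: quad_char_mult GF_closed)
      finally show "\<chi> (z * w) * quad_char Q (z * (z + 1) * (z + z * w)) =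
          \<chi> z * quad_char Q (1 + z) * (\<chi> w * quad_char Q (1 + w))"
        using z w False by (simp add: \<chi>_mult quad_char_of_square)
    qed
    finally show ?thesis
      by (simp add: T_def sum_distrib_left)
  qed (simp add: \<chi>_0)
  then have "(\<Sum>z\<in>F. \<Sum>w\<in>F. \<chi> w * quad_char Q (z * (z + 1) * (z + w))) = T * T"
    by (simp add: T_def flip: sum_distrib_right)
  moreover have "(\<Sum>w\<in>F. \<chi> w * legendre_sum w) =
      (\<Sum>w\<in>F. \<Sum>z\<in>F. \<chi> w * quad_char Q (z * (z + 1) * (z + w)))"
    by (simp add: legendre_sum_def sum_distrib_left)
  ultimately show ?thesis
    using J by (subst (asm) sum.swap) simp
qed

text \<open>Summing over \<open>w\<close> first leaves the character of a linear polynomial. This is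
  the share of the trivial character, which is why the orbit of 0 gives no factor.\<close>

lemma sum_legendre_sum: "(\<Sum>w\<in>F. legendre_sum w) = 0"
proof -
  have "(\<Sum>w\<in>F. quad_char Q (z * (z + 1) * (z + w))) = 0" if z: "z \<in> F" for z
  proof -
    have "(\<Sum>w\<in>F. quad_char Q (z * (z + 1) * (z + w))) =
        (\<Sum>w\<in>F. quad_char Q (z * (z + 1)) * quad_char Q (z + 1 * w))"
      using z by (intro sum.cong refl) (simp add: quad_char_mult GF_closed)
    then show ?thesis
      using sum_quad_char_linear[OF z GF_1] by (simp flip: sum_distrib_left)
  qed
  then have "(\<Sum>z\<in>F. \<Sum>w\<in>F. quad_char Q (z * (z + 1) * (z + w))) = 0"
    by simp
  then show ?thesis
    unfolding legendre_sum_def by (subst sum.swap)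
qed

text \<open>The sum is \<open>- quad_char Q (- 1)\<close>, a sign. It is the Jacobi sum at the index
  \<open>d/2\<close>, whose square has to cancel the contribution of infinity.\<close>

lemma jacobi_quad_char: "(jacobi (quad_char Q))\<^sup>2 = 1"
proof -
  have "jacobi (quad_char Q) = (\<Sum>x\<in>F. quad_char Q (- 1 :: 'a) * quad_char Q (x * (x + (- 1))))"
    unfolding jacobi_def
  proof (intro sum.cong refl)
    fix x assume x: "x \<in> F"
    have "quad_char Q ((- 1) * (x * (x + (- 1)))) = quad_char Q (- x) * quad_char Q (x - 1)"
      using quad_char_mult[of "- x" "x - 1"] x by (simp add: GF_closed)
    moreover have "quad_char Q ((- 1) * (x * (x + (- 1)))) = quad_char Q (- 1 :: 'a) * quad_char Q (x * (x + (- 1)))"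
      using x by (intro quad_char_mult) (auto intro!: GF_closed)
    ultimately show "quad_char Q (- x) * quad_char Q (x - 1) = quad_char Q (- 1 :: 'a) * quad_char Q (x * (x + (- 1)))"
      by simp
  qed
  also have "\<dots> = quad_char Q (- 1 :: 'a) * (- 1)"
    unfolding sum_distrib_left[symmetric] by (subst sum_quad_char_quadratic) (auto intro!: GF_closed)
  finally show ?thesis
    using quad_char_square[of "- 1 :: 'a"] by simp
qed

lemma card_unity_roots:
  assumes "coprime m CHAR('a)" "m > 0"
  shows "card {x :: 'a. x ^ m = 1} = m"
proof -
  define f :: "'a poly" where "f = monom 1 m - 1"
  have deg: "degree f = m"
    unfolding f_def diff_conv_add_uminus using assms(2)
    by (subst degree_add_eq_left) (auto simp: degree_monom_eq)
  have "f \<noteq> 0"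
    using deg assms(2) by auto
  moreover have "of_nat m \<noteq> (0 :: 'a)"
  proof
    assume "of_nat m = (0 :: 'a)"
    then have "CHAR('a) dvd m"
      using of_nat_eq_0_iff_char_dvd by blast
    then show False
      using assms(1) prime_char by (metis coprime_absorb_right not_prime_unit)
  qed
  then have "poly (pderiv f) z \<noteq> 0" if "poly f z = 0" for z
    using that assms(2) by (auto simp: f_def poly_monom pderiv_diff pderiv_monom power_0_left)
  ultimately have "card {z. poly f z = 0} = m"
    using card_roots_separable[of f] deg by simp
  then show ?thesis
    by (simp add: f_def poly_monom)
qed

end

text \<open>\<open>\<Theta>\<close> is an embedding of the \<open>d\<close>-th roots of unity into
  the complex numbers. The assumptions on it do not involve \<open>Q\<close>, so one
  \<open>\<Theta>\<close> defines characters on all fields \<open>GF (Q ^ r)\<close>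
  compatibly.\<close>

locale galois_characters = galois_field Q ty for Q :: nat and ty :: "'a::alg_closed_field itself" +
  fixes d :: nat and \<Theta> :: "'a \<Rightarrow> complex"
  assumes d_pos: "d > 0" and coprime_d: "coprime d CHAR('a)"
    and \<Theta>_mult: "x ^ d = 1 \<Longrightarrow> y ^ d = 1 \<Longrightarrow> \<Theta> (x * y) = \<Theta> x * \<Theta> y"
    and \<Theta>_eq_1_iff: "x ^ d = 1 \<Longrightarrow> \<Theta> x = 1 \<longleftrightarrow> x = 1"
begin

lemma extension_characters: "r > 0 \<Longrightarrow> galois_characters (Q ^ r) d \<Theta>"
  by (intro galois_characters.intro extension galois_characters_axioms.intro)
    (use d_pos coprime_d \<Theta>_mult \<Theta>_eq_1_iff in auto)

lemma \<Theta>_1 [simp]: "\<Theta> 1 = 1"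
  using \<Theta>_eq_1_iff[of 1] by simp

lemma \<Theta>_power: "x ^ d = 1 \<Longrightarrow> \<Theta> (x ^ n) = \<Theta> x ^ n"
proof (induction n)
  case (Suc n)
  then have "(x ^ n) ^ d = 1"
    by (metis mult.commute power_mult power_one)
  with Suc show ?case
    by (simp add: \<Theta>_mult)
qed simp

abbreviation \<chi> :: "nat \<Rightarrow> 'a \<Rightarrow> complex" where
  "\<chi> \<equiv> torsion_char Q d \<Theta>"

text \<open>These are the \<open>i\<close> for which \<chi>_i lives on \<open>F\<close>; elsewhere
  the exponent in \<open>torsion_char\<close> would be a truncated quotient.\<close>

definition indices :: "nat set" where
  "indices = {i \<in> {0..<d}. d dvd (Q - 1) * i}"

lemma exponent_torsion:
  assumes "d dvd (Q - 1) * i" "y \<in> F" "y \<noteq> 0"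
  shows "(y ^ ((Q - 1) * i div d)) ^ d = 1"
proof -
  have "(y ^ ((Q - 1) * i div d)) ^ d = (y ^ (Q - 1)) ^ i"
    using assms(1) by (simp flip: power_mult)
  then show ?thesis
    using GF_nz_power[OF assms(2,3)] by simp
qed

lemma \<chi>_mult:
  assumes "d dvd (Q - 1) * i" "x \<in> F" "y \<in> F"
  shows "\<chi> i (x * y) = \<chi> i x * \<chi> i y"
  using exponent_torsion[OF assms(1,2)] exponent_torsion[OF assms(1,3)]
  by (simp add: torsion_char_def power_mult_distrib \<Theta>_mult)

lemma \<chi>_1 [simp]: "\<chi> i 1 = 1"
  by (simp add: torsion_char_def)

text \<open>The exponent becomes \<open>(Q - 1) div 2\<close>, and injectivity forces
  \<open>\<Theta> (- 1) = - 1\<close>, so Euler's criterion appears.\<close>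

lemma \<chi>_half:
  assumes "even d" "x \<in> F"
  shows "\<chi> (d div 2) x = quad_char Q x"
proof -
  have minus: "\<Theta> (- 1) = - 1"
  proof -
    have d1: "(- 1 :: 'a) ^ d = 1"
      using assms(1) by simp
    have "\<Theta> (- 1) ^ 2 = \<Theta> ((- 1) ^ 2)"
      by (rule \<Theta>_power[OF d1, symmetric])
    then have "\<Theta> (- 1) ^ 2 = 1"
      by simp
    moreover have "\<Theta> (- 1) \<noteq> 1"
      using \<Theta>_eq_1_iff[OF d1] minus_one_neq_one by simp
    ultimately show ?thesis
      by (simp add: power2_eq_1_iff)
  qed
  have "(Q - 1) * (d div 2) = ((Q - 1) div 2) * d"
    using assms(1) odd_Q by (auto elim!: evenE oddE)
  then have "(Q - 1) * (d div 2) div d = (Q - 1) div 2"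
    using d_pos by simp
  then show ?thesis
    using half_power_cases[OF assms(2)] minus minus_one_neq_one
    by (auto simp: torsion_char_def quad_char_def)
qed

lemma indices_gcd:
  defines "\<delta> \<equiv> gcd d (Q - 1)"
  shows "indices = (\<lambda>j. j * (d div \<delta>)) ` {..<\<delta>}"
proof -
  have \<delta>: "\<delta> > 0" "\<delta> dvd d" "\<delta> dvd Q - 1"
    using d_pos by (auto simp: \<delta>_def)
  have d: "d = \<delta> * (d div \<delta>)"
    using \<delta> by simp
  have iff: "d dvd (Q - 1) * i \<longleftrightarrow> d div \<delta> dvd i" for i
  proof -
    have "d dvd (Q - 1) * i \<longleftrightarrow> \<delta> * (d div \<delta>) dvd \<delta> * ((Q - 1) div \<delta> * i)"
      using \<delta> by (simp flip: mult.assoc)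
    also have "\<dots> \<longleftrightarrow> d div \<delta> dvd (Q - 1) div \<delta> * i"
      using \<delta>(1) by simp
    also have "\<dots> \<longleftrightarrow> d div \<delta> dvd i"
      using div_gcd_coprime[of d "Q - 1"] d_pos unfolding \<delta>_def
      by (intro coprime_dvd_mult_right_iff) auto
    finally show ?thesis .
  qed
  have pos: "d div \<delta> > 0"
    using d d_pos by (metis gr0I mult_0_right)
  show ?thesis
  proof (intro equalityI subsetI)
    fix i assume "i \<in> indices"
    then have "d div \<delta> dvd i" "i < d"
      unfolding indices_def iff by auto
    then obtain j where j: "i = j * (d div \<delta>)" "i < d"
      by (metis dvd_def mult.commute)
    then have "j < \<delta>"
      using d pos by (metis mult.commute mult_less_cancel1)
    with j show "i \<in> (\<lambda>j. j * (d div \<delta>)) ` {..<\<delta>}"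
      by auto
  next
    fix i assume "i \<in> (\<lambda>j. j * (d div \<delta>)) ` {..<\<delta>}"
    then obtain j where j: "i = j * (d div \<delta>)" "j < \<delta>"
      by auto
    then have "i < d"
      using d pos by (metis mult.commute mult_less_cancel1)
    with j show "i \<in> indices"
      unfolding indices_def mem_Collect_eq iff by auto
  qed
qed

text \<open>The indices are multiples of \<open>d div \<delta>\<close>, and the characters at them
  take at \<open>w\<close> the powers of \<open>\<Theta> u\<close>, where
  \<open>u ^ \<delta> = 1\<close>. Orthogonality is then a geometric sum.\<close>

lemma sum_indices:
  assumes w: "w \<in> F" "w \<noteq> 0"
  defines "\<delta> \<equiv> gcd d (Q - 1)"
  shows "(\<Sum>i\<in>indices. \<chi> i w) = (if w ^ ((Q - 1) div \<delta>) = 1 then of_nat \<delta> else 0)"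
proof -
  have \<delta>: "\<delta> > 0" "\<delta> dvd d" "\<delta> dvd Q - 1"
    using d_pos by (auto simp: \<delta>_def)
  have pos: "d div \<delta> > 0"
    using \<delta> d_pos by (metis dvd_mult_div_cancel gr0I mult_0_right)
  define u where "u = w ^ ((Q - 1) div \<delta>)"
  have "u ^ \<delta> = 1"
    unfolding u_def using \<delta>(3) GF_nz_power[OF w] by (simp flip: power_mult)
  then have ud: "u ^ d = 1"
    using \<delta>(2) by (metis dvd_def power_mult power_one)
  have val: "\<chi> (j * (d div \<delta>)) w = \<Theta> u ^ j" for j
  proof -
    obtain a b where ab: "Q - 1 = \<delta> * a" "d = \<delta> * b"
      using \<delta> by (elim dvdE)
    have "(Q - 1) * (j * (d div \<delta>)) = ((Q - 1) div \<delta>) * j * d"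
      unfolding ab using \<delta>(1) by simp
    then have E: "(Q - 1) * (j * (d div \<delta>)) div d = (Q - 1) div \<delta> * j"
      using d_pos by (simp only: nonzero_mult_div_cancel_right)
    show ?thesis
      using w(2) by (simp only: torsion_char_def E power_mult u_def[symmetric] \<Theta>_power[OF ud] if_False)
  qed
  have "(\<Sum>i\<in>indices. \<chi> i w) = (\<Sum>j<\<delta>. \<Theta> u ^ j)"
    unfolding indices_gcd \<delta>_def[symmetric]
    by (subst sum.reindex) (use pos in \<open>auto intro!: inj_onI simp: val\<close>)
  also have "\<dots> = (if u = 1 then of_nat \<delta> else 0)"
  proof (cases "u = 1")
    case False
    then have "\<Theta> u \<noteq> 1"
      using \<Theta>_eq_1_iff[OF ud] by simp
    moreover have "\<Theta> u ^ \<delta> = 1"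
      using \<Theta>_power[OF ud, of \<delta>] \<open>u ^ \<delta> = 1\<close> by simp
    ultimately show ?thesis
      using False by (simp add: geometric_sum)
  qed simp
  finally show ?thesis
    by (simp add: u_def)
qed

text \<open>Nonempty fibres of the \<open>d\<close>-th power map on the units have
  \<open>\<delta>\<close> elements, so there are \<open>(Q - 1) div \<delta>\<close> powers. All of
  them satisfy the condition in \<open>sum_indices\<close>, and that equation has no further
  roots.\<close>

lemma card_power_eq:
  assumes w: "w \<in> F" "w \<noteq> 0"
  shows "of_nat (card {x \<in> F. x ^ d = w}) = (\<Sum>i\<in>indices. \<chi> i w)"
proof -
  define \<delta> where "\<delta> = gcd d (Q - 1)"
  have \<delta>: "\<delta> > 0" "\<delta> dvd d" "\<delta> dvd Q - 1"
    using d_pos by (auto simp: \<delta>_def)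
  have unity: "{x \<in> F. x ^ d = 1} = {x. x ^ \<delta> = 1}"
  proof (intro equalityI subsetI CollectI conjI)
    fix x assume x: "x \<in> {x \<in> F. x ^ d = 1}"
    then have "x \<noteq> 0"
      using d_pos by (auto simp: power_0_left)
    with x have x1: "x ^ d = 1" "x ^ (Q - 1) = 1"
      using GF_nz_power by auto
    obtain a b where ab: "d * a = (Q - 1) * b + \<delta>"
      using bezout_nat[of d "Q - 1"] d_pos unfolding \<delta>_def by auto
    have "x ^ (d * a) = x ^ ((Q - 1) * b) * x ^ \<delta>"
      unfolding ab by (rule power_add)
    then show "x ^ \<delta> = 1"
      using x1 by (simp add: power_mult)
  next
    fix x :: 'a assume x: "x \<in> {x. x ^ \<delta> = 1}"
    then have "x \<noteq> 0"
      using \<delta> by (auto simp: power_0_left)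
    moreover have pow: "x ^ k = 1" if "\<delta> dvd k" for k
      using x that by (auto simp: power_mult elim!: dvdE)
    have "x ^ (Q - 1) = 1" "x ^ d = 1"
      using \<delta> by (auto intro!: pow)
    ultimately show "x \<in> F" "x ^ d = 1"
      by (auto simp: GF_nz_iff)
  qed
  have "coprime \<delta> CHAR('a)"
    using \<delta>(2) coprime_d by (meson coprime_divisors dvd_refl)
  then have card_unity: "card {x \<in> F. x ^ d = 1} = \<delta>"
    using \<delta>(1) unfolding unity by (rule card_unity_roots)
  have fibre: "card {x \<in> F. x ^ d = v} = \<delta>" if v: "v = y ^ d" "y \<in> F" "y \<noteq> 0" for v y
  proof -
    have "{x \<in> F. x ^ d = v} = (\<lambda>x. y * x) ` {x \<in> F. x ^ d = 1}"
    proof (intro equalityI subsetI)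
      fix x assume "x \<in> {x \<in> F. x ^ d = v}"
      then show "x \<in> (\<lambda>x. y * x) ` {x \<in> F. x ^ d = 1}"
        using v by (intro image_eqI[of _ _ "x / y"]) (auto simp: power_divide)
    qed (use v in \<open>auto simp: power_mult_distrib\<close>)
    moreover have "inj_on (\<lambda>x. y * x) {x \<in> F. x ^ d = 1}"
      using v by (auto intro: inj_onI)
    ultimately show ?thesis
      by (simp add: card_image card_unity)
  qed
  define m where "m = (Q - 1) div \<delta>"
  have m: "m * \<delta> = Q - 1"
    using \<delta> by (simp add: m_def)
  have "m > 0"
    using m Q_ge by (intro Nat.gr0I) auto
  have "coprime (Q - 1) Q"
    using coprime_diff_one_left_nat[of Q] Q_pos by simp
  then have "coprime (Q - 1) CHAR('a)"
    using Q_power by auto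
  then have "coprime m CHAR('a)"
    using m by (metis coprime_mult_left_iff)
  then have cardU: "card {w :: 'a. w ^ m = 1} = m"
    using \<open>m > 0\<close> by (rule card_unity_roots)
  have fin: "finite {w :: 'a. w ^ m = 1}"
    using cardU \<open>m > 0\<close> by (intro card_ge_0_finite) simp
  define P where "P = (\<lambda>x. x ^ d) ` (F - {0})"
  have PU: "P \<subseteq> {w. w ^ m = 1}"
  proof
    fix v assume "v \<in> P"
    then obtain y where y: "v = y ^ d" "y \<in> F" "y \<noteq> 0"
      by (auto simp: P_def)
    obtain b where "d = \<delta> * b"
      using \<delta>(2) by (elim dvdE)
    then have "d * m = (Q - 1) * (d div \<delta>)"
      using \<delta>(1) m by (simp add: mult_ac)
    then have "v ^ m = (y ^ (Q - 1)) ^ (d div \<delta>)"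
      unfolding y power_mult[symmetric] by simp
    then show "v \<in> {w. w ^ m = 1}"
      using GF_nz_power[OF y(2,3)] by simp
  qed
  have "Q - 1 = (\<Sum>x\<in>F - {0}. 1)"
    by (simp add: card_GF)
  also have "\<dots> = (\<Sum>v\<in>P. \<Sum>x\<in>{x. x \<in> F - {0} \<and> x ^ d = v}. 1)"
    unfolding P_def by (rule sum.image_gen) simp
  also have "\<dots> = (\<Sum>v\<in>P. \<delta>)"
  proof (intro sum.cong refl)
    fix v assume "v \<in> P"
    then obtain y where y: "v = y ^ d" "y \<in> F" "y \<noteq> 0"
      by (auto simp: P_def)
    then have "{x. x \<in> F - {0} \<and> x ^ d = v} = {x \<in> F. x ^ d = v}"
      using d_pos by (auto simp: power_0_left)
    then show "(\<Sum>x\<in>{x. x \<in> F - {0} \<and> x ^ d = v}. 1) = \<delta>"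
      using fibre[OF y] by simp
  qed
  finally have "card P = m"
    using m \<delta>(1) by (metis mult.commute mult_cancel2 neq0_conv sum_constant of_nat_id)
  then have P_eq: "P = {w. w ^ m = 1}"
    using PU cardU fin by (metis card_subset_eq)
  show ?thesis
  proof (cases "w ^ m = 1")
    case True
    then have "w \<in> P"
      by (simp add: P_eq)
    then have "card {x \<in> F. x ^ d = w} = \<delta>"
      using fibre by (auto simp: P_def)
    then show ?thesis
      using sum_indices[OF w] True by (simp add: \<delta>_def m_def)
  next
    case False
    then have "w \<notin> P"
      by (simp add: P_eq)
    then have "{x \<in> F. x ^ d = w} = {}"
      using w(2) d_pos by (auto simp: P_def)
    then show ?thesis
      using sum_indices[OF w] False by (simp only: \<delta>_def[symmetric] m_def[symmetric]) simp
  qed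
qed

text \<open>The trivial character is split off because \<open>torsion_char\<close> is 0 at 0 for
  every index, whereas \<open>x ^ d = 0\<close> has one solution. Replacing it by the constant 1
  gives the unweighted sum.\<close>

lemma sum_over_powers:
  "(\<Sum>x\<in>F. g (x ^ d)) = (\<Sum>w\<in>F. g w) + (\<Sum>i\<in>indices - {0}. \<Sum>w\<in>F. \<chi> i w * g w)"
proof -
  have fin: "finite indices"
    by (simp add: indices_def)
  have i0: "0 \<in> indices"
    using d_pos by (simp add: indices_def)
  have card: "of_nat (card {x \<in> F. x ^ d = w}) = 1 + (\<Sum>i\<in>indices - {0}. \<chi> i w)" if w: "w \<in> F" for w
  proof (cases "w = 0")
    case True
    then have "{x \<in> F. x ^ d = w} = {0}"
      using d_pos by (auto simp: power_0_left)
    then show ?thesis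
      using True by simp
  next
    case False
    have "\<chi> 0 w = 1"
      using False by (simp add: torsion_char_def)
    then show ?thesis
      using card_power_eq[OF w False] by (simp add: sum.remove[OF fin i0])
  qed
  have "(\<Sum>x\<in>F. g (x ^ d)) = (\<Sum>w\<in>F. \<Sum>x\<in>{x \<in> F. x ^ d = w}. g (x ^ d))"
    by (rule sum.group[symmetric]) (auto intro: GF_power)
  also have "\<dots> = (\<Sum>w\<in>F. of_nat (card {x \<in> F. x ^ d = w}) * g w)"
    by (intro sum.cong refl) simp
  also have "\<dots> = (\<Sum>w\<in>F. g w + (\<Sum>i\<in>indices - {0}. \<chi> i w * g w))"
    by (intro sum.cong refl) (simp add: card algebra_simps sum_distrib_left)
  also have "\<dots> = (\<Sum>w\<in>F. g w) + (\<Sum>i\<in>indices - {0}. \<Sum>w\<in>F. \<chi> i w * g w)"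
    unfolding sum.distrib by (subst sum.swap) simp
  finally show ?thesis .
qed

lemma sum_legendre_sum_powers:
  "(\<Sum>x\<in>F. legendre_sum (x ^ d)) - (if even d then 1 else 0) =
    (\<Sum>i\<in>{i \<in> indices. i \<noteq> 0 \<and> 2 * i \<noteq> d}. (jacobi (\<chi> i))\<^sup>2)"
proof -
  have fin: "finite indices"
    by (simp add: indices_def)
  have J: "(\<Sum>w\<in>F. \<chi> i w * legendre_sum w) = (jacobi (\<chi> i))\<^sup>2" if "i \<in> indices" for i
    using that by (intro sum_char_legendre_sum \<chi>_mult) (auto simp: indices_def)
  have total: "(\<Sum>x\<in>F. legendre_sum (x ^ d)) = (\<Sum>i\<in>indices - {0}. (jacobi (\<chi> i))\<^sup>2)"
    unfolding sum_over_powers sum_legendre_sum by (simp add: J)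
  show ?thesis
  proof (cases "even d")
    case True
    have "(Q - 1) * (d div 2) = ((Q - 1) div 2) * d"
      using True odd_Q by (auto elim!: evenE oddE)
    then have mem: "d div 2 \<in> indices - {0}"
      using True d_pos by (auto simp: indices_def elim!: evenE)
    have eq: "indices - {0} - {d div 2} = {i \<in> indices. i \<noteq> 0 \<and> 2 * i \<noteq> d}"
      using True by auto
    have "jacobi (\<chi> (d div 2)) = jacobi (quad_char Q)"
      unfolding jacobi_def by (intro sum.cong refl) (simp add: \<chi>_half True GF_closed)
    then show ?thesis
      using True total sum.remove[OF _ mem, of "\<lambda>i. (jacobi (\<chi> i))\<^sup>2"] fin
      by (simp add: eq jacobi_quad_char)
  next
    case False
    then have "indices - {0} = {i \<in> indices. i \<noteq> 0 \<and> 2 * i \<noteq> d}"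
      by auto
    then show ?thesis
      using False total by simp
  qed
qed

text \<open>Over \<open>GF (Q ^ n)\<close> the character of index \<open>i\<close> is the one over
  \<open>F\<close> composed with the norm, so the Hasse-Davenport relation applies; its sign
  vanishes on squaring.\<close>

lemma jacobi_extension:
  assumes i: "d dvd (Q - 1) * i" and n: "n > 0"
  shows "(galois_field.jacobi (Q ^ n) (torsion_char (Q ^ n) d \<Theta> i))\<^sup>2 = (jacobi (\<chi> i))\<^sup>2 ^ n"
proof -
  interpret E: galois_field "Q ^ n" ty
    by (rule extension) fact
  define N where "N = (\<Sum>j<n. Q ^ j)"
  have N: "(Q - 1) * N = Q ^ n - 1"
    unfolding N_def by (rule norm_exponent)
  have "N > 0"
    unfolding N_def using n by (intro sum_pos) auto
  have "(Q ^ n - 1) * i = N * ((Q - 1) * i)"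
    unfolding N[symmetric] by (simp only: mult_ac)
  then have "(Q ^ n - 1) * i div d = N * ((Q - 1) * i div d)"
    using i by (simp only: div_mult_swap)
  then have "torsion_char (Q ^ n) d \<Theta> i y = \<chi> i (y ^ N)" for y
    using \<open>N > 0\<close> by (simp add: torsion_char_def power_mult)
  then have "E.jacobi (torsion_char (Q ^ n) d \<Theta> i) = (- 1) ^ (n - 1) * jacobi (\<chi> i) ^ n"
    unfolding E.jacobi_def N_def using n by (simp only:) (intro hasse_davenport \<chi>_mult i \<chi>_1)
  then show ?thesis
    by (simp add: power_mult_distrib flip: power_mult) (simp add: mult.commute)
qed

text \<open>Raising to the power \<open>q\<close> permutes \<open>F\<close>, preserves the quadratic
  character since \<open>q\<close> is odd, and turns \<chi>_i into the character of index
  \<open>q * i\<close>. Hence the Jacobi sum depends only on the orbit of the index.\<close>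

lemma jacobi_frob:
  assumes "q > 0" and q: "\<And>x y :: 'a. (x + y) ^ q = x ^ q + y ^ q" "odd q"
    and i: "d dvd (Q - 1) * i" and j: "[q * i = j] (mod d)"
  shows "jacobi (\<chi> j) = jacobi (\<chi> i)"
proof -
  have shift: "\<chi> (i + d * k) y = \<chi> i y" if "y \<in> F" for i k y
  proof (cases "y = 0")
    case False
    have "(Q - 1) * (i + d * k) div d = (Q - 1) * i div d + (Q - 1) * k"
    proof -
      have "(Q - 1) * (i + d * k) = (Q - 1) * i + ((Q - 1) * k) * d"
        by (simp add: algebra_simps)
      then show ?thesis
        using d_pos by simp
    qed
    then show ?thesis
      using GF_nz_power[OF that False] by (simp add: torsion_char_def power_add power_mult)
  qed simp
  have same: "\<chi> j y = \<chi> (q * i) y" if "y \<in> F" for y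
  proof -
    have "\<chi> j y = \<chi> (j mod d) y"
      using shift[OF that, of "j mod d" "j div d"] by simp
    also have "j mod d = q * i mod d"
      using j by (simp add: cong_def)
    also have "\<chi> (q * i mod d) y = \<chi> (q * i) y"
      using shift[OF that, of "q * i mod d" "q * i div d"] by simp
    finally show ?thesis .
  qed
  have mult: "\<chi> (q * i) y = \<chi> i (y ^ q)" for y
  proof -
    have "(Q - 1) * (q * i) div d = q * ((Q - 1) * i div d)"
      using div_mult_swap[OF i, of q] by (simp add: mult_ac)
    then show ?thesis
      using \<open>q > 0\<close> by (simp add: torsion_char_def power_mult)
  qed
  have minus: "(- x) ^ q = - (x ^ q :: 'a)" for x
    using \<open>odd q\<close> by (simp add: power_minus_odd)
  have diff: "(x - y) ^ q = x ^ q - (y ^ q :: 'a)" for x y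
    using q(1)[of x "- y"] by (simp add: minus)
  have "inj_on (\<lambda>x. x ^ q) F"
  proof (rule inj_onI)
    fix x y :: 'a assume "x ^ q = y ^ q"
    then have "(x - y) ^ q = 0"
      by (simp add: diff)
    then show "x = y"
      by simp
  qed
  moreover have "(\<lambda>x. x ^ q) ` F \<subseteq> F"
    by auto
  ultimately have bij: "bij_betw (\<lambda>x. x ^ q) F F"
    by (simp add: bij_betw_def endo_inj_surj)
  have "jacobi (\<chi> j) = (\<Sum>x\<in>F. quad_char Q (- (x ^ q)) * \<chi> i (x ^ q - 1))"
    unfolding jacobi_def
  proof (intro sum.cong refl)
    fix x assume x: "x \<in> F"
    have "quad_char Q (- (x ^ q)) = quad_char Q (- x) ^ q"
      using x by (simp add: quad_char_power GF_closed flip: minus)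
    also have "\<dots> = quad_char Q (- x)"
      using \<open>odd q\<close> \<open>q > 0\<close> by (auto simp: quad_char_def power_0_left)
    finally show "quad_char Q (- x) * \<chi> j (x - 1) = quad_char Q (- (x ^ q)) * \<chi> i (x ^ q - 1)"
      using x by (simp add: same mult GF_closed diff)
  qed
  also have "\<dots> = jacobi (\<chi> i)"
    unfolding jacobi_def by (rule sum.reindex_bij_betw[OF bij])
  finally show ?thesis .
qed

end

section \<open>Orbits of multiplication by q\<close>

context galois_characters
begin

lemma frob_power_add: "(x + y :: 'a) ^ (Q ^ k) = x ^ (Q ^ k) + y ^ (Q ^ k)"
  by (induction k) (simp_all add: power_mult frob_add mult.commute[of Q])

lemma coprime_Q_d: "coprime Q d"
  using Q_power coprime_d by (auto simp: coprime_commute)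

definition orb :: "nat \<Rightarrow> nat set" where
  "orb i = range (\<lambda>n. (Q ^ n * i) mod d)"

lemma mult_orbits_orb: "mult_orbits Q d = orb ` {0..<d}"
  by (simp add: mult_orbits_def orb_def)

lemma dvd_iff_cong: "d dvd (Q ^ n - 1) * i \<longleftrightarrow> [Q ^ n * i = i] (mod d)"
proof -
  have "(Q ^ n - 1) * i = Q ^ n * i - i"
    by (simp add: algebra_simps)
  moreover have "i \<le> Q ^ n * i"
    using Q_pos by (simp add: Suc_le_eq)
  ultimately show ?thesis
    by (metis cong_altdef_nat)
qed

definition orb_period :: "nat \<Rightarrow> nat" where
  "orb_period i = (LEAST m. m > 0 \<and> [Q ^ m * i = i] (mod d))"

lemma orb_period_pos: "orb_period i > 0" and cong_orb_period: "[Q ^ orb_period i * i = i] (mod d)"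
proof -
  have "[Q ^ totient d = 1] (mod d)"
    by (rule euler_theorem) (rule coprime_Q_d)
  then have "[Q ^ totient d * i = 1 * i] (mod d)"
    by (rule cong_mult) (rule cong_refl)
  then have "\<exists>m>0. [Q ^ m * i = i] (mod d)"
    using d_pos by (intro exI[of _ "totient d"]) simp
  from LeastI_ex[OF this] show "orb_period i > 0" "[Q ^ orb_period i * i = i] (mod d)"
    unfolding orb_period_def by auto
qed

lemma cong_orb_period_mult: "[Q ^ (orb_period i * k) * i = i] (mod d)"
proof (induction k)
  case (Suc k)
  have "[Q ^ (orb_period i * k) * (Q ^ orb_period i * i) = Q ^ (orb_period i * k) * i] (mod d)"
    by (intro cong_mult cong_orb_period cong_refl)
  also have "[Q ^ (orb_period i * k) * i = i] (mod d)"
    by (rule Suc)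
  finally show ?case
    by (simp add: power_add mult_ac)
qed simp

text \<open>Links fields of definition with orbit sizes: \<chi>_i exists over
  \<open>GF (Q ^ n)\<close> for just those \<open>n\<close> at which the factor of the orbit of
  \<open>i\<close> has a nontrivial logarithmic coefficient.\<close>

lemma orb_period_dvd_iff: "d dvd (Q ^ n - 1) * i \<longleftrightarrow> orb_period i dvd n"
  unfolding dvd_iff_cong
proof
  assume n: "[Q ^ n * i = i] (mod d)"
  define r where "r = n mod orb_period i"
  have "n = r + orb_period i * (n div orb_period i)"
    by (simp add: r_def)
  then have "Q ^ n * i = Q ^ r * (Q ^ (orb_period i * (n div orb_period i)) * i)"
    by (metis mult.assoc power_add)
  moreover have "[Q ^ r * (Q ^ (orb_period i * (n div orb_period i)) * i) = Q ^ r * i] (mod d)"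
    by (intro cong_mult cong_refl cong_orb_period_mult)
  ultimately have "[Q ^ r * i = i] (mod d)"
    using n by (metis cong_sym cong_trans)
  moreover have "r < orb_period i"
    unfolding r_def by (rule mod_less_divisor) (rule orb_period_pos)
  ultimately have "r = 0"
    using not_less_Least[of r "\<lambda>m. m > 0 \<and> [Q ^ m * i = i] (mod d)"]
    unfolding orb_period_def by (metis gr0I)
  then show "orb_period i dvd n"
    by (auto simp: r_def)
next
  assume "orb_period i dvd n"
  then show "[Q ^ n * i = i] (mod d)"
    using cong_orb_period_mult by auto
qed

lemma orb_eq_image: "orb i = (\<lambda>n. (Q ^ n * i) mod d) ` {..<orb_period i}"
proof (intro equalityI subsetI)
  fix j assume "j \<in> orb i"
  then obtain n where n: "j = (Q ^ n * i) mod d"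
    by (auto simp: orb_def)
  define r where "r = n mod orb_period i"
  have "n = r + orb_period i * (n div orb_period i)"
    by (simp add: r_def)
  then have "Q ^ n * i = Q ^ r * (Q ^ (orb_period i * (n div orb_period i)) * i)"
    by (metis mult.assoc power_add)
  moreover have "[Q ^ r * (Q ^ (orb_period i * (n div orb_period i)) * i) = Q ^ r * i] (mod d)"
    by (intro cong_mult cong_refl cong_orb_period_mult)
  ultimately have "j = (Q ^ r * i) mod d"
    unfolding n by (simp only: cong_def)
  moreover have "r < orb_period i"
    unfolding r_def by (rule mod_less_divisor) (rule orb_period_pos)
  ultimately show "j \<in> (\<lambda>n. (Q ^ n * i) mod d) ` {..<orb_period i}"
    by auto
qed (auto simp: orb_def)

lemma card_orb: "card (orb i) = orb_period i"
proof -
  have "inj_on (\<lambda>n. (Q ^ n * i) mod d) {..<orb_period i}"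
  proof (rule linorder_inj_onI')
    fix a b assume ab: "a \<in> {..<orb_period i}" "b \<in> {..<orb_period i}" "a < b"
    show "(Q ^ a * i) mod d \<noteq> (Q ^ b * i) mod d"
    proof
      assume "(Q ^ a * i) mod d = (Q ^ b * i) mod d"
      moreover have "Q ^ b * i = Q ^ a * (Q ^ (b - a) * i)"
        using ab by (simp flip: mult.assoc power_add)
      ultimately have "[Q ^ a * i = Q ^ a * (Q ^ (b - a) * i)] (mod d)"
        by (simp add: cong_def)
      then have "[i = Q ^ (b - a) * i] (mod d)"
        using coprime_Q_d by (subst (asm) cong_mult_lcancel_nat) auto
      then have "orb_period i dvd b - a"
        unfolding orb_period_dvd_iff[symmetric] dvd_iff_cong by (rule cong_sym)
      then show False
        using ab by (auto dest!: dvd_imp_le)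
    qed
  qed
  then show ?thesis
    unfolding orb_eq_image by (simp add: card_image)
qed

lemma self_in_orb: "i < d \<Longrightarrow> i \<in> orb i"
  unfolding orb_def by (intro image_eqI[of _ _ 0]) auto

lemma orb_less: "j \<in> orb i \<Longrightarrow> j < d"
  using d_pos by (auto simp: orb_def)

lemma orb_subset: "j \<in> orb i \<Longrightarrow> orb j \<subseteq> orb i"
proof
  fix l assume j: "j \<in> orb i" and "l \<in> orb j"
  then obtain n k where "j = (Q ^ k * i) mod d" "l = (Q ^ n * j) mod d"
    by (auto simp: orb_def)
  then have "l = (Q ^ (n + k) * i) mod d"
    by (simp add: mod_mult_right_eq power_add mult.assoc)
  then show "l \<in> orb i"
    by (auto simp: orb_def)
qed

lemma orb_eq:
  assumes "i < d" "j \<in> orb i"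
  shows "orb j = orb i"
proof -
  obtain k where j: "j = (Q ^ k * i) mod d"
    using assms by (auto simp: orb_def)
  \<comment> \<open>As the period is positive, \<open>k\<close> steps can be completed to
    \<open>k\<close> full turns; this leads from \<open>j\<close> back to \<open>i\<close> by
    further multiplications with \<open>Q\<close>.\<close>
  have k: "orb_period i * k - k + k = orb_period i * k"
    using orb_period_pos[of i] by simp
  have "(Q ^ (orb_period i * k - k) * j) mod d = (Q ^ (orb_period i * k - k + k) * i) mod d"
    unfolding j by (simp add: mod_mult_right_eq power_add mult.assoc)
  also have "\<dots> = i"
    unfolding k using cong_orb_period_mult[of i k] assms(1) by (simp add: cong_def)
  finally have "i = (Q ^ (orb_period i * k - k) * j) mod d" ..
  then have "i \<in> orb j"
    unfolding orb_def by (rule range_eqI)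
  then show ?thesis
    using assms(2) orb_subset by blast
qed

lemma orb_0: "orb 0 = {0}"
  by (auto simp: orb_def)

lemma orb_half:
  assumes j: "2 * j = d"
  shows "orb j = {j}"
proof -
  have "(Q ^ n * j) mod d = j" for n
  proof -
    have "odd (Q ^ n)"
      using odd_Q by simp
    then obtain b where "Q ^ n = 2 * b + 1"
      by (rule oddE)
    then have "Q ^ n * j = j + b * d"
      using j by (simp add: algebra_simps)
    then show ?thesis
      using j d_pos by simp
  qed
  then show ?thesis
    by (auto simp: orb_def)
qed

lemma admissible_orbits_eq: "admissible_orbits Q d = orb ` {i. i < d \<and> i \<noteq> 0 \<and> 2 * i \<noteq> d}"
proof -
  show ?thesis
  proof (intro equalityI subsetI)
    fix orbit assume "orbit \<in> admissible_orbits Q d"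
    then have o: "orbit \<in> orb ` {0..<d}" "orbit \<noteq> {0}" "\<not> (even d \<and> orbit = {d div 2})"
      unfolding admissible_orbits_def mult_orbits_orb by simp_all
    from o(1) obtain i where "orbit = orb i" "i < d"
      by auto
    with o have i: "orbit = orb i" "i < d" "orb i \<noteq> {0}" "\<not> (even d \<and> orb i = {d div 2})"
      by simp_all
    have "i \<noteq> 0"
      using i(3) orb_0 by metis
    moreover have "2 * i \<noteq> d"
    proof
      assume "2 * i = d"
      then have "even d" "i = d div 2"
        by auto
      moreover have "orb i = {i}"
        using \<open>2 * i = d\<close> by (rule orb_half)
      ultimately show False
        using i(4) by metis
    qed
    ultimately show "orbit \<in> orb ` {i. i < d \<and> i \<noteq> 0 \<and> 2 * i \<noteq> d}"
      using i(1,2) by blast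
  next
    fix orbit assume "orbit \<in> orb ` {i. i < d \<and> i \<noteq> 0 \<and> 2 * i \<noteq> d}"
    then obtain i where i: "orbit = orb i" "i < d" "i \<noteq> 0" "2 * i \<noteq> d"
      by auto
    then show "orbit \<in> admissible_orbits Q d"
    proof -
      have "orb i \<noteq> {0}" "\<not> (even d \<and> orb i = {d div 2})"
        using self_in_orb[OF i(2)] i(3,4) by (metis dvd_mult_div_cancel singletonD)+
      then show ?thesis
        using i(1,2) by (simp add: admissible_orbits_def mult_orbits_orb)
    qed
  qed
qed

lemma finite_admissible_orbits: "finite (admissible_orbits Q d)"
  by (simp add: admissible_orbits_eq)

definition jac :: "nat \<Rightarrow> nat \<Rightarrow> complex" where
  "jac m i = galois_field.jacobi (Q ^ m) (torsion_char (Q ^ m) d \<Theta> i)"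

text \<open>The Hasse-Davenport relation descends from \<open>n\<close> to the size of the orbit,
  and Frobenius invariance then moves \<open>j\<close> to the representative that
  \<open>SOME\<close> picks.\<close>

lemma jac_orbit:
  assumes orbit: "orbit \<in> admissible_orbits Q d" and j: "j \<in> orbit"
    and n: "n > 0" "card orbit dvd n"
  shows "(jac n j)\<^sup>2 = (jac (card orbit) (SOME i. i \<in> orbit))\<^sup>2 ^ (n div card orbit)"
proof -
  obtain i where i: "orbit = orb i" "i < d"
    using orbit by (auto simp: admissible_orbits_eq)
  define m where "m = card orbit"
  define l where "l = (SOME i. i \<in> orbit)"
  have l: "l \<in> orbit"
    unfolding l_def using j by (rule someI)
  have orb_l: "orb l = orbit" and orb_j: "orb j = orbit"
    using i j l orb_eq by auto
  have m: "m > 0" "m = orb_period l" "m = orb_period j"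
    using orb_l orb_j card_orb[of l] card_orb[of j] orb_period_pos[of l] by (auto simp: m_def)
  interpret E: galois_characters "Q ^ m" ty d \<Theta>
    by (rule extension_characters) fact
  have dj: "d dvd (Q ^ m - 1) * j" and dl: "d dvd (Q ^ m - 1) * l"
    unfolding orb_period_dvd_iff using m by simp_all
  have nm: "n = m * (n div m)" "n div m > 0"
    using n m by (auto simp: m_def dvd_imp_le div_greater_zero_iff)
  have "(jac n j)\<^sup>2 = (jac m j)\<^sup>2 ^ (n div m)"
    unfolding jac_def using E.jacobi_extension[OF dj nm(2)] nm(1) by (metis power_mult)
  moreover obtain k where "j = (Q ^ k * l) mod d"
    using j orb_l by (auto simp: orb_def)
  then have "jac m j = jac m l"
    unfolding jac_def
    by (intro E.jacobi_frob[of "Q ^ k"]) (use dl odd_Q in \<open>auto simp: frob_power_add cong_def\<close>)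
  ultimately show ?thesis
    by (simp add: m_def l_def)
qed

text \<open>The indices available over \<open>GF (Q ^ n)\<close> fall into whole orbits. An orbit
  gives \<open>card orbit\<close> equal terms, which together are the coefficient at
  \<open>n\<close> of minus the logarithmic derivative of its factor.\<close>

theorem global_count:
  assumes n: "n > 0"
  shows "(\<Sum>x\<in>(GF (Q ^ n) :: 'a set). galois_field.legendre_sum (Q ^ n) (x ^ d)) - (if even d then 1 else 0) =
    (\<Sum>orbit\<in>{orbit \<in> admissible_orbits Q d. card orbit dvd n}.
      of_nat (card orbit) * (jac (card orbit) (SOME i. i \<in> orbit))\<^sup>2 ^ (n div card orbit))"
proof -
  interpret E: galois_characters "Q ^ n" ty d \<Theta>
    by (rule extension_characters) fact
  define S where "S = {i \<in> E.indices. i \<noteq> 0 \<and> 2 * i \<noteq> d}"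
  have S: "S = {i. i < d \<and> i \<noteq> 0 \<and> 2 * i \<noteq> d \<and> orb_period i dvd n}"
    unfolding S_def E.indices_def orb_period_dvd_iff by auto
  have "(\<Sum>x\<in>GF (Q ^ n). E.legendre_sum (x ^ d)) - (if even d then 1 else 0) = (\<Sum>i\<in>S. (jac n i)\<^sup>2)"
    using E.sum_legendre_sum_powers by (simp add: S_def jac_def)
  also have "\<dots> = (\<Sum>orbit\<in>orb ` S. \<Sum>i\<in>{i. i \<in> S \<and> orb i = orbit}. (jac n i)\<^sup>2)"
    by (rule sum.image_gen) (simp add: S)
  also have "orb ` S = {orbit \<in> admissible_orbits Q d. card orbit dvd n}"
    unfolding S admissible_orbits_eq by (auto simp: card_orb)
  also have "(\<Sum>orbit\<in>\<dots>. \<Sum>i\<in>{i. i \<in> S \<and> orb i = orbit}. (jac n i)\<^sup>2) =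
      (\<Sum>orbit\<in>{orbit \<in> admissible_orbits Q d. card orbit dvd n}.
        of_nat (card orbit) * (jac (card orbit) (SOME i. i \<in> orbit))\<^sup>2 ^ (n div card orbit))"
  proof (rule sum.cong[OF refl])
    fix orbit assume orbit: "orbit \<in> {orbit \<in> admissible_orbits Q d. card orbit dvd n}"
    then obtain i where i: "orbit = orb i" "i < d" "i \<noteq> 0" "2 * i \<noteq> d"
      by (auto simp: admissible_orbits_eq)
    have eq: "{i. i \<in> S \<and> orb i = orbit} = orbit"
    proof (intro equalityI subsetI)
      fix j assume "j \<in> {i. i \<in> S \<and> orb i = orbit}"
      then show "j \<in> orbit"
        using self_in_orb[of j] by (auto simp: S)
    next
      fix j assume j: "j \<in> orbit"
      have oj: "orb j = orbit" "j < d"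
        using orb_eq[OF i(2), of j] j orb_less i by auto
      have "i \<in> orb j"
        using self_in_orb[OF i(2)] oj i by simp
      then have "j \<noteq> 0"
        using i(3) orb_0 by (metis singletonD)
      moreover have "2 * j \<noteq> d"
        using orb_half[of j] i(4) \<open>i \<in> orb j\<close> by (metis singletonD)
      ultimately show "j \<in> {i. i \<in> S \<and> orb i = orbit}"
        using oj orbit card_orb[of j] by (auto simp: S)
    qed
    show "(\<Sum>i\<in>{i. i \<in> S \<and> orb i = orbit}. (jac n i)\<^sup>2) =
        of_nat (card orbit) * (jac (card orbit) (SOME i. i \<in> orbit))\<^sup>2 ^ (n div card orbit)"
    proof -
      have "(\<Sum>i\<in>orbit. (jac n i)\<^sup>2) =
          (\<Sum>i\<in>orbit. (jac (card orbit) (SOME i. i \<in> orbit))\<^sup>2 ^ (n div card orbit))"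
        using orbit n by (intro sum.cong refl jac_orbit) auto
      then show ?thesis
        unfolding eq by simp
    qed
  qed
  finally show ?thesis .
qed

end

section \<open>Prime ideals over p\<close>

lemma ev_add:
  fixes x :: "'a::comm_ring_1"
  shows "poly (map_poly of_int (g + h)) x = poly (map_poly of_int g) x + poly (map_poly of_int h) x"
proof -
  have "map_poly of_int (g + h) = (map_poly of_int g + map_poly of_int h :: 'a poly)"
    by (intro poly_eqI) (simp add: coeff_map_poly)
  then show ?thesis
    by simp
qed

lemma ev_mult:
  fixes x :: "'a::comm_ring_1"
  shows "poly (map_poly of_int (g * h)) x = poly (map_poly of_int g) x * poly (map_poly of_int h) x"
  by (subst map_poly_mult_hom) auto

lemma ev_const: "poly (map_poly of_int [:c:]) (x :: 'a::comm_ring_1) = of_int c"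
  by (simp add: map_poly_pCons)

lemma ev_monom: "poly (map_poly of_int (monom c n)) (x :: 'a::comm_ring_1) = of_int c * x ^ n"
  by (simp add: map_poly_monom poly_monom)

lemma ev_uminus: "poly (map_poly of_int (- g)) (x :: 'a::comm_ring_1) = - poly (map_poly of_int g) x"
  using ev_mult[of "[:- 1:]" g x] by (simp add: map_poly_pCons)

lemma ev_diff:
  "poly (map_poly of_int (g - h)) (x :: 'a::comm_ring_1) = poly (map_poly of_int g) x - poly (map_poly of_int h) x"
  using ev_add[of g "- h" x] by (simp add: ev_uminus)

lemmas ev_simps = ev_add ev_mult ev_const ev_monom ev_diff

text \<open>If such an ideal contains a monic polynomial, then it is generated by \<open>p\<close> and a monic element of
  minimal degree.\<close>

locale int_poly_ideal =
  fixes I :: "int poly set" and p :: nat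
  assumes add: "g \<in> I \<Longrightarrow> h \<in> I \<Longrightarrow> g + h \<in> I" and mult: "h \<in> I \<Longrightarrow> g * h \<in> I"
    and p_in: "[:int p:] \<in> I" and prime_p: "prime p"
begin

lemma diff: "g \<in> I \<Longrightarrow> h \<in> I \<Longrightarrow> g - h \<in> I"
  using add[of g "- h"] mult[of h "- 1"] by simp

lemma monom_p: "int p dvd c \<Longrightarrow> monom c n \<in> I"
proof (elim dvdE)
  fix k assume "c = int p * k"
  then have "monom c n = monom k n * [:int p:]"
    by (simp add: smult_monom mult.commute)
  then show "monom c n \<in> I"
    using mult[OF p_in] by simp
qed

context
  fixes h0 :: "int poly"
  assumes h0: "h0 \<in> I" "lead_coeff h0 = 1"
    and minimal: "\<And>g. g \<in> I \<Longrightarrow> lead_coeff g = 1 \<Longrightarrow> degree h0 \<le> degree g"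
begin

text \<open>A leading coefficient prime to \<open>p\<close> could be normalised to 1 inside the
  ideal, against the minimality of \<open>h0\<close>. So it is divisible by \<open>p\<close>, its
  term may be dropped, and the degree falls.\<close>

lemma small_degree_dvd: "r \<in> I \<Longrightarrow> degree r < degree h0 \<Longrightarrow> int p dvd coeff r i"
proof (induction "degree r" arbitrary: r rule: less_induct)
  case less
  define n where "n = degree r"
  define c where "c = coeff r n"
  show ?case
  proof (cases "r = 0")
    case False
    have dvd: "int p dvd c"
    proof (rule ccontr)
      assume "\<not> int p dvd c"
      then have "coprime c (int p)"
        using prime_p by (metis coprime_commute prime_imp_coprime prime_nat_int_transfer)
      then obtain e where "[c * e = 1] (mod int p)"
        using cong_solve_coprime_int by blast
      then have e: "int p dvd c * e - 1"
        by (simp add: cong_iff_dvd_diff)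
      \<comment> \<open>\<open>e\<close> inverts \<open>c\<close> modulo \<open>p\<close>; the
        monomial subtracted is in the ideal and corrects the leading coefficient from
        \<open>c * e\<close> to 1.\<close>
      define g where "g = [:e:] * r - monom (c * e - 1) n"
      have "g \<in> I"
        unfolding g_def using less.prems(1) e by (intro diff mult monom_p)
      moreover have gn: "coeff g n = 1"
        by (simp add: g_def c_def mult.commute)
      moreover have "degree g = n"
      proof (rule antisym)
        show "degree g \<le> n"
          by (rule degree_le) (auto simp: g_def n_def coeff_eq_0)
        show "n \<le> degree g"
          using gn by (intro le_degree) auto
      qed
      ultimately show False
        using minimal[of g] less.prems(2) by (simp add: n_def)
    qed
    define s where "s = r - monom c n"
    have sI: "s \<in> I"
      unfolding s_def using less.prems(1) dvd by (intro diff monom_p)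
    have s_coeff: "coeff s i = (if i < n then coeff r i else 0)" for i
      by (auto simp: s_def c_def n_def coeff_eq_0)
    have r_coeff: "coeff r i = coeff s i + (if i = n then c else 0)"
      by (simp add: s_def)
    have "int p dvd coeff s i"
    proof (cases "s = 0")
      case False
      then have "degree s < n"
        using s_coeff[of "degree s"] by (auto split: if_splits)
      then show ?thesis
        using less.hyps[of s] sI less.prems(2) by (simp add: n_def)
    qed simp
    then show ?thesis
      unfolding r_coeff using dvd by simp
  qed simp
qed

lemma monic_division:
  assumes "h \<in> I"
  shows "\<exists>g r. h = g * h0 + r \<and> (\<forall>i. int p dvd coeff r i) \<and> (r = 0 \<or> degree r < degree h0)"
proof -
  have nz: "h0 \<noteq> 0"
    using h0(2) by auto
  obtain g r where gr: "pseudo_divmod h h0 = (g, r)"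
    by force
  have eq: "h = h0 * g + r" and deg: "r = 0 \<or> degree r < degree h0"
    using pseudo_divmod[OF nz gr] h0(2) by auto
  have "r = h - g * h0"
    using eq by (simp add: mult.commute)
  then have "r \<in> I"
    using assms h0(1) diff mult by simp
  then have "int p dvd coeff r i" for i
    using small_degree_dvd[of r i] deg by auto
  then show ?thesis
    using eq deg by (intro exI[of _ g] exI[of _ r]) (simp add: mult.commute)
qed

text \<open>Vanishing of \<open>h0\<close> at \<open>a\<close> suffices for the whole ideal, because
  the remainders in \<open>monic_division\<close> have coefficients divisible by
  \<open>p\<close>.\<close>

lemma ev_eq_0:
  assumes "h \<in> I" "of_nat p = (0 :: 'a::comm_ring_1)" "poly (map_poly of_int h0) (a :: 'a) = 0"
  shows "poly (map_poly of_int h) a = 0"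
proof -
  obtain g r where gr: "h = g * h0 + r" "\<forall>i. int p dvd coeff r i"
    using monic_division[OF assms(1)] by blast
  have "of_int (coeff r i) = (0 :: 'a)" for i
    using gr(2)[rule_format, of i] assms(2) by (auto elim!: dvdE)
  then have "map_poly of_int r = (0 :: 'a poly)"
    by (intro poly_eqI) (simp add: coeff_map_poly)
  then show ?thesis
    using assms(3) by (simp add: gr(1) ev_simps)
qed

end

end

text \<open>This is maximality of nonzero primes in the principal ideal domain F_p[X]. The minimal
  monic \<open>g\<close> of the larger ideal divides \<open>h0\<close> modulo \<open>p\<close>;
  primality of \<open>I2\<close> and minimality of \<open>h0\<close> exclude a smaller
  degree.\<close>

lemma int_poly_ideals_eq:
  assumes I1: "int_poly_ideal I1 p" "1 \<notin> I1" and I2: "int_poly_ideal I2 p"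
    and prime: "\<And>g h. g * h \<in> I2 \<Longrightarrow> g \<in> I2 \<or> h \<in> I2"
    and sub: "I2 \<subseteq> I1"
    and h0: "h0 \<in> I2" "lead_coeff h0 = 1"
    and minimal: "\<And>g. g \<in> I2 \<Longrightarrow> lead_coeff g = 1 \<Longrightarrow> degree h0 \<le> degree g"
  shows "I1 = I2"
proof
  interpret I1: int_poly_ideal I1 p by fact
  interpret I2: int_poly_ideal I2 p by fact
  define S where "S = {g \<in> I1. lead_coeff g = 1}"
  have "h0 \<in> S"
    using h0 sub by (auto simp: S_def)
  then obtain g where g: "g \<in> S" "\<And>g'. g' \<in> S \<Longrightarrow> degree g \<le> degree g'"
    using ex_has_least_nat[of "\<lambda>g. g \<in> S" h0 degree] by blast
  have gI: "g \<in> I1" "lead_coeff g = 1" and gmin: "\<And>g'. g' \<in> I1 \<Longrightarrow> lead_coeff g' = 1 \<Longrightarrow> degree g \<le> degree g'"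
    using g by (auto simp: S_def)
  have g0: "degree g > 0"
  proof (rule ccontr)
    assume "\<not> degree g > 0"
    then have "g = 1"
      using gI(2) by (auto elim!: degree_eq_zeroE)
    then show False
      using gI(1) I1(2) by simp
  qed
  have "degree h0 \<le> degree g"
  proof (rule ccontr)
    assume less: "\<not> degree h0 \<le> degree g"
    obtain u r where ur: "h0 = u * g + r" "\<forall>i. int p dvd coeff r i" "r = 0 \<or> degree r < degree g"
      using I1.monic_division[OF gI gmin subsetD[OF sub h0(1)]] by blast
    have r: "degree r < degree h0"
      using ur(3) less g0 by auto
    have u0: "u \<noteq> 0" "g \<noteq> 0"
      using r ur(1) g0 by auto
    have ug: "u * g = h0 - r"
      using ur(1) by simp
    have "degree (u * g) = degree h0"
      unfolding ug diff_conv_add_uminus by (rule degree_add_eq_left) (use r in simp)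
    then have deg: "degree u + degree g = degree h0"
      using u0 by (simp add: degree_mult_eq)
    have "lead_coeff (u * g) = 1"
      unfolding \<open>degree (u * g) = degree h0\<close> unfolding ug using h0(2) r by (simp add: coeff_eq_0)
    then have lu: "lead_coeff u = 1"
      using gI(2) by (simp only: lead_coeff_mult mult_1_right)
    have "r = Polynomial.smult (int p) (map_poly (\<lambda>c. c div int p) r)"
      by (intro poly_eqI) (simp add: coeff_map_poly ur(2))
    then have "r = map_poly (\<lambda>c. c div int p) r * [:int p:]"
      by simp
    then have "r \<in> I2"
      using I2.mult[OF I2.p_in] by metis
    then have "u * g \<in> I2"
      unfolding ug using h0(1) by (intro I2.diff)
    then show False
      using prime[of u g] minimal[of u] minimal[of g] lu gI(2) less g0 deg by auto
  qed
  then have min1: "\<And>g'. g' \<in> I1 \<Longrightarrow> lead_coeff g' = 1 \<Longrightarrow> degree h0 \<le> degree g'"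
    using gmin le_trans by blast
  show "I1 \<subseteq> I2"
  proof
    fix h assume "h \<in> I1"
    then obtain u r where ur: "h = u * h0 + r" "\<forall>i. int p dvd coeff r i"
      using I1.monic_division[OF subsetD[OF sub h0(1)] h0(2) min1] by blast
    have "r = Polynomial.smult (int p) (map_poly (\<lambda>c. c div int p) r)"
      by (intro poly_eqI) (simp add: coeff_map_poly ur(2))
    then have "r = map_poly (\<lambda>c. c div int p) r * [:int p:]"
      by simp
    then have "r \<in> I2"
      using I2.mult[OF I2.p_in] by metis
    then show "h \<in> I2"
      unfolding ur(1) using h0(1) by (intro I2.add I2.mult)
  qed
qed (rule sub)

section \<open>Congruences modulo \<open>P\<close> between roots of unity\<close>

locale prime_over =
  fixes P :: "complex set" and p :: nat
  assumes primeideal_P: "primeideal P algebraic_integers" and prime_p: "prime p" and p_in: "of_nat p \<in> P"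
begin

sublocale R: primeideal P algebraic_integers
  by (rule primeideal_P)

lemma carrier_R [simp]: "carrier algebraic_integers = {z. algebraic_int z}"
  and add_R [simp]: "add algebraic_integers = (+)"
  and mult_R [simp]: "monoid.mult algebraic_integers = (*)"
  and zero_R [simp]: "zero algebraic_integers = 0"
  and one_R [simp]: "one algebraic_integers = 1"
  by (auto simp: algebraic_integers_def)

lemma alg_add: "algebraic_int x \<Longrightarrow> algebraic_int y \<Longrightarrow> algebraic_int (x + y :: complex)"
  using R.add.m_closed[of x y] by simp

lemma alg_mult: "algebraic_int x \<Longrightarrow> algebraic_int y \<Longrightarrow> algebraic_int (x * y :: complex)"
  using R.m_closed[of x y] by simp

lemma alg_diff: "algebraic_int x \<Longrightarrow> algebraic_int y \<Longrightarrow> algebraic_int (x - y :: complex)"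
  using alg_add[of x "- y"] by simp

lemma alg_power: "algebraic_int x \<Longrightarrow> algebraic_int (x ^ n :: complex)"
  by (induction n) (auto intro: alg_mult int_imp_algebraic_int)

lemma alg_of_int: "algebraic_int (of_int c :: complex)"
  by (rule int_imp_algebraic_int) simp

lemma alg_1 [simp]: "algebraic_int (1 :: complex)"
  by (rule int_imp_algebraic_int) simp

lemma P_add: "x \<in> P \<Longrightarrow> y \<in> P \<Longrightarrow> x + y \<in> P"
  using additive_subgroup.a_closed[OF R.additive_subgroup_axioms, of x y] by simp

lemma P_mult: "algebraic_int x \<Longrightarrow> y \<in> P \<Longrightarrow> x * y \<in> P"
  using R.I_l_closed[of y x] by simp

lemma P_0 [simp]: "0 \<in> P"
  using additive_subgroup.zero_closed[OF R.additive_subgroup_axioms] by simp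

lemma P_minus: "x \<in> P \<Longrightarrow> - x \<in> P"
  using P_mult[of "- 1" x] by simp

lemma P_diff: "x \<in> P \<Longrightarrow> y \<in> P \<Longrightarrow> x - y \<in> P"
  using P_add[of x "- y"] P_minus[of y] by simp

lemma P_1: "1 \<notin> P"
  using R.one_imp_carrier R.I_notcarr by auto

lemma P_prime: "algebraic_int x \<Longrightarrow> algebraic_int y \<Longrightarrow> x * y \<in> P \<Longrightarrow> x \<in> P \<or> y \<in> P"
  using R.I_prime[of x y] by simp

lemma P_sum: "(\<And>i. i \<in> A \<Longrightarrow> f i \<in> P) \<Longrightarrow> sum f A \<in> P"
  by (induction A rule: infinite_finite_induct) (auto intro: P_add)

lemma P_prod: "finite A \<Longrightarrow> (\<And>i. i \<in> A \<Longrightarrow> algebraic_int (f i)) \<Longrightarrow> prod f A \<in> P \<Longrightarrow> \<exists>i\<in>A. f i \<in> P"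
proof (induction A rule: finite_induct)
  case (insert i A)
  have "algebraic_int (prod f B)" if "B \<subseteq> A" for B
    using finite_subset[OF that insert.hyps(1)] that insert.prems(1)
    by (induction B rule: finite_induct) (auto intro: alg_mult)
  then show ?case
    using insert P_prime[of "f i" "prod f A"] by auto
qed (simp add: P_1)

lemma P_of_nat_coprime: "coprime n p \<Longrightarrow> of_nat n \<notin> P"
proof
  assume n: "coprime n p" "of_nat n \<in> P"
  then have "coprime (int n) (int p)"
    by simp
  then obtain a b where "a * int n + b * int p = 1"
    using bezout_int[of "int n" "int p"] by (metis coprime_imp_gcd_eq_1)
  then have "of_int a * of_nat n + of_int b * of_nat p = (1 :: complex)"
    by (metis of_int_1 of_int_add of_int_mult of_int_of_nat_eq)
  moreover have "of_int a * of_nat n + of_int b * of_nat p \<in> P"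
    using n p_in by (intro P_add P_mult alg_of_int)
  ultimately show False
    using P_1 by simp
qed

lemma alg_root_of_unity: "n > 0 \<Longrightarrow> z ^ n = 1 \<Longrightarrow> algebraic_int (z :: complex)"
  by (rule algebraic_int_root[of 1 "monom 1 n"]) (auto simp: poly_monom degree_monom_eq)

lemma root_of_unity_notin: "n > 0 \<Longrightarrow> z ^ n = 1 \<Longrightarrow> z \<notin> P"
proof
  assume z: "n > 0" "z ^ n = 1" "z \<in> P"
  have "z ^ n = z ^ (n - 1) * z"
    using z(1) by (cases n) auto
  moreover have "algebraic_int (z ^ (n - 1))"
    using z by (intro alg_power alg_root_of_unity)
  ultimately show False
    using z P_mult[of "z ^ (n - 1)" z] P_1 by simp
qed

text \<open>For \<open>z \<noteq> 1\<close> the sum \<open>1 + z + ... + z^(n-1)\<close> is 0, yet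
  modulo \<open>P\<close> it is \<open>n\<close>, which is prime to \<open>p\<close>.\<close>

lemma root_of_unity_cong_1:
  assumes n: "n > 0" "coprime n p" "z ^ n = 1" and z: "z - 1 \<in> P"
  shows "z = 1"
proof (rule ccontr)
  assume "z \<noteq> 1"
  then have "(\<Sum>k<n. z ^ k) = 0"
    using n by (simp add: geometric_sum)
  moreover have alg: "algebraic_int z"
    using n by (intro alg_root_of_unity)
  have "z ^ k - 1 \<in> P" for k
  proof (induction k)
    case (Suc k)
    have "z ^ Suc k - 1 = z * (z ^ k - 1) + (z - 1)"
      by (simp add: algebra_simps)
    then show ?case
      using Suc z alg by (simp only:) (intro P_add P_mult)
  qed simp
  then have "(\<Sum>k<n. z ^ k - 1) \<in> P"
    by (intro P_sum)
  ultimately have "- of_nat n \<in> P"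
    by (simp add: sum_subtractf)
  then have "of_nat n \<in> P"
    using P_minus by force
  then show False
    using P_of_nat_coprime[OF n(2)] by simp
qed

lemma roots_of_unity_cong:
  assumes "n > 0" "coprime n p" "z ^ n = 1" "w ^ n = 1" "z - w \<in> P"
  shows "z = w"
proof -
  have w: "w \<noteq> 0"
    using assms by (auto simp: power_0_left)
  have "inverse w * (z - w) \<in> P"
    using assms by (intro P_mult) (auto intro!: alg_root_of_unity[of n] simp: power_inverse)
  moreover have "inverse w * (z - w) = z / w - 1"
    using w by (simp add: field_simps)
  moreover have "(z / w) ^ n = 1"
    using assms by (simp add: power_divide)
  ultimately have "z / w = 1"
    using root_of_unity_cong_1[of n "z / w"] assms by simp
  then show ?thesis
    using w by simp
qed

abbreviation coset :: "complex \<Rightarrow> complex set" where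
  "coset z \<equiv> P +>\<^bsub>algebraic_integers\<^esub> z"

lemma coset_eq_image: "coset z = (\<lambda>x. x + z) ` P"
  by (auto simp: a_r_coset_def')

lemma coset_eq_iff: "coset z = coset w \<longleftrightarrow> z - w \<in> P"
proof
  assume "coset z = coset w"
  moreover have "z \<in> coset z"
    unfolding coset_eq_image by (intro image_eqI[of _ _ 0]) auto
  ultimately obtain x where "x \<in> P" "z = x + w"
    unfolding coset_eq_image by auto
  then show "z - w \<in> P"
    by simp
next
  assume zw: "z - w \<in> P"
  show "coset z = coset w"
  proof (intro equalityI subsetI)
    fix y assume "y \<in> coset z"
    then obtain x where "x \<in> P" "y = x + z"
      unfolding coset_eq_image by auto
    then show "y \<in> coset w"
      unfolding coset_eq_image using zw
      by (intro image_eqI[of _ _ "x + (z - w)"]) (auto intro: P_add)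
  next
    fix y assume "y \<in> coset w"
    then obtain x where "x \<in> P" "y = x + w"
      unfolding coset_eq_image by auto
    then show "y \<in> coset z"
      unfolding coset_eq_image using zw
      by (intro image_eqI[of _ _ "x - (z - w)"]) (auto intro: P_diff)
  qed
qed

lemma carrier_Fp_bar: "carrier (Fp_bar P) = coset ` {z. algebraic_int z}"
  by (auto simp: Fp_bar_def FactRing_def A_RCOSETS_def RCOSETS_def a_r_coset_def)

lemma zero_Fp_bar: "zero (Fp_bar P) = coset 0"
  by (simp add: Fp_bar_def FactRing_def coset_eq_image)

lemma one_Fp_bar: "one (Fp_bar P) = coset 1"
  by (simp add: Fp_bar_def FactRing_def)

lemma mult_Fp_bar: "algebraic_int z \<Longrightarrow> algebraic_int w \<Longrightarrow> coset z \<otimes>\<^bsub>Fp_bar P\<^esub> coset w = coset (z * w)"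
  using R.rcoset_mult_add[of z w] by (simp add: Fp_bar_def FactRing_def)

lemma add_Fp_bar: "algebraic_int z \<Longrightarrow> algebraic_int w \<Longrightarrow> coset z \<oplus>\<^bsub>Fp_bar P\<^esub> coset w = coset (z + w)"
  using R.a_rcos_sum[of z w] by (simp add: Fp_bar_def FactRing_def)

lemma pow_Fp_bar: "algebraic_int z \<Longrightarrow> coset z [^]\<^bsub>Fp_bar P\<^esub> (n :: nat) = coset (z ^ n)"
  by (induction n) (simp_all add: nat_pow_def one_Fp_bar mult_Fp_bar alg_power mult.commute)

text \<open>Over the complex numbers \<open>z^Q - z\<close> splits into \<open>z\<close> and the
  \<open>z - s\<close> with \<open>s ^ (Q - 1) = 1\<close>. As \<open>P\<close> is prime, it
  contains the product only if it contains a factor.\<close>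

lemma carrier_subfield_of_card:
  assumes Q: "Q > 1"
  shows "carrier (subfield_of_card P Q) = coset ` ({0} \<union> {w. w ^ (Q - 1) = 1})"
proof -
  have Q_eq: "z ^ Q - z = z * (z ^ (Q - 1) - 1)" for z :: complex
    using Q by (cases Q) (auto simp: algebra_simps)
  have alg: "algebraic_int w" if "w ^ (Q - 1) = 1" for w :: complex
    using Q that by (intro alg_root_of_unity[of "Q - 1"]) auto
  define S where "S = {w :: complex. w ^ (Q - 1) = 1}"
  have cardS: "card S = Q - 1" and finS: "finite S"
    unfolding S_def using Q card_roots_unity_eq[of "Q - 1"] finite_roots_unity[of "Q - 1"] by auto
  define f :: "complex poly" where "f = monom 1 (Q - 1) - 1"
  have degf: "degree f = Q - 1"
    unfolding f_def diff_conv_add_uminus using Q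
    by (subst degree_add_eq_left) (auto simp: degree_monom_eq)
  have "(\<Prod>s\<in>S. [:- s, 1:]) dvd f"
    by (rule prod_linear_dvd[OF finS]) (simp add: S_def f_def poly_monom)
  then obtain g where g: "f = (\<Prod>s\<in>S. [:- s, 1:]) * g"
    by (rule dvdE)
  have f0: "f \<noteq> 0"
    using degf Q by auto
  have degS: "degree (\<Prod>s\<in>S. [:- s, 1:]) = Q - 1"
    by (subst degree_prod_eq_sum_degree) (auto simp: cardS)
  have "degree g = 0"
    using degf g f0 degS by (simp add: degree_mult_eq)
  moreover have "lead_coeff f = 1"
    unfolding degf unfolding f_def using Q by (simp add: coeff_eq_0 flip: One_nat_def)
  then have "lead_coeff g = 1"
    unfolding g lead_coeff_mult lead_coeff_prod by simp
  ultimately have "g = 1"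
    by (auto elim!: degree_eq_zeroE)
  then have factor: "z ^ (Q - 1) - 1 = (\<Prod>s\<in>S. z - s)" for z
    using arg_cong[OF g, of "\<lambda>f. poly f z"] by (simp add: f_def poly_monom poly_prod)
  have iff: "z ^ Q - z \<in> P \<longleftrightarrow> (\<exists>w\<in>{0} \<union> S. z - w \<in> P)" if z: "algebraic_int z" for z
  proof
    assume "z ^ Q - z \<in> P"
    then have "z \<in> P \<or> (\<Prod>s\<in>S. z - s) \<in> P"
      unfolding Q_eq factor[symmetric] using z by (intro P_prime alg_diff alg_power alg_1)
    then show "\<exists>w\<in>{0} \<union> S. z - w \<in> P"
    proof
      assume "(\<Prod>s\<in>S. z - s) \<in> P"
      then have "\<exists>s\<in>S. z - s \<in> P"
        using z alg by (intro P_prod finS) (auto simp: S_def intro!: alg_diff)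
      then show ?thesis
        by blast
    qed simp
  next
    assume "\<exists>w\<in>{0} \<union> S. z - w \<in> P"
    then obtain w where w: "w \<in> {0} \<union> S" "z - w \<in> P"
      by blast
    have algw: "algebraic_int w"
      using w(1) alg by (auto simp: S_def)
    have "coset (z ^ Q) = coset (w ^ Q)"
      using w(2) pow_Fp_bar[OF z] pow_Fp_bar[OF algw] coset_eq_iff by metis
    moreover have "w ^ Q = w"
      using w(1) Q_eq[of w] by (auto simp: S_def)
    ultimately have "z ^ Q - w \<in> P"
      by (simp add: coset_eq_iff)
    then have "(z ^ Q - w) - (z - w) \<in> P"
      using w(2) by (rule P_diff)
    then show "z ^ Q - z \<in> P"
      by simp
  qed
  show ?thesis
  proof (intro equalityI subsetI)
    fix x assume "x \<in> carrier (subfield_of_card P Q)"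
    then obtain z where z: "algebraic_int z" "x = coset z" "coset (z ^ Q) = coset z"
      by (auto simp: subfield_of_card_def carrier_Fp_bar pow_Fp_bar)
    then have "\<exists>w\<in>{0} \<union> S. z - w \<in> P"
      using iff[of z] unfolding coset_eq_iff by blast
    then obtain w where "w \<in> {0} \<union> S" "z - w \<in> P"
      by (rule bexE)
    then show "x \<in> coset ` ({0} \<union> {w. w ^ (Q - 1) = 1})"
      using z by (intro image_eqI[of _ _ w]) (auto simp: coset_eq_iff S_def)
  next
    fix x assume "x \<in> coset ` ({0} \<union> {w. w ^ (Q - 1) = 1})"
    then obtain w where w: "x = coset w" "w \<in> {0} \<union> S"
      by (auto simp: S_def)
    have algw: "algebraic_int w"
      using w(2) alg by (auto simp: S_def)
    have "\<exists>v\<in>{0} \<union> S. w - v \<in> P"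
      using w(2) by (intro bexI[of _ w]) simp_all
    then have "w ^ Q - w \<in> P"
      by (rule iffD2[OF iff[OF algw]])
    then show "x \<in> carrier (subfield_of_card P Q)"
      using w algw by (auto simp: subfield_of_card_def carrier_Fp_bar pow_Fp_bar coset_eq_iff)
  qed
qed

text \<open>\<open>teichmueller\<close> is an inverse chosen by \<open>inv_into\<close>, so the
  point is injectivity of the coset map; two roots of unity are compared at the product of their
  exponents.\<close>

lemma teichmueller_coset:
  assumes n: "n > 0" "coprime n p" "z ^ n = 1"
  shows "teichmueller p P (coset z) = z"
  unfolding teichmueller_def
proof (rule inv_into_f_f)
  show "inj_on coset {z. \<exists>n>0. coprime n p \<and> z ^ n = 1}"
  proof (rule inj_onI)
    fix z w assume zw: "z \<in> {z. \<exists>n>0. coprime n p \<and> z ^ n = 1}" "w \<in> {z. \<exists>n>0. coprime n p \<and> z ^ n = 1}"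
      "coset z = coset w"
    then obtain a b where ab: "a > 0" "coprime a p" "z ^ a = 1" "b > 0" "coprime b p" "w ^ b = 1"
      by auto
    have "z ^ (a * b) = 1"
      by (simp add: power_mult ab)
    moreover have "w ^ (a * b) = 1"
      by (subst mult.commute) (simp add: power_mult ab)
    moreover have "a * b > 0" "coprime (a * b) p"
      using ab by auto
    ultimately show "z = w"
      using zw(3) roots_of_unity_cong[of "a * b" z w] by (simp only: coset_eq_iff)
  qed
qed (use n in auto)

end

section \<open>Teichmueller characters\<close>

lemma root_of_unity_power_cis:
  assumes "n > 0"
  shows "bij_betw (\<lambda>k. cis (2 * pi / real n) ^ k) {..<n} {z. z ^ n = 1}"
proof -
  have "cis (2 * pi * real k / real n) = cis (2 * pi / real n) ^ k" for k
    by (simp add: DeMoivre mult_ac)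
  then show ?thesis
    using bij_betw_roots_unity[OF assms] by simp
qed

locale galois_field_prime_over = galois_field Q ty + prime_over P "CHAR('a)"
  for Q :: nat and ty :: "'a::alg_closed_field itself" and P :: "complex set"
begin

lemma alg_ev:
  assumes "algebraic_int (z :: complex)"
  shows "algebraic_int (poly (map_poly of_int h) z)"
  by (induction h) (auto simp: map_poly_pCons intro!: alg_add alg_mult alg_of_int assms)

text \<open>The rings generated by \<open>\<zeta>\<close> modulo \<open>P\<close> and by \<open>a\<close> are quotients of \<open>\<int>[X]\<close> by the same ideal. This
  replaces an isomorphism between the quotient by \<open>P\<close> and the algebraically closed field \<open>'a\<close>.\<close>

lemma exists_reduction:
  assumes D: "D > 0" "\<zeta> ^ D = 1"
  shows "\<exists>a::'a. \<forall>h. poly (map_poly of_int h) a = 0 \<longleftrightarrow> poly (map_poly of_int h) \<zeta> \<in> P"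
proof -
  note alg = alg_ev[OF alg_root_of_unity[OF D]]
  define I2 where "I2 = {h. poly (map_poly of_int h) \<zeta> \<in> P}"
  have I2: "int_poly_ideal I2 CHAR('a)"
    by unfold_locales (auto simp: I2_def ev_simps P_add P_mult alg p_in prime_char)
  interpret I2: int_poly_ideal I2 "CHAR('a)"
    by (rule I2)
  define M where "M = {h. h \<in> I2 \<and> lead_coeff h = 1}"
  have "monom 1 D - 1 \<in> M"
  proof -
    have deg: "degree (monom 1 D - 1 :: int poly) = D"
      unfolding diff_conv_add_uminus using D(1)
      by (subst degree_add_eq_left) (auto simp: degree_monom_eq)
    have "poly (map_poly of_int (monom 1 D - 1)) \<zeta> = 0"
      using D(2) by (simp add: ev_diff ev_monom map_poly_1')
    then show ?thesis
      using D(1) by (simp add: M_def I2_def deg)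
  qed
  then obtain h0 where "h0 \<in> M" and least: "\<And>h. h \<in> M \<Longrightarrow> degree h0 \<le> degree h"
    using ex_has_least_nat[of "\<lambda>h. h \<in> M" _ degree] by blast
  then have h0: "h0 \<in> I2" "lead_coeff h0 = 1"
    and minimal: "\<And>h. h \<in> I2 \<Longrightarrow> lead_coeff h = 1 \<Longrightarrow> degree h0 \<le> degree h"
    by (auto simp: M_def)
  have "1 \<notin> I2"
    by (simp add: I2_def map_poly_1' P_1)
  have "degree h0 > 0"
  proof (rule ccontr)
    assume "\<not> degree h0 > 0"
    then have "h0 = 1"
      using h0(2) by (auto elim!: degree_eq_zeroE)
    then show False
      using h0(1) \<open>1 \<notin> I2\<close> by simp
  qed
  \<comment> \<open>Being monic, \<open>h0\<close> keeps its positive degree in characteristic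
    \<open>p\<close>, so it has a root in the closure.\<close>
  moreover have "degree (map_poly of_int h0 :: 'a poly) = degree h0"
  proof (rule antisym)
    show "degree (map_poly of_int h0 :: 'a poly) \<le> degree h0"
      by (rule map_poly_degree_leq)
    show "degree h0 \<le> degree (map_poly of_int h0 :: 'a poly)"
      by (rule le_degree) (simp add: coeff_map_poly h0(2))
  qed
  ultimately obtain a :: 'a where a: "poly (map_poly of_int h0) a = 0"
    using alg_closed_imp_poly_has_root[of "map_poly of_int h0 :: 'a poly"] by auto
  define I1 where "I1 = {h. poly (map_poly of_int h) a = 0}"
  have I1: "int_poly_ideal I1 CHAR('a)"
    by unfold_locales (auto simp: I1_def ev_simps prime_char)
  have "I1 = I2"
  proof (rule int_poly_ideals_eq[OF I1 _ I2 _ _ h0 minimal])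
    show "1 \<notin> I1"
      by (simp add: I1_def map_poly_1')
    show "g \<in> I2 \<or> h \<in> I2" if "g * h \<in> I2" for g h
      using that P_prime[OF alg alg] by (simp add: I2_def ev_mult)
    show "I2 \<subseteq> I1"
      using I2.ev_eq_0[OF h0 minimal _ _ a] by (auto simp: I1_def)
  qed
  then show ?thesis
    by (auto simp: I1_def I2_def set_eq_iff)
qed

text \<open>Only with 0 included can the solutions of \<open>x + y + 1 = 0\<close> be
  transported.\<close>

definition lift :: "('a \<Rightarrow> complex) \<Rightarrow> 'a \<Rightarrow> complex" where
  "lift \<Theta> x = (if x = 0 then 0 else \<Theta> x)"

text \<open>With \<open>a\<close> from \<open>exists_reduction\<close>, \<open>\<Theta>\<close>
  sends \<open>a ^ k\<close> to \<open>\<zeta> ^ k\<close>. Integer polynomial relations at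
  \<open>a\<close> are those at \<open>\<zeta>\<close> modulo \<open>P\<close>; this yields
  well-definedness, injectivity and the last clause, the only additive information in a Jacobi
  sum.\<close>

lemma exists_theta:
  assumes D: "D > 0" "coprime D CHAR('a)"
  shows "\<exists>\<Theta>. (\<forall>x y. x ^ D = 1 \<longrightarrow> y ^ D = 1 \<longrightarrow> \<Theta> (x * y) = \<Theta> x * \<Theta> y) \<and>
    bij_betw \<Theta> {x. x ^ D = 1} {z. z ^ D = 1} \<and>
    (\<forall>x y. x = 0 \<or> x ^ D = 1 \<longrightarrow> y = 0 \<or> y ^ D = 1 \<longrightarrow>
      (x + y + 1 = 0 \<longleftrightarrow> lift \<Theta> x + lift \<Theta> y + 1 \<in> P))"
proof -
  define \<zeta> where "\<zeta> = cis (2 * pi / real D)"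
  have bij: "bij_betw (\<lambda>k. \<zeta> ^ k) {..<D} {z. z ^ D = 1}"
    unfolding \<zeta>_def by (rule root_of_unity_power_cis) fact
  have \<zeta>: "\<zeta> ^ D = 1"
    using D(1) by (simp add: \<zeta>_def DeMoivre)
  obtain a :: 'a where a: "\<And>h. poly (map_poly of_int h) a = 0 \<longleftrightarrow> poly (map_poly of_int h) \<zeta> \<in> P"
    using exists_reduction[OF D(1) \<zeta>] by auto
  have power_eq: "a ^ j = a ^ k \<longleftrightarrow> \<zeta> ^ j = \<zeta> ^ k" for j k
  proof -
    have "a ^ j = a ^ k \<longleftrightarrow> \<zeta> ^ j - \<zeta> ^ k \<in> P"
      using a[of "monom 1 j - monom 1 k"] by (simp add: ev_simps)
    moreover have "(\<zeta> ^ j) ^ D = 1" "(\<zeta> ^ k) ^ D = 1"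
      using \<zeta> by (metis mult.commute power_mult power_one)+
    ultimately show ?thesis
      using roots_of_unity_cong[OF D, of "\<zeta> ^ j" "\<zeta> ^ k"] by auto
  qed
  have aD: "a ^ D = 1"
    using power_eq[of D 0] \<zeta> by simp
  have "inj_on (\<lambda>k. a ^ k) {..<D}"
    using bij by (auto simp: bij_betw_def inj_on_def power_eq)
  moreover have sub: "(\<lambda>k. a ^ k) ` {..<D} \<subseteq> {x. x ^ D = 1}"
    using aD by (auto simp flip: power_mult) (metis mult.commute power_mult power_one)
  moreover have cardD: "card {x :: 'a. x ^ D = 1} = D"
    using D by (intro card_unity_roots)
  moreover have "finite {x :: 'a. x ^ D = 1}"
    using cardD D(1) by (intro card_ge_0_finite) simp
  ultimately have powers: "(\<lambda>k. a ^ k) ` {..<D} = {x. x ^ D = 1}"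
    by (intro card_subset_eq) (auto simp: card_image)
  define \<Theta> where "\<Theta> x = \<zeta> ^ (SOME k. a ^ k = x)" for x
  have \<Theta>: "\<Theta> (a ^ k) = \<zeta> ^ k" for k
  proof -
    have "a ^ (SOME j. a ^ j = a ^ k) = a ^ k"
      by (rule someI[of "\<lambda>j. a ^ j = a ^ k"]) simp
    then show ?thesis
      by (simp add: \<Theta>_def power_eq)
  qed
  have ex: "\<exists>k. x = a ^ k" if "x ^ D = 1" for x
    using that powers by (metis (mono_tags, lifting) imageE mem_Collect_eq)
  have mult: "\<Theta> (x * y) = \<Theta> x * \<Theta> y" if xy: "x ^ D = 1" "y ^ D = 1" for x y
  proof -
    obtain j k where "x = a ^ j" "y = a ^ k"
      using ex xy by blast
    then show ?thesis
      using \<Theta>[of "j + k"] by (simp add: \<Theta> power_add)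
  qed
  have bij\<Theta>: "bij_betw \<Theta> {x. x ^ D = 1} {z. z ^ D = 1}"
    unfolding powers[symmetric] using bij
    by (auto simp: bij_betw_def inj_on_def \<Theta> power_eq image_image)
  have add: "x + y + 1 = 0 \<longleftrightarrow> lift \<Theta> x + lift \<Theta> y + 1 \<in> P"
    if x: "x = 0 \<or> x ^ D = 1" and y: "y = 0 \<or> y ^ D = 1" for x y
  proof -
    have "\<exists>g. x = poly (map_poly of_int g) a \<and> lift \<Theta> x = poly (map_poly of_int g) \<zeta>"
      if x: "x = 0 \<or> x ^ D = 1" for x
    proof (cases "x = 0")
      case False
      then obtain k where "x = a ^ k"
        using x ex by blast
      then show ?thesis
        using False by (intro exI[of _ "monom 1 k"]) (simp add: ev_monom lift_def \<Theta>)
    qed (auto simp: lift_def intro!: exI[of _ 0])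
    then obtain g h where "x = poly (map_poly of_int g) a" "lift \<Theta> x = poly (map_poly of_int g) \<zeta>"
      "y = poly (map_poly of_int h) a" "lift \<Theta> y = poly (map_poly of_int h) \<zeta>"
      using x y by metis
    then show ?thesis
      using a[of "g + h + 1"] by (simp add: ev_add map_poly_1')
  qed
  show ?thesis
    using mult bij\<Theta> add by blast
qed

end

text \<open>\<open>D\<close> is kept apart from \<open>Q - 1\<close> because one
  \<open>\<Theta>\<close> has to serve fields of several sizes.\<close>

locale teichmueller_lift = galois_field_prime_over Q ty P
  for Q :: nat and ty :: "'a::alg_closed_field itself" and P :: "complex set" +
  fixes D :: nat and \<Theta> :: "'a \<Rightarrow> complex"
  assumes D: "D > 0" "coprime D CHAR('a)" "(Q - 1) dvd D"
    and \<Theta>_mult: "x ^ D = 1 \<Longrightarrow> y ^ D = 1 \<Longrightarrow> \<Theta> (x * y) = \<Theta> x * \<Theta> y"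
    and \<Theta>_bij: "bij_betw \<Theta> {x. x ^ D = 1} {z. z ^ D = 1}"
    and \<Theta>_add: "x = 0 \<or> x ^ D = 1 \<Longrightarrow> y = 0 \<or> y ^ D = 1 \<Longrightarrow>
      x + y + 1 = 0 \<longleftrightarrow> lift \<Theta> x + lift \<Theta> y + 1 \<in> P"
begin

lemma D_root: "x ^ (Q - 1) = 1 \<Longrightarrow> x ^ D = 1" for x :: "'b::monoid_mult"
  using D(3) by (auto simp: power_mult elim!: dvdE)

lemma F_D: "x \<in> F \<Longrightarrow> x \<noteq> 0 \<Longrightarrow> x ^ D = 1"
  using D_root GF_nz_power by blast

lemma \<Theta>_root: "x ^ D = 1 \<Longrightarrow> \<Theta> x ^ D = 1"
  using \<Theta>_bij by (auto simp: bij_betw_def)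

lemma \<Theta>_inj: "x ^ D = 1 \<Longrightarrow> y ^ D = 1 \<Longrightarrow> \<Theta> x = \<Theta> y \<Longrightarrow> x = y"
  using \<Theta>_bij by (auto simp: bij_betw_def inj_on_def)

lemma \<Theta>_one: "\<Theta> 1 = 1"
proof -
  have "\<Theta> 1 * \<Theta> 1 = \<Theta> 1 * 1" "\<Theta> 1 \<noteq> 0"
    using \<Theta>_mult[of 1 1] \<Theta>_root[of 1] D(1) by (auto simp: power_0_left)
  then show ?thesis
    by (metis mult_left_cancel)
qed

lemma \<Theta>_pow: "x ^ D = 1 \<Longrightarrow> \<Theta> (x ^ n) = \<Theta> x ^ n"
proof (induction n)
  case (Suc n)
  then have "(x ^ n) ^ D = 1"
    by (metis mult.commute power_mult power_one)
  with Suc show ?case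
    by (simp add: \<Theta>_mult)
qed (simp add: \<Theta>_one)

lemma \<Theta>_eq_1: "x ^ D = 1 \<Longrightarrow> \<Theta> x = 1 \<longleftrightarrow> x = 1"
  using \<Theta>_inj[of x 1] \<Theta>_one by auto

text \<open>The identification of \<open>GF Q\<close> with \<open>subfield_of_card P Q\<close>
  through Teichmueller representatives. It is multiplicative by construction; addition enters
  through \<open>\<beta>_add_iff\<close>.\<close>

definition \<beta> :: "'a \<Rightarrow> complex set" where
  "\<beta> x = coset (lift \<Theta> x)"

abbreviation S :: "complex set ring" where
  "S \<equiv> subfield_of_card P Q"

lemma lift_image: "lift \<Theta> ` F = {0} \<union> {w. w ^ (Q - 1) = 1}"
proof (intro equalityI subsetI)
  fix w assume "w \<in> lift \<Theta> ` F"
  then obtain x where x: "x \<in> F" "w = lift \<Theta> x"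
    by auto
  show "w \<in> {0} \<union> {w. w ^ (Q - 1) = 1}"
  proof (cases "x = 0")
    case False
    then show ?thesis
      using x \<Theta>_pow[OF F_D[OF x(1) False], of "Q - 1"] GF_nz_power[OF x(1) False] \<Theta>_one
      by (simp add: lift_def)
  qed (simp add: x lift_def)
next
  fix w :: complex assume w: "w \<in> {0} \<union> {w. w ^ (Q - 1) = 1}"
  show "w \<in> lift \<Theta> ` F"
  proof (cases "w = 0")
    case True
    then show ?thesis
      by (intro image_eqI[of _ _ 0]) (auto simp: lift_def)
  next
    case False
    then have w1: "w ^ (Q - 1) = 1"
      using w by auto
    then have "w \<in> \<Theta> ` {x. x ^ D = 1}"
      using D_root \<Theta>_bij by (auto simp: bij_betw_def)
    then obtain x where x: "x ^ D = 1" "w = \<Theta> x"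
      by auto
    have "(x ^ (Q - 1)) ^ D = 1"
      using x(1) by (metis mult.commute power_mult power_one)
    moreover have "\<Theta> (x ^ (Q - 1)) = 1"
      using \<Theta>_pow[OF x(1)] w1 x(2) by simp
    ultimately have "x ^ (Q - 1) = 1"
      using \<Theta>_eq_1 by blast
    moreover have "x \<noteq> 0"
      using x(1) D(1) by (auto simp: power_0_left)
    ultimately show ?thesis
      using x by (intro image_eqI[of _ _ x]) (auto simp: lift_def GF_nz_iff)
  qed
qed

lemma \<beta>_image: "\<beta> ` F = carrier S"
  using Q_ge lift_image unfolding \<beta>_def by (subst carrier_subfield_of_card) (auto simp flip: image_image)

lemma alg_lift: "x \<in> F \<Longrightarrow> algebraic_int (lift \<Theta> x)"
  using \<Theta>_root[of x] F_D[of x] D(1) by (auto simp: lift_def intro!: alg_root_of_unity[of D])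

lemma \<beta>_inj: "inj_on \<beta> F"
proof (rule inj_onI)
  fix x y assume xy: "x \<in> F" "y \<in> F" "\<beta> x = \<beta> y"
  have nP: "lift \<Theta> z \<notin> P" if "z \<in> F" "z \<noteq> 0" for z
    using root_of_unity_notin[OF D(1) \<Theta>_root[OF F_D[OF that]]] that by (simp add: lift_def)
  have diff: "lift \<Theta> x - lift \<Theta> y \<in> P"
    using xy(3) by (simp add: \<beta>_def coset_eq_iff)
  consider "x = 0" | "y = 0" | "x \<noteq> 0" "y \<noteq> 0"
    by auto
  then show "x = y"
  proof cases
    case 1
    then show ?thesis
      using nP[OF xy(2)] P_minus[OF diff] by (cases "y = 0") (auto simp: lift_def)
  next
    case 2
    then show ?thesis
      using nP[OF xy(1)] diff by (cases "x = 0") (auto simp: lift_def)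
  next
    case 3
    then show ?thesis
      using roots_of_unity_cong[OF D(1,2) \<Theta>_root[OF F_D[OF xy(1)]] \<Theta>_root[OF F_D[OF xy(2)]]] diff
        \<Theta>_inj[OF F_D[OF xy(1)] F_D[OF xy(2)]] by (simp add: lift_def)
  qed
qed

lemma zero_S: "zero S = \<beta> 0"
  by (simp add: subfield_of_card_def zero_Fp_bar \<beta>_def lift_def)

lemma \<beta>_mult: "x \<in> F \<Longrightarrow> y \<in> F \<Longrightarrow> \<beta> x \<otimes>\<^bsub>S\<^esub> \<beta> y = \<beta> (x * y)"
  using mult_Fp_bar[OF alg_lift alg_lift, of x y] F_D \<Theta>_mult[of x y]
  by (simp add: subfield_of_card_def \<beta>_def) (simp add: lift_def)

lemma \<beta>_add_iff:
  assumes "x \<in> F" "y \<in> F"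
  shows "\<beta> x \<oplus>\<^bsub>S\<^esub> \<beta> y \<oplus>\<^bsub>S\<^esub> \<one>\<^bsub>S\<^esub> = \<zero>\<^bsub>S\<^esub> \<longleftrightarrow> x + y + 1 = 0"
proof -
  have "\<beta> x \<oplus>\<^bsub>S\<^esub> \<beta> y \<oplus>\<^bsub>S\<^esub> \<one>\<^bsub>S\<^esub> = coset (lift \<Theta> x + lift \<Theta> y + 1)"
    using assms by (simp add: subfield_of_card_def \<beta>_def add_Fp_bar one_Fp_bar alg_lift alg_add)
  then show ?thesis
    using \<Theta>_add[of x y] assms F_D
    by (auto simp: zero_S \<beta>_def lift_def[of _ 0] coset_eq_iff)
qed

lemma \<beta>_nz: "x \<in> F \<Longrightarrow> \<beta> x = \<beta> 0 \<longleftrightarrow> x = 0"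
  by (rule inj_on_eq_iff[OF \<beta>_inj]) auto

lemma units_S: "carrier (mult_of S) = \<beta> ` (F - {0})"
  by (simp add: zero_S inj_on_image_set_diff[OF \<beta>_inj] flip: \<beta>_image)

text \<open>A primitive root of unity is explicit among the complex numbers, and
  \<open>\<Theta>\<close> carries the cyclic structure over to the units of
  \<open>F\<close>.\<close>

lemma exists_generator:
  obtains b where "b \<in> F" "b \<noteq> 0" "\<And>x. x \<in> F \<Longrightarrow> x \<noteq> 0 \<Longrightarrow> \<exists>k. x = b ^ k"
    "\<And>k. 0 < k \<Longrightarrow> k < Q - 1 \<Longrightarrow> b ^ k \<noteq> 1"
proof -
  define w where "w = cis (2 * pi / real (Q - 1))"
  have bij: "bij_betw (\<lambda>k. w ^ k) {..<Q - 1} {z. z ^ (Q - 1) = 1}"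
    unfolding w_def using Q_ge by (intro root_of_unity_power_cis) auto
  have "1 \<in> {..<Q - 1}"
    using Q_ge by auto
  then have "w ^ 1 \<in> {z. z ^ (Q - 1) = 1}"
    using bij unfolding bij_betw_def by blast
  then have w1: "w ^ (Q - 1) = 1"
    by simp
  then have "w \<in> lift \<Theta> ` F"
    unfolding lift_image by simp
  then obtain b where b: "b \<in> F" "w = lift \<Theta> b"
    by auto
  have b0: "b \<noteq> 0"
    using b w1 Q_ge by (auto simp: lift_def power_0_left)
  then have w: "w = \<Theta> b"
    using b by (simp add: lift_def)
  note bD = F_D[OF b(1) b0]
  have bkD: "(b ^ k) ^ D = 1" for k
    using bD by (metis mult.commute power_mult power_one)
  show thesis
  proof (rule that[OF b(1) b0])
    fix x assume x: "x \<in> F" "x \<noteq> 0"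
    have "\<Theta> x \<in> {z. z ^ (Q - 1) = 1}"
      using \<Theta>_pow[OF F_D[OF x], of "Q - 1"] GF_nz_power[OF x] \<Theta>_one by simp
    then obtain k where "\<Theta> x = w ^ k"
      using bij unfolding bij_betw_def by blast
    then have "\<Theta> x = \<Theta> (b ^ k)"
      by (simp add: w \<Theta>_pow[OF bD])
    then show "\<exists>k. x = b ^ k"
      using \<Theta>_inj[OF F_D[OF x] bkD] by blast
  next
    fix k assume k: "0 < k" "k < Q - 1"
    show "b ^ k \<noteq> 1"
    proof
      assume "b ^ k = 1"
      then have eq: "w ^ k = w ^ 0"
        using \<Theta>_pow[OF bD, of k] by (simp add: w \<Theta>_one)
      have "k = 0"
        by (rule inj_onD[OF bij_betw_imp_inj_on[OF bij] eq]) (use k in auto)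
      with k show False
        by simp
    qed
  qed
qed

text \<open>The choice by \<open>SOME\<close> needs a witness: \<open>quad_char\<close> transported
  along \<open>\<beta>\<close>, which is nontrivial at a generator.\<close>

lemma quadratic_character_spec:
  "mult_character S (quadratic_character S) \<and> \<not> trivial_character S (quadratic_character S) \<and>
    (\<forall>x \<in> carrier (mult_of S). quadratic_character S x ^ 2 = 1)"
proof -
  obtain b where b: "b \<in> F" "b \<noteq> 0" "\<And>k. 0 < k \<Longrightarrow> k < Q - 1 \<Longrightarrow> b ^ k \<noteq> 1"
    using exists_generator by metis
  have "quad_char Q b \<noteq> 1"
    using b(2) b(3)[of "(Q - 1) div 2"] Q_ge by (simp add: quad_char_def)
  define \<chi> where "\<chi> c = quad_char Q (inv_into F \<beta> c)" for c
  have \<chi>: "\<chi> (\<beta> x) = quad_char Q x" if "x \<in> F" for x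
    using that by (simp add: \<chi>_def inv_into_f_f[OF \<beta>_inj])
  have nz: "quad_char Q x \<noteq> 0" if "x \<noteq> 0" for x :: 'a
    using that by (simp add: quad_char_def)
  have "mult_character S \<chi> \<and> \<not> trivial_character S \<chi> \<and> (\<forall>x \<in> carrier (mult_of S). \<chi> x ^ 2 = 1)"
    unfolding mult_character_def trivial_character_def units_S
    using b(1,2) \<open>quad_char Q b \<noteq> 1\<close> quad_char_square
    by (auto simp: \<chi> \<beta>_mult GF_mult quad_char_mult nz)
  then show ?thesis
    unfolding quadratic_character_def
    by (rule someI[where P = "\<lambda>\<chi>. mult_character S \<chi> \<and> \<not> trivial_character S \<chi> \<and>
      (\<forall>x \<in> carrier (mult_of S). \<chi> x ^ 2 = 1)"])
qed

text \<open>Such a character is fixed by its value at a generator, a square root of 1 other than 1;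
  \<open>quad_char\<close> has the same value there.\<close>

lemma quadratic_character_\<beta>:
  assumes x: "x \<in> F" "x \<noteq> 0"
  shows "quadratic_character S (\<beta> x) = quad_char Q x"
proof -
  define l where "l = quadratic_character S"
  have spec: "\<forall>c\<in>\<beta> ` (F - {0}). l c \<noteq> 0"
    "\<forall>c\<in>\<beta> ` (F - {0}). \<forall>c'\<in>\<beta> ` (F - {0}). l (c \<otimes>\<^bsub>S\<^esub> c') = l c * l c'"
    "\<not> (\<forall>c\<in>\<beta> ` (F - {0}). l c = 1)" "\<forall>c\<in>\<beta> ` (F - {0}). l c ^ 2 = 1"
    using quadratic_character_spec
    unfolding l_def mult_character_def trivial_character_def units_S by blast+
  have l_nz: "l (\<beta> x) \<noteq> 0" and l_sq: "l (\<beta> x) ^ 2 = 1" if "x \<in> F" "x \<noteq> 0" for x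
    using spec(1,4) that by blast+
  have l_mult: "l (\<beta> (x * y)) = l (\<beta> x) * l (\<beta> y)" if "x \<in> F" "x \<noteq> 0" "y \<in> F" "y \<noteq> 0" for x y
    using spec(2) that by (simp add: \<beta>_mult)
  have l_nontrivial: "\<exists>x\<in>F. x \<noteq> 0 \<and> l (\<beta> x) \<noteq> 1"
    using spec(3) by blast
  have l_1: "l (\<beta> 1) = 1"
    using l_mult[of 1 1] l_nz[of 1] by (metis GF_1 mult_cancel_left1 one_neq_zero mult_1)
  obtain b where b: "b \<in> F" "b \<noteq> 0" "\<And>x. x \<in> F \<Longrightarrow> x \<noteq> 0 \<Longrightarrow> \<exists>k. x = b ^ k"
    "\<And>k. 0 < k \<Longrightarrow> k < Q - 1 \<Longrightarrow> b ^ k \<noteq> 1"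
    using exists_generator by metis
  have l_pow: "l (\<beta> (b ^ k)) = l (\<beta> b) ^ k" for k
    by (induction k) (use b in \<open>simp_all add: l_1 l_mult GF_power\<close>)
  have "l (\<beta> b) \<noteq> 1"
    using l_nontrivial b(3) l_pow by (metis power_one)
  then have "l (\<beta> b) = - 1"
    using l_sq[OF b(1,2)] by (simp add: power2_eq_1_iff)
  moreover have "quad_char Q b = - 1"
    using b(2) b(4)[of "(Q - 1) div 2"] Q_ge by (simp add: quad_char_def)
  moreover obtain k where "x = b ^ k"
    using b(3)[OF x] by auto
  ultimately show ?thesis
    using l_pow[of k] quad_char_power[OF b(1), of k] by (simp add: l_def)
qed

theorem J_lambda_chi_eq:
  assumes i: "0 < i" "i < d" "d dvd (Q - 1) * i"
  shows "J_lambda_chi CHAR('a) P d Q i = jacobi (torsion_char Q d \<Theta> i)"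
proof -
  define e where "e = (Q - 1) * i div d"
  define \<psi> where "\<psi> = (\<lambda>c. teichmueller CHAR('a) P c ^ e)"
  have \<psi>: "\<psi> (\<beta> x) = torsion_char Q d \<Theta> i x" if x: "x \<in> F" "x \<noteq> 0" for x
  proof -
    have "teichmueller CHAR('a) P (\<beta> x) = \<Theta> x"
      using teichmueller_coset[OF D(1,2) \<Theta>_root[OF F_D[OF x]]] x(2) by (simp add: \<beta>_def lift_def)
    then show ?thesis
      using x \<Theta>_pow[OF F_D[OF x], of e] by (simp add: \<psi>_def torsion_char_def e_def)
  qed
  \<comment> \<open>These bounds make \<open>\<psi>\<close> nontrivial at a generator. Therefore
    \<open>extend_char\<close> is 0 at 0, in agreement with \<open>torsion_char\<close>.\<close>
  have e: "0 < e" "e < Q - 1"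
  proof -
    have ed: "e * d = (Q - 1) * i"
      using i(3) by (simp add: e_def)
    then show "0 < e"
      using i(1) Q_ge by (intro Nat.gr0I) auto
    have "(Q - 1) * i < (Q - 1) * d"
      using i(2) Q_ge by simp
    then show "e < Q - 1"
      unfolding ed[symmetric] by simp
  qed
  obtain b where b: "b \<in> F" "b \<noteq> 0" "\<And>k. 0 < k \<Longrightarrow> k < Q - 1 \<Longrightarrow> b ^ k \<noteq> 1"
    using exists_generator by metis
  have "torsion_char Q d \<Theta> i b \<noteq> 1"
  proof -
    have "(b ^ e) ^ D = 1"
      using F_D[OF b(1,2)] by (metis mult.commute power_mult power_one)
    then have "\<Theta> (b ^ e) \<noteq> 1"
      using b(3)[OF e] \<Theta>_eq_1 by blast
    then show ?thesis
      using b(2) by (simp add: torsion_char_def e_def)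
  qed
  then have nontrivial: "\<not> trivial_character S \<psi>"
    unfolding trivial_character_def units_S using b(1,2) \<psi> by auto
  have ext\<psi>: "extend_char S \<psi> (\<beta> x) = torsion_char Q d \<Theta> i x" if "x \<in> F" for x
    using that nontrivial \<psi> \<beta>_nz[OF that] by (auto simp: extend_char_def zero_S)
  have extl: "extend_char S (quadratic_character S) (\<beta> x) = quad_char Q x" if "x \<in> F" for x
    using that quadratic_character_spec quadratic_character_\<beta> \<beta>_nz[OF that]
    by (auto simp: extend_char_def zero_S)
  define U where "U = {(u, v). u \<in> carrier S \<and> v \<in> carrier S \<and> u \<oplus>\<^bsub>S\<^esub> v \<oplus>\<^bsub>S\<^esub> \<one>\<^bsub>S\<^esub> = \<zero>\<^bsub>S\<^esub>}"
  have U: "U = (\<lambda>x. (\<beta> (- x), \<beta> (x - 1))) ` F"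
  proof (intro equalityI subsetI)
    fix uv assume "uv \<in> U"
    then obtain x y where xy: "uv = (\<beta> x, \<beta> y)" "x \<in> F" "y \<in> F" "\<beta> x \<oplus>\<^bsub>S\<^esub> \<beta> y \<oplus>\<^bsub>S\<^esub> \<one>\<^bsub>S\<^esub> = \<zero>\<^bsub>S\<^esub>"
      unfolding U_def \<beta>_image[symmetric] by auto
    then have "x + y + 1 = 0"
      using \<beta>_add_iff by blast
    then have "y = - x - 1"
      by (simp add: eq_neg_iff_add_eq_0 algebra_simps)
    then show "uv \<in> (\<lambda>x. (\<beta> (- x), \<beta> (x - 1))) ` F"
      using xy by (intro image_eqI[of _ _ "- x"]) auto
  next
    fix uv assume "uv \<in> (\<lambda>x. (\<beta> (- x), \<beta> (x - 1))) ` F"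
    then obtain x where x: "uv = (\<beta> (- x), \<beta> (x - 1))" "x \<in> F"
      by auto
    then have F: "- x \<in> F" "x - 1 \<in> F"
      by auto
    then show "uv \<in> U"
      unfolding U_def \<beta>_image[symmetric] x(1) using \<beta>_add_iff[OF F] by simp
  qed
  have inj: "inj_on (\<lambda>x. (\<beta> (- x), \<beta> (x - 1))) F"
  proof (rule inj_onI)
    fix x y assume "x \<in> F" "y \<in> F" "(\<beta> (- x), \<beta> (x - 1)) = (\<beta> (- y), \<beta> (y - 1))"
    then have "- x = - y"
      by (intro inj_onD[OF \<beta>_inj]) auto
    then show "x = y"
      by simp
  qed
  have "J_lambda_chi CHAR('a) P d Q i =
      (\<Sum>(u, v)\<in>U. extend_char S (quadratic_character S) u * extend_char S \<psi> v)"
    by (simp add: J_lambda_chi_def jacobi_sum_def U_def \<psi>_def e_def)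
  also have "\<dots> = (\<Sum>x\<in>F. extend_char S (quadratic_character S) (\<beta> (- x)) * extend_char S \<psi> (\<beta> (x - 1)))"
    unfolding U by (subst sum.reindex[OF inj]) simp
  also have "\<dots> = jacobi (torsion_char Q d \<Theta> i)"
    unfolding jacobi_def by (intro sum.cong refl) (simp add: ext\<psi> extl GF_minus GF_diff)
  finally show ?thesis .
qed

end

theorem exists_characters:
  fixes ty :: "'a::alg_closed_field itself"
  assumes "galois_field TYPE('a) q" and P: "prime_over P CHAR('a)"
    and d: "d > 0" "coprime d CHAR('a)"
  shows "\<exists>\<Theta> :: 'a \<Rightarrow> complex. galois_characters q d \<Theta> \<and>
    (\<forall>m i. 0 < m \<longrightarrow> m \<le> d \<longrightarrow> 0 < i \<longrightarrow> i < d \<longrightarrow> d dvd (q ^ m - 1) * i \<longrightarrow>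
      J_lambda_chi CHAR('a) P d (q ^ m) i = galois_field.jacobi (q ^ m) (torsion_char (q ^ m) d \<Theta> i))"
proof -
  interpret galois_field q ty
    by fact
  interpret galois_field_prime_over q ty P
    by (intro galois_field_prime_over.intro assms)
  \<comment> \<open>The factorial makes \<open>q ^ m - 1\<close> divide \<open>D\<close> for all
    \<open>m \<le> d\<close>, which covers every orbit size. It is also a multiple of
    \<open>totient d\<close>, so that \<open>d\<close> divides \<open>D\<close> by Euler's
    theorem.\<close>
  define D where "D = q ^ fact d - 1"
  have qm: "q ^ m > 1" if "m > 0" for m
    using Q_ge that by (intro one_less_power) auto
  have D: "D > 0"
    using qm[of "fact d"] by (simp add: D_def)
  have "coprime (q ^ fact d - 1) (q ^ fact d)"
    using coprime_diff_one_left_nat[of "q ^ fact d"] Q_pos by simp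
  then have copD: "coprime D CHAR('a)"
    using Q_power unfolding D_def by (auto simp flip: power_mult)
  have dvdD: "q ^ m - 1 dvd D" if "0 < m" "m \<le> d" for m
  proof -
    have "m dvd fact d"
      using that by (intro dvd_fact) auto
    then obtain k where "fact d = m * k"
      by (rule dvdE)
    then have "D = (q ^ m) ^ k - 1"
      by (simp add: D_def power_mult)
    moreover interpret E: galois_field "q ^ m" ty
      by (rule extension) fact
    have "q ^ m - 1 dvd (q ^ m) ^ k - 1"
      using E.norm_exponent[of k] by (metis dvd_triv_left)
    ultimately show ?thesis
      by simp
  qed
  have "d dvd D"
  proof -
    have "coprime q d"
      using Q_power d(2) by (auto simp: coprime_commute)
    then have "[q ^ totient d = 1] (mod d)"
      by (rule euler_theorem)
    moreover have "totient d dvd fact d"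
      using d(1) totient_le[of d] by (intro dvd_fact) (auto simp: Suc_le_eq)
    ultimately have "[q ^ fact d = 1] (mod d)"
      by (metis cong_pow dvd_def power_mult power_one)
    then show ?thesis
      unfolding D_def using Q_pos by (simp add: cong_altdef_nat Suc_le_eq)
  qed
  obtain \<Theta> :: "'a \<Rightarrow> complex" where
    mult: "\<forall>x y. x ^ D = 1 \<longrightarrow> y ^ D = 1 \<longrightarrow> \<Theta> (x * y) = \<Theta> x * \<Theta> y" and
    bij: "bij_betw \<Theta> {x. x ^ D = 1} {z. z ^ D = 1}" and
    add: "\<forall>x y. x = 0 \<or> x ^ D = 1 \<longrightarrow> y = 0 \<or> y ^ D = 1 \<longrightarrow>
      (x + y + 1 = 0 \<longleftrightarrow> lift \<Theta> x + lift \<Theta> y + 1 \<in> P)"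
    using exists_theta[OF D copD] by blast
  have lifting: "teichmueller_lift (q ^ m) P D \<Theta>" if "0 < m" "m \<le> d" for m
  proof -
    interpret E: galois_field_prime_over "q ^ m" ty P
      by (intro galois_field_prime_over.intro extension P that)
    show ?thesis
      by (intro teichmueller_lift.intro teichmueller_lift_axioms.intro E.galois_field_prime_over_axioms
          D copD dvdD that bij mult[rule_format] add[rule_format])
  qed
  interpret T: teichmueller_lift "q ^ 1" ty P D \<Theta>
    using d(1) by (intro lifting) auto
  have dD: "x ^ D = 1" if "x ^ d = 1" for x :: 'a
    using \<open>d dvd D\<close> that by (auto simp: power_mult elim!: dvdE)
  have "galois_characters q d \<Theta>"
    by (intro galois_characters.intro galois_characters_axioms.intro galois_field_axioms d
        T.\<Theta>_mult T.\<Theta>_eq_1 dD)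
  moreover have "J_lambda_chi CHAR('a) P d (q ^ m) i = galois_field.jacobi (q ^ m) (torsion_char (q ^ m) d \<Theta> i)"
    if "0 < m" "m \<le> d" "0 < i" "i < d" "d dvd (q ^ m - 1) * i" for m i
    using teichmueller_lift.J_lambda_chi_eq[OF lifting] that by blast
  ultimately show ?thesis
    by blast
qed

section \<open>Residue fields of places\<close>

text \<open>In a line extension every element is uniquely \<open>k \<otimes> v \<oplus> w\<close>:
  two expressions with different \<open>k\<close> would put a nonzero multiple of \<open>v\<close>,
  hence \<open>v\<close>, into \<open>E'\<close>.\<close>

lemma (in ring) card_dimension:
  assumes K: "subfield K R" and fin: "finite (carrier R)" and dim: "dimension n K E"
  shows "card E = card K ^ n"
  using dim
proof (induction n arbitrary: E)
  case 0
  then have "E = {\<zero>}"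
    by (rule dimension_zero[OF K])
  then show ?case
    by simp
next
  case (Suc n)
  from Suc.prems obtain v E' where v: "v \<in> carrier R" "v \<notin> E'" "dimension n K E'" "E = line_extension K v E'"
    by (cases rule: dimension.cases) auto
  note E' = space_subgroup_props[OF K v(3)]
  have KR: "K \<subseteq> carrier R"
    using subfieldE(3)[OF K] by blast
  have E_eq: "E = (\<lambda>(k, w). k \<otimes> v \<oplus> w) ` (K \<times> E')"
    unfolding v(4) by (auto simp: line_extension_mem_iff) blast
  have "inj_on (\<lambda>(k, w). k \<otimes> v \<oplus> w) (K \<times> E')"
  proof (rule inj_onI, clarify)
    fix k w k' w' assume k: "k \<in> K" "k' \<in> K" and w: "w \<in> E'" "w' \<in> E'"
      and eq: "k \<otimes> v \<oplus> w = k' \<otimes> v \<oplus> w'"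
    have car: "k \<in> carrier R" "k' \<in> carrier R" "w \<in> carrier R" "w' \<in> carrier R"
      using k w KR E'(1) by auto
    have diff: "(k \<ominus> k') \<otimes> v = w' \<oplus> (\<ominus> w)"
    proof -
      have "(k \<ominus> k') \<otimes> v = (k \<otimes> v \<oplus> w) \<oplus> (\<ominus> (k' \<otimes> v) \<oplus> (\<ominus> w))"
        using car v(1) by algebra
      also have "\<dots> = w' \<oplus> (\<ominus> w)"
        unfolding eq using car v(1) by algebra
      finally show ?thesis .
    qed
    have "k \<ominus> k' = \<zero>"
    proof (rule ccontr)
      assume "k \<ominus> k' \<noteq> \<zero>"
      moreover have "k \<ominus> k' \<in> K"
        using k subringE(7,5)[OF subfieldE(1)[OF K]] by (simp add: a_minus_def)
      moreover have "(k \<ominus> k') \<otimes> v \<in> E'"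
        unfolding diff using w E'(3,4) by auto
      ultimately show False
        using E'(6)[of "k \<ominus> k'" v] v by auto
    qed
    then have "k = k'"
      using car by (metis r_right_minus_eq)
    then have "w = w'"
      using eq car v(1) by (metis add.l_cancel m_closed)
    with \<open>k = k'\<close> show "k = k' \<and> w = w'"
      by simp
  qed
  then have "card E = card (K \<times> E')"
    unfolding E_eq by (rule card_image)
  then show ?case
    using Suc.IH[OF v(3)] by (simp add: card_cartesian_product)
qed

text \<open>A finite ring is spanned by its own elements, so a dimension exists;
  \<open>card K > 1\<close> lets it be read off from the cardinality.\<close>

lemma (in ring) dim_finite:
  assumes K: "subfield K R" and fin: "finite (carrier R)" and card: "card (carrier R) = card K ^ n"
  shows "dim K (carrier R) = n"
proof -
  obtain Us where Us: "set Us = carrier R"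
    using fin finite_list by blast
  have KR: "K \<subseteq> carrier R"
    using subfieldE(3)[OF K] by blast
  have "Span K Us = carrier R"
    using Span_base_incl[OF K, of Us] Span_in_carrier[OF KR, of Us] Us by auto
  then obtain m where m: "dimension m K (carrier R)"
    using Span_finite_dimension[OF K, of Us] Us by (auto simp: finite_dimension_def)
  have "card K > 1"
  proof -
    have "{\<zero>, \<one>} \<subseteq> K"
      using subringE(2,3)[OF subfieldE(1)[OF K]] by auto
    moreover have "finite K"
      using KR fin finite_subset by blast
    moreover have "\<zero> \<noteq> \<one>"
      using subfieldE(6)[OF K] by auto
    ultimately show ?thesis
      using card_mono[of K "{\<zero>, \<one>}"] by auto
  qed
  moreover have "card K ^ m = card K ^ n"
    using card_dimension[OF K fin m] card by simp
  ultimately have "m = n"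
    by simp
  then show ?thesis
    using dimI[OF K m] by (simp add: over_def)
qed

section \<open>Valuation rings and their residue fields\<close>

locale place =
  fixes v :: "'f::field \<Rightarrow> int"
  assumes is_place_v: "is_place v"
begin

lemma v_0: "v 0 = 0"
  and v_mult: "x \<noteq> 0 \<Longrightarrow> y \<noteq> 0 \<Longrightarrow> v (x * y) = v x + v y"
  and v_add: "x \<noteq> 0 \<Longrightarrow> y \<noteq> 0 \<Longrightarrow> x + y \<noteq> 0 \<Longrightarrow> min (v x) (v y) \<le> v (x + y)"
  and v_surj: "\<exists>x. x \<noteq> 0 \<and> v x = n"
proof -
  have surj: "v ` (UNIV - {0}) = UNIV"
    using is_place_v by (simp add: is_place_def)
  show "\<exists>x. x \<noteq> 0 \<and> v x = n"
    using surj by (metis DiffD2 UNIV_I imageE singletonI)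
qed (use is_place_v in \<open>auto simp: is_place_def\<close>)

lemma v_1 [simp]: "v 1 = 0"
  using v_mult[of 1 1] by simp

lemma v_power: "x \<noteq> 0 \<Longrightarrow> v (x ^ n) = int n * v x"
  by (induction n) (auto simp: v_mult algebra_simps)

lemma v_minus: "v (- x) = v x"
proof (cases "x = 0")
  case False
  have "v (- 1) + v (- 1) = 0"
    using v_mult[of "- 1" "- 1"] by simp
  then have "v (- 1) = 0"
    by simp
  then show ?thesis
    using v_mult[of "- 1" x] False by simp
qed simp

lemma v_inverse: "x \<noteq> 0 \<Longrightarrow> v (inverse x) = - v x"
  using v_mult[of x "inverse x"] by simp

lemma v_divide: "x \<noteq> 0 \<Longrightarrow> y \<noteq> 0 \<Longrightarrow> v (x / y) = v x - v y"
  by (simp add: divide_inverse v_mult v_inverse)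

definition Ov :: "'f set" where
  "Ov = {x. x = 0 \<or> 0 \<le> v x}"

lemma O_0 [simp]: "0 \<in> Ov" and O_1 [simp]: "1 \<in> Ov"
  by (auto simp: Ov_def)

lemma O_add: "x \<in> Ov \<Longrightarrow> y \<in> Ov \<Longrightarrow> x + y \<in> Ov"
  using v_add[of x y] by (cases "x = 0 \<or> y = 0 \<or> x + y = 0") (auto simp: Ov_def)

lemma O_mult: "x \<in> Ov \<Longrightarrow> y \<in> Ov \<Longrightarrow> x * y \<in> Ov"
  using v_mult[of x y] by (cases "x = 0 \<or> y = 0") (auto simp: Ov_def)

lemma O_minus: "x \<in> Ov \<Longrightarrow> - x \<in> Ov"
  by (auto simp: Ov_def v_minus)

lemma O_diff: "x \<in> Ov \<Longrightarrow> y \<in> Ov \<Longrightarrow> x - y \<in> Ov"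
  using O_add[of x "- y"] O_minus[of y] by simp

lemma O_power: "x \<in> Ov \<Longrightarrow> x ^ n \<in> Ov"
  by (induction n) (auto intro: O_mult)

lemma O_of_nat: "of_nat n \<in> Ov"
  by (induction n) (auto intro: O_add)

lemma O_numeral: "numeral n \<in> Ov"
  using O_of_nat[of "numeral n"] by simp

lemma O_divide: "x \<in> Ov \<Longrightarrow> y \<noteq> 0 \<Longrightarrow> v y = 0 \<Longrightarrow> x / y \<in> Ov"
  by (cases "x = 0") (auto simp: Ov_def v_divide)

lemmas O_closed = O_0 O_1 O_add O_mult O_minus O_diff O_power O_of_nat O_numeral

lemma v_add_eq:
  assumes "x \<noteq> 0" "y \<noteq> 0" "v x < v y"
  shows "x + y \<noteq> 0" "v (x + y) = v x"
proof -
  show nz: "x + y \<noteq> 0"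
    using assms by (metis add_eq_0_iff2 less_irrefl v_minus)
  have "min (v (x + y)) (v (- y)) \<le> v (x + y + - y)"
    using nz assms by (intro v_add) auto
  then show "v (x + y) = v x"
    using v_add[OF assms(1,2) nz] assms(3) by (simp add: v_minus)
qed

definition I :: "'f set" where
  "I = {x. x = 0 \<or> 0 < v x}"

lemma ideal_eq: "valuation_ideal v = I"
  by (simp add: valuation_ideal_def I_def)

lemma carrier_vr [simp]: "carrier (valuation_ring v) = Ov"
  and add_vr [simp]: "add (valuation_ring v) = (+)"
  and mult_vr [simp]: "monoid.mult (valuation_ring v) = (*)"
  and zero_vr [simp]: "zero (valuation_ring v) = 0"
  and one_vr [simp]: "one (valuation_ring v) = 1"
  by (auto simp: valuation_ring_def Ov_def)

lemma cring_vr: "cring (valuation_ring v)"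
proof (intro cringI abelian_groupI comm_monoidI)
  fix x assume "x \<in> carrier (valuation_ring v)"
  then show "\<exists>y\<in>carrier (valuation_ring v). y \<oplus>\<^bsub>valuation_ring v\<^esub> x = \<zero>\<^bsub>valuation_ring v\<^esub>"
    by (intro bexI[of _ "- x"]) (auto intro: O_minus)
qed (auto intro: O_add O_mult simp: algebra_simps)

lemma I_subset_O: "I \<subseteq> Ov"
  by (auto simp: I_def Ov_def)

lemma I_add: "x \<in> I \<Longrightarrow> y \<in> I \<Longrightarrow> x + y \<in> I"
  using v_add[of x y] by (cases "x = 0 \<or> y = 0 \<or> x + y = 0") (auto simp: I_def)

lemma I_minus: "x \<in> I \<Longrightarrow> - x \<in> I"
  by (auto simp: I_def v_minus)

lemma I_mult: "x \<in> Ov \<Longrightarrow> y \<in> I \<Longrightarrow> x * y \<in> I"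
  using v_mult[of x y] by (cases "x = 0 \<or> y = 0") (auto simp: I_def Ov_def)

lemma ideal_vr: "ideal I (valuation_ring v)"
proof (rule idealI)
  show "ring (valuation_ring v)"
    using cring_vr by (rule cring.axioms)
  interpret cring "valuation_ring v"
    by (rule cring_vr)
  have inv: "\<ominus>\<^bsub>valuation_ring v\<^esub> x = - x" if "x \<in> Ov" for x
    using that by (intro minus_equality) (auto intro: O_minus)
  show "subgroup I (add_monoid (valuation_ring v))"
  proof (rule add.subgroupI)
    show "I \<subseteq> carrier (valuation_ring v)" "I \<noteq> {}"
      using I_subset_O by (auto simp: I_def)
    show "\<ominus>\<^bsub>valuation_ring v\<^esub> a \<in> I" if "a \<in> I" for a
      using that inv I_subset_O I_minus by auto
  qed (auto intro: I_add)
next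
  fix a x assume ax: "a \<in> I" "x \<in> carrier (valuation_ring v)"
  show "x \<otimes>\<^bsub>valuation_ring v\<^esub> a \<in> I" "a \<otimes>\<^bsub>valuation_ring v\<^esub> x \<in> I"
    using ax I_mult[of x a] by (simp_all add: mult.commute)
qed

sublocale RI: ideal I "valuation_ring v"
  by (rule ideal_vr)

abbreviation res :: "'f \<Rightarrow> 'f set" where
  "res \<equiv> residue v"

lemma res_eq: "res x = I +>\<^bsub>valuation_ring v\<^esub> x"
  by (simp add: residue_def ideal_eq)

lemma res_image: "res x = (\<lambda>i. i + x) ` I"
  by (auto simp: res_eq a_r_coset_def')

lemma res_eq_iff: "res x = res y \<longleftrightarrow> x - y \<in> I"
proof
  assume "res x = res y"
  moreover have "x \<in> res x"
    unfolding res_image by (intro image_eqI[of _ _ 0]) (auto simp: I_def)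
  ultimately obtain i where "i \<in> I" "x = i + y"
    unfolding res_image by auto
  then show "x - y \<in> I"
    by simp
next
  assume xy: "x - y \<in> I"
  then have yx: "y - x \<in> I"
    using I_minus by fastforce
  show "res x = res y"
  proof (intro equalityI subsetI)
    fix z assume "z \<in> res x"
    then obtain i where "i \<in> I" "z = i + x"
      unfolding res_image by auto
    then show "z \<in> res y"
      unfolding res_image using I_add[OF _ xy] by (intro image_eqI[of _ _ "i + (x - y)"]) auto
  next
    fix z assume "z \<in> res y"
    then obtain i where "i \<in> I" "z = i + y"
      unfolding res_image by auto
    then show "z \<in> res x"
      unfolding res_image using I_add[OF _ yx] by (intro image_eqI[of _ _ "i + (y - x)"]) auto
  qed
qed

lemma residue_field_eq: "residue_field v = valuation_ring v Quot I"
  by (simp add: residue_field_def ideal_eq)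

lemma carrier_rf: "carrier (residue_field v) = res ` Ov"
  by (auto simp: residue_field_eq FactRing_def A_RCOSETS_def RCOSETS_def a_r_coset_def res_eq)

lemma add_rf: "x \<in> Ov \<Longrightarrow> y \<in> Ov \<Longrightarrow> res x \<oplus>\<^bsub>residue_field v\<^esub> res y = res (x + y)"
  using RI.a_rcos_sum[of x y] by (simp add: residue_field_eq FactRing_def res_eq)

lemma mult_rf: "x \<in> Ov \<Longrightarrow> y \<in> Ov \<Longrightarrow> res x \<otimes>\<^bsub>residue_field v\<^esub> res y = res (x * y)"
  using RI.rcoset_mult_add[of x y] by (simp add: residue_field_eq FactRing_def res_eq)

lemma zero_rf: "\<zero>\<^bsub>residue_field v\<^esub> = res 0"
  by (simp add: residue_field_eq FactRing_def res_image)

lemma one_rf: "\<one>\<^bsub>residue_field v\<^esub> = res 1"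
  by (simp add: residue_field_eq FactRing_def res_eq)

lemma ring_rf: "ring (residue_field v)"
  unfolding residue_field_eq by (rule RI.quotient_is_ring)

end

text \<open>The map \<open>e\<close> identifies the residue field with the subfield \<open>C\<close> of a concrete field; its values
  outside the valuation ring are irrelevant.\<close>

locale reduction = place v for v :: "'f::field \<Rightarrow> int" +
  fixes e :: "'f \<Rightarrow> 'c::field" and C :: "'c set"
  assumes e_add: "x \<in> Ov \<Longrightarrow> y \<in> Ov \<Longrightarrow> e (x + y) = e x + e y"
    and e_mult: "x \<in> Ov \<Longrightarrow> y \<in> Ov \<Longrightarrow> e (x * y) = e x * e y"
    and e_1: "e 1 = 1"
    and e_eq_0_iff: "x \<in> Ov \<Longrightarrow> x \<noteq> 0 \<Longrightarrow> e x = 0 \<longleftrightarrow> v x > 0"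
    and e_image: "e ` Ov = C"
begin

lemma e_0 [simp]: "e 0 = 0"
  using e_add[OF O_0 O_0] unfolding add_0_right add_cancel_right_right .

lemma e_minus: "x \<in> Ov \<Longrightarrow> e (- x) = - e x"
  using e_add[of x "- x"] O_minus[of x] by (simp add: eq_neg_iff_add_eq_0 add.commute)

lemma e_diff: "x \<in> Ov \<Longrightarrow> y \<in> Ov \<Longrightarrow> e (x - y) = e x - e y"
  using e_add[of x "- y"] by (simp add: e_minus O_minus)

lemma e_power: "x \<in> Ov \<Longrightarrow> e (x ^ n) = e x ^ n"
  by (induction n) (auto simp: e_1 e_mult O_power)

lemma e_of_nat: "e (of_nat n) = of_nat n"
  by (induction n) (auto simp: e_add e_1 O_of_nat)

lemma e_numeral: "e (numeral n) = numeral n"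
  using e_of_nat[of "numeral n"] by simp

lemma e_nz_iff: "x \<in> Ov \<Longrightarrow> e x \<noteq> 0 \<longleftrightarrow> x \<noteq> 0 \<and> v x = 0"
  using e_eq_0_iff[of x] by (cases "x = 0") (auto simp: Ov_def)

lemma e_I_iff: "x \<in> Ov \<Longrightarrow> x \<in> I \<longleftrightarrow> e x = 0"
  using e_eq_0_iff[of x] by (cases "x = 0") (auto simp: I_def)

lemma e_eq_iff: "x \<in> Ov \<Longrightarrow> y \<in> Ov \<Longrightarrow> res x = res y \<longleftrightarrow> e x = e y"
  by (simp add: res_eq_iff e_I_iff O_diff e_diff)

lemma card_residue: "residue_card v = card C"
proof -
  have "bij_betw (\<lambda>c. e (SOME x. x \<in> Ov \<and> res x = c)) (res ` Ov) C"
  proof -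
    have *: "e (SOME y. y \<in> Ov \<and> res y = res x) = e x" if "x \<in> Ov" for x
    proof -
      have "(SOME y. y \<in> Ov \<and> res y = res x) \<in> Ov \<and> res (SOME y. y \<in> Ov \<and> res y = res x) = res x"
        by (rule someI[of _ x]) (use that in auto)
      then show ?thesis
        using e_eq_iff that by blast
    qed
    show ?thesis
      unfolding bij_betw_def e_image[symmetric] using e_eq_iff by (auto simp: inj_on_def * image_image)
  qed
  then show ?thesis
    unfolding residue_card_def carrier_rf by (rule bij_betw_same_card)
qed

text \<open>Both solution sets are images of the same set \<open>A\<close> of integral pairs that
  solve the equation after reduction, and the two maps have the same fibres.\<close>

lemma card_affine_points:
  assumes "a1 \<in> Ov" "a2 \<in> Ov" "a3 \<in> Ov" "a4 \<in> Ov" "a6 \<in> Ov"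
  shows "card (affine_points (residue_field v) (map_weierstrass res (Weierstrass a1 a2 a3 a4 a6))) =
    card {(x, y). x \<in> C \<and> y \<in> C \<and>
      y * y + e a1 * x * y + e a3 * y = x * x * x + e a2 * x * x + e a4 * x + e a6}"
proof -
  define A where "A = {(x, y). x \<in> Ov \<and> y \<in> Ov \<and>
    e (y * y + a1 * x * y + a3 * y) = e (x * x * x + a2 * x * x + a4 * x + a6)}"
  have 1: "affine_points (residue_field v) (map_weierstrass res (Weierstrass a1 a2 a3 a4 a6)) =
    (\<lambda>(x, y). (res x, res y)) ` A"
  proof -
    have iff: "res y \<otimes>\<^bsub>residue_field v\<^esub> res y \<oplus>\<^bsub>residue_field v\<^esub> res a1 \<otimes>\<^bsub>residue_field v\<^esub> res x \<otimes>\<^bsub>residue_field v\<^esub> res y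
         \<oplus>\<^bsub>residue_field v\<^esub> res a3 \<otimes>\<^bsub>residue_field v\<^esub> res y =
      res x \<otimes>\<^bsub>residue_field v\<^esub> res x \<otimes>\<^bsub>residue_field v\<^esub> res x \<oplus>\<^bsub>residue_field v\<^esub>
        res a2 \<otimes>\<^bsub>residue_field v\<^esub> res x \<otimes>\<^bsub>residue_field v\<^esub> res x \<oplus>\<^bsub>residue_field v\<^esub>
        res a4 \<otimes>\<^bsub>residue_field v\<^esub> res x \<oplus>\<^bsub>residue_field v\<^esub> res a6 \<longleftrightarrow>
      e (y * y + a1 * x * y + a3 * y) = e (x * x * x + a2 * x * x + a4 * x + a6)"
      if "x \<in> Ov" "y \<in> Ov" for x y
      using assms that
      by (subst e_eq_iff[symmetric]) (auto simp: add_rf mult_rf O_closed)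
    show ?thesis
    proof (intro equalityI subsetI)
      fix c assume "c \<in> affine_points (residue_field v) (map_weierstrass res (Weierstrass a1 a2 a3 a4 a6))"
      then obtain x y where xy: "c = (res x, res y)" "x \<in> Ov" "y \<in> Ov"
        and "res y \<otimes>\<^bsub>residue_field v\<^esub> res y \<oplus>\<^bsub>residue_field v\<^esub> res a1 \<otimes>\<^bsub>residue_field v\<^esub> res x \<otimes>\<^bsub>residue_field v\<^esub> res y
          \<oplus>\<^bsub>residue_field v\<^esub> res a3 \<otimes>\<^bsub>residue_field v\<^esub> res y =
        res x \<otimes>\<^bsub>residue_field v\<^esub> res x \<otimes>\<^bsub>residue_field v\<^esub> res x \<oplus>\<^bsub>residue_field v\<^esub>
          res a2 \<otimes>\<^bsub>residue_field v\<^esub> res x \<otimes>\<^bsub>residue_field v\<^esub> res x \<oplus>\<^bsub>residue_field v\<^esub>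
          res a4 \<otimes>\<^bsub>residue_field v\<^esub> res x \<oplus>\<^bsub>residue_field v\<^esub> res a6"
        by (clarsimp simp only: affine_points.simps weierstrass.map carrier_rf mem_Collect_eq)
      then have "(x, y) \<in> A"
        unfolding A_def using iff by simp
      then show "c \<in> (\<lambda>(x, y). (res x, res y)) ` A"
        unfolding xy(1) by (intro image_eqI[of _ _ "(x, y)"]) simp_all
    next
      fix c assume "c \<in> (\<lambda>(x, y). (res x, res y)) ` A"
      then obtain x y where "c = (res x, res y)" "x \<in> Ov" "y \<in> Ov"
        "e (y * y + a1 * x * y + a3 * y) = e (x * x * x + a2 * x * x + a4 * x + a6)"
        unfolding A_def by auto
      then show "c \<in> affine_points (residue_field v) (map_weierstrass res (Weierstrass a1 a2 a3 a4 a6))"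
        using iff[of x y] by (simp add: carrier_rf)
    qed
  qed
  have 2: "{(x, y). x \<in> C \<and> y \<in> C \<and>
      y * y + e a1 * x * y + e a3 * y = x * x * x + e a2 * x * x + e a4 * x + e a6} =
    (\<lambda>(x, y). (e x, e y)) ` A"
  proof -
    have iff: "e (y * y + a1 * x * y + a3 * y) = e (x * x * x + a2 * x * x + a4 * x + a6) \<longleftrightarrow>
      e y * e y + e a1 * e x * e y + e a3 * e y = e x * e x * e x + e a2 * e x * e x + e a4 * e x + e a6"
      if "x \<in> Ov" "y \<in> Ov" for x y
      using assms that by (simp add: e_add e_mult O_closed)
    show ?thesis
      unfolding A_def e_image[symmetric] by (auto simp: iff image_iff)
  qed
  have "card ((\<lambda>(x, y). (res x, res y)) ` A) = card ((\<lambda>(x, y). (e x, e y)) ` A)"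
  proof (rule bij_betw_same_card)
    define h where "h c = (let s = SOME s. s \<in> A \<and> (res (fst s), res (snd s)) = c in (e (fst s), e (snd s)))" for c
    have *: "h (res x, res y) = (e x, e y)" if "(x, y) \<in> A" for x y
    proof -
      define s where "s = (SOME s. s \<in> A \<and> (res (fst s), res (snd s)) = (res x, res y))"
      have "s \<in> A \<and> (res (fst s), res (snd s)) = (res x, res y)"
        unfolding s_def by (rule someI[of _ "(x, y)"]) (use that in auto)
      then have "e (fst s) = e x" "e (snd s) = e y"
        using that e_eq_iff by (auto simp: A_def)
      then show ?thesis
        by (simp add: h_def s_def Let_def)
    qed
    show "bij_betw h ((\<lambda>(x, y). (res x, res y)) ` A) ((\<lambda>(x, y). (e x, e y)) ` A)"
    proof (intro bij_betw_imageI)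
      show "inj_on h ((\<lambda>(x, y). (res x, res y)) ` A)"
      proof (rule inj_onI, elim imageE, clarify)
        fix x y x' y' assume A: "(x, y) \<in> A" "(x', y') \<in> A" "h (res x, res y) = h (res x', res y')"
        then have "e x = e x'" "e y = e y'"
          by (simp_all add: *)
        then show "res x = res x' \<and> res y = res y'"
          using A e_eq_iff by (auto simp: A_def)
      qed
      show "h ` (\<lambda>(x, y). (res x, res y)) ` A = (\<lambda>(x, y). (e x, e y)) ` A"
        unfolding image_image by (intro image_cong refl) (auto simp: *)
    qed
  qed
  then show ?thesis
    by (simp only: 1 2)
qed

end

lemma (in reduction) place_degree_eq:
  fixes \<iota> :: "'k::{field,finite} \<Rightarrow> 'f"
  assumes \<iota>: "\<And>c. \<iota> c \<in> Ov" "\<And>c c'. \<iota> (c + c') = \<iota> c + \<iota> c'" "\<And>c c'. \<iota> (c * c') = \<iota> c * \<iota> c'" "\<iota> 1 = 1"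
    and C: "card C = CARD('k) ^ n"
  shows "ring.dim (residue_field v) (range (\<lambda>c. res (\<iota> c))) (carrier (residue_field v)) = n"
proof -
  interpret R: ring "residue_field v"
    by (rule ring_rf)
  interpret K: field "ring_of_type_algebra :: 'k ring"
    by (rule field_from_type_algebra)
  have hom: "(\<lambda>c. res (\<iota> c)) \<in> ring_hom (ring_of_type_algebra :: 'k ring) (residue_field v)"
    by (rule ring_hom_memI)
      (auto simp: ring_of_type_algebra_def carrier_rf \<iota> mult_rf add_rf one_rf)
  interpret H: ring_hom_ring "ring_of_type_algebra :: 'k ring" "residue_field v" "\<lambda>c. res (\<iota> c)"
    by (rule ring_hom_ringI2[OF K.ring_axioms ring_rf hom])
  have nz: "\<one>\<^bsub>residue_field v\<^esub> \<noteq> \<zero>\<^bsub>residue_field v\<^esub>"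
    by (simp add: one_rf zero_rf e_eq_iff e_1)
  have car: "carrier (ring_of_type_algebra :: 'k ring) = UNIV"
    by (simp add: ring_of_type_algebra_def)
  note img = H.img_is_subfield[OF K.carrier_is_subfield nz, unfolded car]
  have "card (carrier (residue_field v)) = card (range (\<lambda>c. res (\<iota> c))) ^ n"
    using card_residue C card_image[OF img(1)] by (simp add: residue_card_def)
  moreover have "card (carrier (residue_field v)) > 0"
    using card_residue C by (simp add: residue_card_def)
  ultimately show ?thesis
    using R.dim_finite[OF img(2)] card_ge_0_finite by blast
qed

section \<open>Places of the rational function field\<close>

text \<open>Extends an order function from a domain to its fractions; additivity of \<open>w\<close>
  on products makes the chosen value independent of the representation.\<close>

definition fract_val :: "('r::idom \<Rightarrow> int) \<Rightarrow> 'r fract \<Rightarrow> int" where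
  "fract_val w r = (if r = 0 then 0 else (SOME k. \<exists>a b. a \<noteq> 0 \<and> b \<noteq> 0 \<and> r = Fract a b \<and> k = w a - w b))"

lemma fract_val_Fract:
  assumes w: "\<And>a b. a \<noteq> 0 \<Longrightarrow> b \<noteq> 0 \<Longrightarrow> w (a * b) = w a + w b" and ab: "a \<noteq> 0" "b \<noteq> 0"
  shows "fract_val w (Fract a b) = w a - w b"
proof -
  have nz: "Fract a b \<noteq> 0"
    using ab by (simp add: Zero_fract_def eq_fract)
  define k where "k = (SOME k. \<exists>c e. c \<noteq> 0 \<and> e \<noteq> 0 \<and> Fract a b = Fract c e \<and> k = w c - w e)"
  have "\<exists>c e. c \<noteq> 0 \<and> e \<noteq> 0 \<and> Fract a b = Fract c e \<and> k = w c - w e"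
    unfolding k_def by (rule someI[of _ "w a - w b"]) (use ab in blast)
  then obtain c e where ce: "c \<noteq> 0" "e \<noteq> 0" "Fract a b = Fract c e" "k = w c - w e"
    by blast
  then have "w (a * e) = w (c * b)"
    using ab by (simp add: eq_fract)
  then have "k = w a - w b"
    using ab ce by (simp add: w)
  then show ?thesis
    using nz by (simp add: fract_val_def k_def)
qed

lemma Fract_nz_cases:
  fixes r :: "'r::idom fract"
  assumes "r \<noteq> 0"
  obtains a b where "a \<noteq> 0" "b \<noteq> 0" "r = Fract a b"
proof -
  obtain a b where "r = Fract a b" "b \<noteq> 0"
    by (cases r) auto
  moreover from this have "a \<noteq> 0"
    using assms by (auto simp: Zero_fract_def eq_fract)
  ultimately show thesis
    using that by blast
qed

lemma is_place_fract_val: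
  fixes w :: "'r::idom \<Rightarrow> int"
  assumes mult: "\<And>a b. a \<noteq> 0 \<Longrightarrow> b \<noteq> 0 \<Longrightarrow> w (a * b) = w a + w b"
    and add: "\<And>a b. a \<noteq> 0 \<Longrightarrow> b \<noteq> 0 \<Longrightarrow> a + b \<noteq> 0 \<Longrightarrow> min (w a) (w b) \<le> w (a + b)"
    and unif: "a0 \<noteq> 0" "b0 \<noteq> 0" "w a0 - w b0 = 1"
  shows "is_place (fract_val w)"
proof -
  note val = fract_val_Fract[of w, OF mult]
  have v_mult: "fract_val w (x * y) = fract_val w x + fract_val w y" if xy: "x \<noteq> 0" "y \<noteq> 0" for x y
  proof -
    obtain a b c d where "x = Fract a b" "y = Fract c d" "a \<noteq> 0" "b \<noteq> 0" "c \<noteq> 0" "d \<noteq> 0"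
      using xy by (metis Fract_nz_cases)
    then show ?thesis
      by (simp add: val mult)
  qed
  have v_add: "min (fract_val w x) (fract_val w y) \<le> fract_val w (x + y)"
    if xy: "x \<noteq> 0" "y \<noteq> 0" "x + y \<noteq> 0" for x y
  proof -
    obtain a b c d where ab: "x = Fract a b" "y = Fract c d" "a \<noteq> 0" "b \<noteq> 0" "c \<noteq> 0" "d \<noteq> 0"
      using xy by (metis Fract_nz_cases)
    have "a * d + c * b \<noteq> 0"
      using xy(3) ab by (auto simp: Zero_fract_def eq_fract)
    then show ?thesis
      using ab add[of "a * d" "c * b"] by (simp add: val mult)
  qed
  have surj: "\<exists>x. x \<noteq> 0 \<and> fract_val w x = n" for n
  proof -
    define x where "x = Fract a0 b0"
    have x: "x \<noteq> 0" "fract_val w x = 1"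
      using unif by (auto simp: x_def val Zero_fract_def eq_fract)
    have v1: "fract_val w 1 = 0"
      using v_mult[of 1 1] by simp
    have pow: "fract_val w (x ^ k) = int k" for k
      by (induction k) (use x v1 in \<open>auto simp: v_mult\<close>)
    show ?thesis
    proof (cases "n \<ge> 0")
      case True
      then show ?thesis
        using pow[of "nat n"] x by (intro exI[of _ "x ^ nat n"]) auto
    next
      case False
      have "fract_val w (x ^ nat (- n) * inverse (x ^ nat (- n))) =
          fract_val w (x ^ nat (- n)) + fract_val w (inverse (x ^ nat (- n)))"
        using x by (intro v_mult) auto
      moreover have "x ^ nat (- n) * inverse (x ^ nat (- n)) = 1"
        using x by simp
      ultimately show ?thesis
        using False pow[of "nat (- n)"] v1 x by (intro exI[of _ "inverse (x ^ nat (- n))"]) auto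
    qed
  qed
  have "fract_val w ` (UNIV - {0}) = UNIV"
  proof (intro equalityI subsetI UNIV_I)
    fix n :: int
    obtain x where "x \<noteq> 0" "fract_val w x = n"
      using surj by blast
    then show "n \<in> fract_val w ` (UNIV - {0})"
      by (intro image_eqI[of _ _ x]) auto
  qed
  then show ?thesis
    unfolding is_place_def using v_mult v_add by (simp add: fract_val_def)
qed

lemma coeff_mult_bounded:
  assumes "degree a \<le> m" "degree b \<le> n"
  shows "coeff (a * b) (m + n) = coeff a m * (coeff b n :: 'a::comm_semiring_0)"
proof -
  have "coeff (a * b) (m + n) = (\<Sum>i\<le>m + n. coeff a i * coeff b (m + n - i))"
    by (rule coeff_mult)
  also have "\<dots> = (\<Sum>i\<in>{m}. coeff a i * coeff b (m + n - i))"
  proof (rule sum.mono_neutral_right)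
    show "\<forall>i\<in>{..m + n} - {m}. coeff a i * coeff b (m + n - i) = 0"
    proof
      fix i assume "i \<in> {..m + n} - {m}"
      then have "i > m \<or> m + n - i > n"
        by auto
      then show "coeff a i * coeff b (m + n - i) = 0"
        using assms by (auto simp: coeff_eq_0)
    qed
  qed auto
  finally show ?thesis
    by simp
qed

lemma finite_field_power_card: "(c :: 'k::{field,finite}) ^ CARD('k) = c"
proof (cases "c = 0")
  case False
  have "(\<Prod>y\<in>UNIV - {0}. c * y) = (\<Prod>y\<in>UNIV - {0}. y)"
    by (rule prod.reindex_bij_witness[of _ "\<lambda>y. y / c" "\<lambda>y. c * y"]) (use False in auto)
  then have "c ^ (CARD('k) - 1) * (\<Prod>y\<in>UNIV - {0::'k}. y) = 1 * (\<Prod>y\<in>UNIV - {0::'k}. y)"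
    by (simp add: prod.distrib)
  then have "c ^ (CARD('k) - 1) = 1"
    by (subst (asm) mult_right_cancel) auto
  then have "c * c ^ (CARD('k) - 1) = c"
    by simp
  then show ?thesis
    by (simp flip: power_Suc)
qed simp

locale function_field =
  fixes ty :: "'k::{field,finite} itself" and q :: nat
  assumes CARD_k: "CARD('k) = q" and odd_card: "odd q" and prime_CHAR: "prime CHAR('k)"
    and card_power: "\<exists>e>0. q = CHAR('k) ^ e"
begin

sublocale galois_field q "TYPE('k alg_closure)"
  by unfold_locales (use odd_card prime_CHAR card_power in auto)

abbreviation ac :: "'k poly \<Rightarrow> 'k alg_closure poly" where
  "ac \<equiv> map_poly to_ac"

lemma GF_q: "(GF q :: 'k alg_closure set) = range to_ac"
proof (rule card_subset_eq[symmetric])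
  show "range to_ac \<subseteq> (GF q :: 'k alg_closure set)"
    using finite_field_power_card[where ?'k = 'k] CARD_k by (auto simp: GF_def simp flip: to_ac_power)
  show "card (range (to_ac :: 'k \<Rightarrow> _)) = card (GF q :: 'k alg_closure set)"
    using CARD_k by (simp add: card_image inj_to_ac card_GF)
qed simp

lemma ac_mult: "ac (f * g) = ac f * ac g"
  by (rule map_poly_mult_hom) auto

lemma ac_add: "ac (f + g) = ac f + ac g"
  by (intro poly_eqI) (simp add: coeff_map_poly)

lemma ac_diff: "ac (f - g) = ac f - ac g"
  by (intro poly_eqI) (simp add: coeff_map_poly)

lemma ac_eq_0_iff [simp]: "ac f = 0 \<longleftrightarrow> f = 0"
  by (rule map_poly_eq_0_iff) auto

lemma degree_ac [simp]: "degree (ac f) = degree f"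
  by (rule degree_map_poly) auto

lemma ac_pCons: "ac (pCons a f) = pCons (to_ac a) (ac f)"
  by (rule map_poly_pCons) auto

lemma frob_poly_ac: "frob_poly (ac f) = ac f"
  using GF_q by (auto simp: frob_poly_fixed_iff coeff_map_poly)

lemma ac_of_ac: "frob_poly g = g \<Longrightarrow> ac (map_poly of_ac g) = g"
  using GF_q by (auto intro!: poly_eqI simp: frob_poly_fixed_iff coeff_map_poly to_ac_of_ac)

lemma periodic: "\<exists>m>0. x ^ (q ^ m) = (x :: 'k alg_closure)"
proof -
  obtain f :: "'k poly" where f: "f \<noteq> 0" "poly (ac f) x = 0"
    by (rule alg_closure_algebraic)
  define g where "g = Polynomial.smult (inverse (lead_coeff f)) f"
  have "lead_coeff g = 1"
    using f(1) by (simp add: g_def)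
  then have "ac g \<in> monics (degree g)"
    by (simp add: monics_def frob_poly_ac coeff_map_poly)
  moreover have "poly (ac g) x = 0"
    using f(2) by (simp add: g_def map_poly_smult)
  ultimately show ?thesis
    by (rule root_periodic)
qed

lemmas period_pos = period_pos[OF periodic]
  and power_period = power_period[OF periodic]

definition minpoly :: "'k alg_closure \<Rightarrow> 'k poly" where
  "minpoly x = map_poly of_ac (cpoly (period x) x)"

lemma ac_minpoly: "ac (minpoly x) = cpoly (period x) x"
  unfolding minpoly_def by (rule ac_of_ac) (rule monics_fixed[OF cpoly_period_monics[OF periodic]])

lemma degree_minpoly: "degree (minpoly x) = period x"
  using monics_degree[OF cpoly_period_monics[OF periodic]] degree_ac[of "minpoly x"] by (simp add: ac_minpoly)

lemma minpoly_nz: "minpoly x \<noteq> 0"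
  using degree_minpoly[of x] period_pos[of x] by auto

lemma poly_minpoly: "poly (ac (minpoly x)) x = 0"
  unfolding ac_minpoly poly_cpoly using period_pos[of x] by (auto intro!: bexI[of _ 0])

lemma root_minpoly_iff: "poly (ac (minpoly x)) y = 0 \<longleftrightarrow> (\<exists>j<period x. y = x ^ (q ^ j))"
  unfolding ac_minpoly poly_cpoly by auto

lemma order_minpoly:
  assumes "poly (ac (minpoly x)) y = 0"
  shows "Polynomial.order y (ac (minpoly x)) = 1"
  using assms unfolding root_minpoly_iff unfolding ac_minpoly cpoly_period_eq[OF periodic]
  by (subst order_prod_linear) auto

lemma minpoly_dvd_iff: "minpoly x dvd f \<longleftrightarrow> poly (ac f) x = 0"
proof
  assume f: "poly (ac f) x = 0"
  define r where "r = f mod minpoly x"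
  have fr: "f = minpoly x * (f div minpoly x) + r"
    by (simp add: r_def)
  have "poly (ac r) x = 0"
    using f poly_minpoly[of x] by (subst (asm) fr) (simp add: ac_add ac_mult)
  then have "ac (minpoly x) dvd ac r"
    unfolding ac_minpoly by (intro cpoly_period_dvd periodic frob_poly_ac)
  moreover have "r = 0 \<or> degree r < degree (minpoly x)"
    unfolding r_def using minpoly_nz degree_mod_less by blast
  ultimately have "r = 0"
    using dvd_imp_degree_le[of "ac (minpoly x)" "ac r"] degree_ac ac_eq_0_iff by (metis leD)
  then show "minpoly x dvd f"
    by (simp add: r_def mod_eq_0_iff_dvd)
qed (auto elim!: dvdE simp: ac_mult poly_minpoly)

lemma minpoly_degree_le: "f \<noteq> 0 \<Longrightarrow> poly (ac f) x = 0 \<Longrightarrow> period x \<le> degree f"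
  using minpoly_dvd_iff[of x f] dvd_imp_degree_le[of "minpoly x" f] degree_minpoly[of x] by simp

text \<open>Multiplicity is measured at a single conjugate in the closure. As minimal polynomials
  have simple roots, it is the exponent of \<open>minpoly x\<close> in \<open>f\<close>.\<close>

definition ord_at :: "'k alg_closure \<Rightarrow> 'k poly \<Rightarrow> int" where
  "ord_at x f = int (Polynomial.order x (ac f))"

lemma ord_at_mult: "f \<noteq> 0 \<Longrightarrow> g \<noteq> 0 \<Longrightarrow> ord_at x (f * g) = ord_at x f + ord_at x g"
  by (simp add: ord_at_def ac_mult order_mult)

lemma ord_at_eq_0_iff: "f \<noteq> 0 \<Longrightarrow> ord_at x f = 0 \<longleftrightarrow> poly (ac f) x \<noteq> 0"
  by (simp add: ord_at_def order_eq_0_iff)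

lemma ord_at_nonneg: "ord_at x f \<ge> 0"
  by (simp add: ord_at_def)

lemma ord_at_add:
  assumes "f \<noteq> 0" "g \<noteq> 0" "f + g \<noteq> 0"
  shows "min (ord_at x f) (ord_at x g) \<le> ord_at x (f + g)"
proof -
  define n where "n = min (Polynomial.order x (ac f)) (Polynomial.order x (ac g))"
  have "[:- x, 1:] ^ n dvd ac f" "[:- x, 1:] ^ n dvd ac g"
    by (simp_all add: order_divides n_def)
  then have "[:- x, 1:] ^ n dvd ac (f + g)"
    by (simp add: ac_add)
  then have "n \<le> Polynomial.order x (ac (f + g))"
    using assms by (simp add: order_divides)
  then show ?thesis
    by (simp add: ord_at_def n_def)
qed

definition place_at :: "'k alg_closure \<Rightarrow> 'k poly fract \<Rightarrow> int" where
  "place_at x = fract_val (ord_at x)"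

lemma is_place_place_at: "is_place (place_at x)"
  unfolding place_at_def
proof (rule is_place_fract_val)
  show "minpoly x \<noteq> 0" "(1 :: 'k poly) \<noteq> 0"
    using minpoly_nz by auto
  show "ord_at x (minpoly x) - ord_at x 1 = 1"
    using order_minpoly[OF poly_minpoly] by (simp add: ord_at_def)
qed (auto intro: ord_at_mult ord_at_add)

lemma place_at_Fract: "a \<noteq> 0 \<Longrightarrow> b \<noteq> 0 \<Longrightarrow> place_at x (Fract a b) = ord_at x a - ord_at x b"
  unfolding place_at_def by (rule fract_val_Fract) (auto intro: ord_at_mult)

lemma Fract_1_nz: "a \<noteq> 0 \<Longrightarrow> Fract a 1 \<noteq> (0 :: 'k poly fract)"
  by (simp add: Zero_fract_def eq_fract)

definition place_inf :: "'k poly fract \<Rightarrow> int" where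
  "place_inf = fract_val (\<lambda>f. - int (degree f))"

lemma place_inf_Fract: "a \<noteq> 0 \<Longrightarrow> b \<noteq> 0 \<Longrightarrow> place_inf (Fract a b) = int (degree b) - int (degree a)"
  unfolding place_inf_def by (subst fract_val_Fract) (auto simp: degree_mult_eq)

lemma is_place_place_inf: "is_place place_inf"
  unfolding place_inf_def
proof (rule is_place_fract_val)
  show "(1 :: 'k poly) \<noteq> 0" "[:0, 1 :: 'k:] \<noteq> 0" "- int (degree (1 :: 'k poly)) - - int (degree [:0, 1 :: 'k:]) = 1"
    by auto
  show "min (- int (degree a)) (- int (degree b)) \<le> - int (degree (a + b))" for a b :: "'k poly"
    using degree_add_le_max[of a b] by linarith
qed (auto simp: degree_mult_eq)

lemma place_eqI:
  assumes "place v" "place w" "\<And>f. f \<noteq> 0 \<Longrightarrow> v (Fract f 1) = w (Fract f 1)"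
  shows "v = (w :: 'k poly fract \<Rightarrow> int)"
proof
  interpret v: place v by fact
  interpret w: place w by fact
  fix r
  show "v r = w r"
  proof (cases "r = 0")
    case False
    then obtain a b where ab: "a \<noteq> 0" "b \<noteq> 0" "r = Fract a b"
      by (rule Fract_nz_cases)
    have "r = Fract a 1 / Fract b 1"
      by (simp add: ab)
    moreover have "v (Fract a 1 / Fract b 1) = w (Fract a 1 / Fract b 1)"
      using ab assms(3) v.v_divide[OF Fract_1_nz Fract_1_nz] w.v_divide[OF Fract_1_nz Fract_1_nz] by metis
    ultimately show ?thesis
      by simp
  qed (simp add: v.v_0 w.v_0)
qed

lemma place_place_at: "place (place_at x)"
  by (simp add: place.intro is_place_place_at)

lemma place_place_inf: "place place_inf"
  by (simp add: place.intro is_place_place_inf)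

text \<open>Factors \<open>minpoly x\<close> have simple zeros at all conjugates and are divided off
  one by one; a polynomial over \<open>'k\<close> not vanishing at \<open>x\<close> does not vanish
  at a conjugate.\<close>

lemma ord_at_conj:
  assumes "y = x ^ (q ^ j)" "j < period x" "f \<noteq> 0"
  shows "ord_at x f = ord_at y f"
  using assms(3)
proof (induction "degree f" arbitrary: f rule: less_induct)
  case less
  show ?case
  proof (cases "poly (ac f) x = 0")
    case True
    then obtain g where g: "f = minpoly x * g"
      unfolding minpoly_dvd_iff[symmetric] by (rule dvdE)
    have g0: "g \<noteq> 0"
      using g less.prems by auto
    have "degree g < degree f"
      using g g0 minpoly_nz period_pos[of x] degree_minpoly[of x] by (simp add: degree_mult_eq)
    then have "ord_at x g = ord_at y g"
      using less.hyps g0 by blast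
    moreover have "poly (ac (minpoly x)) y = 0"
      unfolding root_minpoly_iff using assms by blast
    ultimately show ?thesis
      using g0 minpoly_nz order_minpoly poly_minpoly by (simp add: g ord_at_mult) (simp add: ord_at_def)
  next
    case False
    have "poly (ac f) y = poly (ac f) x ^ (q ^ j)"
      unfolding assms(1) by (intro poly_fixed_power frob_poly_ac)
    then have "poly (ac f) y \<noteq> 0"
      using False by simp
    then show ?thesis
      using False less.prems ord_at_eq_0_iff by metis
  qed
qed

text \<open>The value at \<open>minpoly x\<close> detects the conjugates of \<open>x\<close>. Finite
  places thereby become Frobenius orbits, which turns sums over places into sums over
  elements.\<close>

lemma place_at_eq_iff: "place_at y = place_at x \<longleftrightarrow> (\<exists>j<period x. y = x ^ (q ^ j))"
proof
  assume eq: "place_at y = place_at x"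
  have "place_at x (Fract (minpoly x) 1) = 1"
    using minpoly_nz order_minpoly[OF poly_minpoly] by (simp add: place_at_Fract) (simp add: ord_at_def)
  then have "ord_at y (minpoly x) - ord_at y 1 = 1"
    using minpoly_nz place_at_Fract[of "minpoly x" 1 y] by (simp add: eq)
  then have "poly (ac (minpoly x)) y = 0"
    using ord_at_eq_0_iff[OF minpoly_nz, of y x] by (auto simp: ord_at_def)
  then show "\<exists>j<period x. y = x ^ (q ^ j)"
    by (simp add: root_minpoly_iff)
next
  assume "\<exists>j<period x. y = x ^ (q ^ j)"
  then obtain j where j: "y = x ^ (q ^ j)" "j < period x"
    by auto
  show "place_at y = place_at x"
    by (intro place_eqI place_place_at) (simp add: place_at_Fract ord_at_conj[OF j])
qed

lemma card_place_at_fibre: "card {y. place_at y = place_at x} = period x"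
proof -
  have "{y. place_at y = place_at x} = (\<lambda>j. x ^ (q ^ j)) ` {..<period x}"
    by (auto simp: place_at_eq_iff)
  then show ?thesis
    using inj_on_period[OF periodic] by (simp add: card_image)
qed

lemma place_inf_neq_place_at: "place_at x \<noteq> place_inf"
proof
  assume "place_at x = place_inf"
  then have "place_at x (Fract (minpoly x) 1) = place_inf (Fract (minpoly x) 1)"
    by simp
  then show False
    using minpoly_nz order_minpoly[OF poly_minpoly] degree_minpoly[of x] period_pos[of x]
    by (simp add: place_at_Fract place_inf_Fract) (simp add: ord_at_def)
qed

text \<open>If X has a pole, the top term dominates and the value is a multiple of the degree.
  Otherwise all polynomials are integral, and those of positive value are the multiples of a minimal
  polynomial. Surjectivity of \<open>v\<close> normalises the multiple.\<close>

theorem place_classification: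
  assumes "is_place (v :: 'k poly fract \<Rightarrow> int)"
  shows "v = place_inf \<or> (\<exists>x. v = place_at x)"
proof -
  interpret v: place v
    using assms by (rule place.intro)
  define w where "w f = v (Fract f 1)" for f
  have w_mult: "w (f * g) = w f + w g" if "f \<noteq> 0" "g \<noteq> 0" for f g
    using that v.v_mult[of "Fract f 1" "Fract g 1"] by (simp add: w_def Fract_1_nz)
  have w_add: "min (w f) (w g) \<le> w (f + g)" if "f \<noteq> 0" "g \<noteq> 0" "f + g \<noteq> 0" for f g
    using that v.v_add[of "Fract f 1" "Fract g 1"] by (simp add: w_def Fract_1_nz)
  have w_add_eq: "w (f + g) = w g" if "f \<noteq> 0" "g \<noteq> 0" "w g < w f" for f g
    using that v.v_add_eq[of "Fract g 1" "Fract f 1"] by (simp add: w_def Fract_1_nz add.commute)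
  \<comment> \<open>Nonzero constants are roots of unity, and the integers have no torsion.\<close>
  have w_const: "w [:c:] = 0" if "c \<noteq> 0" for c
  proof -
    have "Fract [:c:] 1 ^ n = (Fract [:c ^ n:] 1 :: 'k poly fract)" for n
      by (induction n) (auto simp: One_fract_def one_pCons mult.commute)
    then have "Fract [:c:] 1 ^ (q - 1) = (Fract [:c ^ (q - 1):] 1 :: 'k poly fract)" .
    moreover have "c ^ (q - 1) = 1"
    proof -
      have "c * c ^ (q - 1) = c * 1"
        using finite_field_power_card[of c] Q_pos by (simp add: CARD_k flip: power_Suc)
      then show ?thesis
        using that by simp
    qed
    ultimately have "Fract [:c:] 1 ^ (q - 1) = (1 :: 'k poly fract)"
      by (simp add: One_fract_def one_pCons)
    then have "int (q - 1) * w [:c:] = 0"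
      using v.v_power[of "Fract [:c:] 1" "q - 1"] that by (simp add: w_def Fract_1_nz)
    then show ?thesis
      using Q_ge by auto
  qed
  have pCons_eq: "pCons c f = [:c:] + [:0, 1:] * f" for c and f :: "'k poly"
    by simp
  show ?thesis
  proof (cases "w [:0, 1:] < 0")
    case True
    have deg: "w f = int (degree f) * w [:0, 1:]" if "f \<noteq> 0" for f
      using that
    proof (induction f)
      case (pCons c f)
      show ?case
      proof (cases "f = 0")
        case True
        then show ?thesis
          using pCons w_const by simp
      next
        case False
        have m: "w ([:0, 1:] * f) = w [:0, 1:] + int (degree f) * w [:0, 1:]"
          using False pCons.IH by (subst w_mult) auto
        have "w (pCons c f) = w ([:0, 1:] * f)"
        proof (cases "c = 0")
          case c: False
          have "w [:0, 1:] + int (degree f) * w [:0, 1:] < 0"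
            using True by (simp add: add_neg_nonpos mult_nonneg_nonpos)
          then have "w ([:c:] + [:0, 1:] * f) = w ([:0, 1:] * f)"
            using c False m by (intro w_add_eq) (auto simp: w_const)
          then show ?thesis
            by (simp flip: pCons_eq)
        qed simp
        then show ?thesis
          using m False by (simp add: algebra_simps)
      qed
    qed simp
    have "w [:0, 1:] = - 1"
    proof -
      obtain r where r: "r \<noteq> 0" "v r = - 1"
        using v.v_surj by blast
      obtain a b where ab: "a \<noteq> 0" "b \<noteq> 0" "r = Fract a b"
        using r(1) by (rule Fract_nz_cases)
      then have "r = Fract a 1 / Fract b 1"
        by simp
      then have "v r = w a - w b"
        unfolding w_def using v.v_divide[OF Fract_1_nz[OF ab(1)] Fract_1_nz[OF ab(2)]] by simp
      then have "(int (degree a) - int (degree b)) * w [:0, 1:] = - 1"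
        using r(2) deg[OF ab(1)] deg[OF ab(2)] by (simp only: left_diff_distrib)
      then have "(- w [:0, 1:]) * (int (degree a) - int (degree b)) = 1"
        by (simp add: mult.commute)
      then have "- w [:0, 1:] = 1"
        using True by (subst (asm) pos_zmult_eq_1_iff) auto
      then show ?thesis
        by simp
    qed
    then have "v (Fract f 1) = place_inf (Fract f 1)" if "f \<noteq> 0" for f
      using deg[OF that] place_inf_Fract[of f 1] that by (simp add: w_def)
    then have "v = place_inf"
      by (intro place_eqI v.place_axioms place_place_inf)
    then show ?thesis ..
  next
    case False
    have nonneg: "w f \<ge> 0" if "f \<noteq> 0" for f
      using that
    proof (induction f)
      case (pCons c f)
      show ?case
      proof (cases "f = 0")
        case True
        then show ?thesis
          using pCons w_const by simp
      next
        case f: False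
        have m: "w ([:0, 1:] * f) \<ge> 0"
          using f False pCons.IH by (subst w_mult) auto
        show ?thesis
        proof (cases "c = 0")
          case c: False
          then show ?thesis
            using w_add[of "[:c:]" "[:0, 1:] * f"] f m w_const[OF c] by (simp flip: pCons_eq)
        qed (use m in simp)
      qed
    qed simp
    obtain r where r: "r \<noteq> 0" "v r = 1"
      using v.v_surj by blast
    obtain a b where ab: "a \<noteq> 0" "b \<noteq> 0" "r = Fract a b"
      using r(1) by (rule Fract_nz_cases)
    then have "r = Fract a 1 / Fract b 1"
      by simp
    then have "v r = w a - w b"
      unfolding w_def using v.v_divide[OF Fract_1_nz[OF ab(1)] Fract_1_nz[OF ab(2)]] by simp
    then have "w a > 0"
      using r(2) nonneg[OF ab(2)] by linarith
    define M where "M = {f. f \<noteq> 0 \<and> w f > 0}"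
    have "a \<in> M"
      using ab(1) \<open>w a > 0\<close> by (simp add: M_def)
    then obtain g where "g \<in> M" and "\<And>f. f \<in> M \<Longrightarrow> degree g \<le> degree f"
      using ex_has_least_nat[of "\<lambda>f. f \<in> M" a degree] by blast
    then have g: "g \<noteq> 0 \<and> w g > 0" and least: "\<And>f. f \<noteq> 0 \<and> w f > 0 \<Longrightarrow> degree g \<le> degree f"
      by (simp_all add: M_def)
    have "degree g > 0"
    proof (rule ccontr)
      assume "\<not> degree g > 0"
      then obtain c where "g = [:c:]"
        by (auto elim: degree_eq_zeroE)
      then show False
        using g w_const by auto
    qed
    then obtain x where x: "poly (ac g) x = 0"
      using alg_closed_imp_poly_has_root[of "ac g"] by auto
    \<comment> \<open>Division by \<open>g\<close> leaves a remainder of positive value and smaller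
      degree, which must be 0 by the choice of \<open>g\<close>; so \<open>f\<close> inherits the
      root of \<open>g\<close>.\<close>
    have root: "poly (ac f) x = 0" if f: "f \<noteq> 0" "w f > 0" for f
    proof -
      define s where "s = f mod g"
      have s: "s = f - g * (f div g)"
        by (simp add: s_def minus_mult_div_eq_mod)
      have "s = 0"
      proof (rule ccontr)
        assume s0: "s \<noteq> 0"
        have "w s > 0"
        proof (cases "f div g = 0")
          case True
          then show ?thesis
            using s f by simp
        next
          case False
          have "w (- (g * (f div g))) = w (g * (f div g))"
            by (simp add: w_def v.v_minus flip: minus_fract)
          also have "\<dots> > 0"
            using g nonneg[OF False] False by (simp add: w_mult)
          finally show ?thesis
            using w_add[of f "- (g * (f div g))"] f g False s0 s by auto
        qed
        moreover have "degree s < degree g"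
          using s0 g degree_mod_less[of g f] by (auto simp: s_def)
        ultimately show False
          using least[of s] s0 by auto
      qed
      then have "f = g * (f div g)"
        using s by simp
      then show ?thesis
        using x by (metis ac_mult mult_zero_left poly_mult)
    qed
    have w_pi: "w (minpoly x) > 0"
    proof -
      obtain h where h: "g = minpoly x * h"
        using x unfolding minpoly_dvd_iff[symmetric] by (rule dvdE)
      have h0: "h \<noteq> 0"
        using h g by auto
      have "degree h < degree g"
        using h0 minpoly_nz degree_minpoly[of x] period_pos[of x] by (simp add: h degree_mult_eq)
      then have "w h \<le> 0"
        using least[of h] h0 by force
      then show ?thesis
        using g h0 minpoly_nz by (simp add: h w_mult)
    qed
    have w_eq: "w f = w (minpoly x) * ord_at x f" if "f \<noteq> 0" for f
      using that
    proof (induction "degree f" arbitrary: f rule: less_induct)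
      case less
      show ?case
      proof (cases "poly (ac f) x = 0")
        case True
        then obtain h where h: "f = minpoly x * h"
          unfolding minpoly_dvd_iff[symmetric] by (rule dvdE)
        have h0: "h \<noteq> 0"
          using h less.prems by auto
        have "degree h < degree f"
          using h h0 minpoly_nz period_pos[of x] degree_minpoly[of x] by (simp add: degree_mult_eq)
        then have IH: "w h = w (minpoly x) * ord_at x h"
          using less.hyps h0 by blast
        have "ord_at x (minpoly x) = 1"
          using order_minpoly[OF poly_minpoly] by (simp add: ord_at_def)
        then show ?thesis
          using h0 minpoly_nz IH by (simp add: h w_mult ord_at_mult algebra_simps)
      next
        case False
        then have "\<not> w f > 0"
          using root less.prems by blast
        then show ?thesis
          using False nonneg[OF less.prems] ord_at_eq_0_iff[OF less.prems] by force
      qed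
    qed
    have "v r = w (minpoly x) * (ord_at x a - ord_at x b)"
      using \<open>v r = w a - w b\<close> w_eq[OF ab(1)] w_eq[OF ab(2)] by (simp only: right_diff_distrib)
    then have "w (minpoly x) = 1"
      using r(2) w_pi by (metis pos_zmult_eq_1_iff)
    then have "v (Fract f 1) = place_at x (Fract f 1)" if "f \<noteq> 0" for f
      using w_eq[OF that] place_at_Fract[of f 1 x] that by (simp add: w_def ord_at_def)
    then have "v = place_at x"
      by (intro place_eqI v.place_axioms place_place_at)
    then show ?thesis
      by blast
  qed
qed

end

section \<open>Reduction maps of the places\<close>

context function_field
begin

definition ev_at :: "'k alg_closure \<Rightarrow> 'k poly fract \<Rightarrow> 'k alg_closure" where
  "ev_at x r = (SOME y. \<exists>a b. r = Fract a b \<and> poly (ac b) x \<noteq> 0 \<and> y = poly (ac a) x / poly (ac b) x)"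

lemma ev_at_Fract:
  assumes b: "poly (ac b) x \<noteq> 0"
  shows "ev_at x (Fract a b) = poly (ac a) x / poly (ac b) x"
proof -
  define y where "y = ev_at x (Fract a b)"
  have "\<exists>c e. Fract a b = Fract c e \<and> poly (ac e) x \<noteq> 0 \<and> y = poly (ac c) x / poly (ac e) x"
    unfolding y_def ev_at_def by (rule someI_ex) (use b in blast)
  then obtain c e where ce: "Fract a b = Fract c e" "poly (ac e) x \<noteq> 0" "y = poly (ac c) x / poly (ac e) x"
    by blast
  have "b \<noteq> 0" "e \<noteq> 0"
    using b ce(2) by auto
  then have "a * e = c * b"
    using ce(1) by (simp add: eq_fract)
  then have "poly (ac a) x * poly (ac e) x = poly (ac c) x * poly (ac b) x"
    by (metis ac_mult poly_mult)
  then have "y = poly (ac a) x / poly (ac b) x"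
    using b ce(2) unfolding ce(3) by (simp add: frac_eq_eq)
  then show ?thesis
    by (simp add: y_def)
qed

text \<open>While the denominator vanishes at \<open>x\<close>, so does the numerator by
  integrality, and a common factor \<open>minpoly x\<close> can be cancelled.\<close>

lemma integral_at_cases:
  assumes "r \<in> place.Ov (place_at x)"
  obtains a b where "r = Fract a b" "poly (ac b) x \<noteq> 0"
proof -
  interpret place "place_at x"
    by (rule place_place_at)
  have "\<exists>a b. r = Fract a b \<and> poly (ac b) x \<noteq> 0"
  proof (cases "r = 0")
    case True
    then show ?thesis
      by (intro exI[of _ 0] exI[of _ 1]) (auto simp: Zero_fract_def)
  next
    case False
    then obtain a b where ab: "a \<noteq> 0" "b \<noteq> 0" "r = Fract a b"
      by (rule Fract_nz_cases)
    then have "ord_at x b \<le> ord_at x a"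
      using assms False by (simp add: Ov_def place_at_Fract)
    then show ?thesis
      using ab
    proof (induction "degree b" arbitrary: a b rule: less_induct)
      case less
      show ?case
      proof (cases "poly (ac b) x = 0")
        case True
        then have "ord_at x b \<noteq> 0"
          using ord_at_eq_0_iff[OF less.prems(3)] by blast
        then have "ord_at x a \<noteq> 0"
          using less.prems(1) ord_at_nonneg[of x b] by linarith
        then have a: "poly (ac a) x = 0"
          using ord_at_eq_0_iff[OF less.prems(2)] by blast
        obtain b' where b': "b = minpoly x * b'"
          using True unfolding minpoly_dvd_iff[symmetric] by (rule dvdE)
        obtain a' where a': "a = minpoly x * a'"
          using a unfolding minpoly_dvd_iff[symmetric] by (rule dvdE)
        have nz: "a' \<noteq> 0" "b' \<noteq> 0"
          using a' b' less.prems by auto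
        have "degree b' < degree b"
          using nz minpoly_nz period_pos[of x] degree_minpoly[of x] by (simp add: b' degree_mult_eq)
        moreover have "ord_at x b' \<le> ord_at x a'"
          using less.prems(1) nz minpoly_nz by (simp add: a' b' ord_at_mult)
        moreover have "r = Fract a' b'"
          using less.prems(4) minpoly_nz[of x] by (simp add: a' b' mult_fract_cancel)
        ultimately show ?thesis
          using less.hyps nz by blast
      qed (use less.prems in blast)
    qed
  qed
  then show thesis
    using that by blast
qed

lemma Fract_integral_at: "poly (ac b) x \<noteq> 0 \<Longrightarrow> Fract a b \<in> place.Ov (place_at x)"
proof -
  interpret place "place_at x"
    by (rule place_place_at)
  assume b: "poly (ac b) x \<noteq> 0"
  then have b0: "b \<noteq> 0"
    by auto
  show "Fract a b \<in> Ov"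
  proof (cases "a = 0")
    case True
    then show ?thesis
      by (simp add: fract_collapse)
  next
    case False
    then show ?thesis
      using b b0 ord_at_eq_0_iff[OF b0, of x] ord_at_nonneg[of x a] by (simp add: Ov_def place_at_Fract)
  qed
qed

text \<open>Polynomials of degree below the period take distinct values at \<open>x\<close>, since
  none of their nonzero differences can vanish there. There are \<open>q ^ period x\<close> of them,
  which fills the field.\<close>

lemma ev_at_image: "ev_at x ` place.Ov (place_at x) = GF (q ^ period x)"
proof -
  interpret E: galois_field "q ^ period x" "TYPE('k alg_closure)"
    by (rule extension) (rule period_pos)
  have x: "x \<in> E.F"
    by (simp add: GF_def power_period)
  have poly_F: "poly (ac f) x \<in> E.F" for f
  proof (rule E.poly_fixed_GF[OF _ x])
    show "E.frob_poly (ac f) = ac f"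
      unfolding E.frob_poly_fixed_iff using GF_subset_ext GF_q by (auto simp: coeff_map_poly)
  qed
  define G where "G = ({..<period x} \<rightarrow>\<^sub>E (UNIV :: 'k set))"
  define P where "P g = (\<Sum>i<period x. monom (g i) i)" for g :: "nat \<Rightarrow> 'k"
  have coeff_P: "coeff (P g) i = (if i < period x then g i else 0)" for g i
    by (simp add: P_def coeff_sum)
  have card_G: "card G = q ^ period x"
    by (simp add: G_def card_funcsetE CARD_k)
  have "inj_on (\<lambda>g. poly (ac (P g)) x) G"
  proof (rule inj_onI)
    fix g h assume gh: "g \<in> G" "h \<in> G" "poly (ac (P g)) x = poly (ac (P h)) x"
    then have root: "poly (ac (P g - P h)) x = 0"
      by (simp add: ac_diff)
    have "degree (P g - P h) < period x"
      using period_pos[of x] by (intro degree_lessI) (auto simp: coeff_P)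
    then have "P g - P h = 0"
      using minpoly_degree_le[OF _ root] by (metis leD)
    then have "coeff (P g) i = coeff (P h) i" for i
      by simp
    then have "g i = h i" if "i < period x" for i
      using that by (metis coeff_P)
    then show "g = h"
      using gh(1,2) unfolding G_def by (intro PiE_ext) auto
  qed
  then have "card ((\<lambda>g. poly (ac (P g)) x) ` G) = card E.F"
    by (simp add: card_image card_G E.card_GF)
  moreover have "(\<lambda>g. poly (ac (P g)) x) ` G \<subseteq> E.F"
    using poly_F by auto
  ultimately have all: "(\<lambda>g. poly (ac (P g)) x) ` G = E.F"
    by (intro card_subset_eq) auto
  show ?thesis
  proof (intro equalityI subsetI)
    fix y assume "y \<in> ev_at x ` place.Ov (place_at x)"
    then obtain r where "r \<in> place.Ov (place_at x)" "y = ev_at x r"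
      by auto
    then obtain a b where "poly (ac b) x \<noteq> 0" "y = ev_at x (Fract a b)"
      by (metis integral_at_cases)
    then show "y \<in> E.F"
      by (simp add: ev_at_Fract E.GF_divide poly_F)
  next
    fix y assume "y \<in> E.F"
    then obtain g where "y = poly (ac (P g)) x"
      unfolding all[symmetric] by auto
    then show "y \<in> ev_at x ` place.Ov (place_at x)"
      using ev_at_Fract[of 1 x "P g"] Fract_integral_at[of 1 x "P g"]
      by (intro image_eqI[of _ _ "Fract (P g) 1"]) auto
  qed
qed

lemma reduction_at: "reduction (place_at x) (ev_at x) (GF (q ^ period x))"
proof -
  interpret place "place_at x"
    by (rule place_place_at)
  show ?thesis
  proof
    fix r s assume "r \<in> Ov" "s \<in> Ov"
    then obtain a b c d where rs: "r = Fract a b" "s = Fract c d" "poly (ac b) x \<noteq> 0" "poly (ac d) x \<noteq> 0"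
      by (metis integral_at_cases)
    then have nz: "b \<noteq> 0" "d \<noteq> 0"
      by auto
    have bd: "poly (ac (b * d)) x \<noteq> 0"
      using rs by (simp add: ac_mult)
    have "r + s = Fract (a * d + c * b) (b * d)" "r * s = Fract (a * c) (b * d)"
      using nz by (simp_all add: rs(1,2))
    then have "ev_at x (r + s) = poly (ac (a * d + c * b)) x / poly (ac (b * d)) x"
      "ev_at x (r * s) = poly (ac (a * c)) x / poly (ac (b * d)) x"
      by (simp_all only: ev_at_Fract[OF bd])
    moreover have "ev_at x r = poly (ac a) x / poly (ac b) x" "ev_at x s = poly (ac c) x / poly (ac d) x"
      by (simp_all only: rs(1,2) ev_at_Fract[OF rs(3)] ev_at_Fract[OF rs(4)])
    ultimately show "ev_at x (r + s) = ev_at x r + ev_at x s" "ev_at x (r * s) = ev_at x r * ev_at x s"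
      using rs(3,4) by (simp_all add: ac_add ac_mult add_frac_eq)
  next
    show "ev_at x 1 = 1"
      by (simp add: One_fract_def ev_at_Fract)
  next
    fix r assume r: "r \<in> Ov" "r \<noteq> 0"
    obtain a b where ab: "r = Fract a b" "poly (ac b) x \<noteq> 0"
      using r(1) by (rule integral_at_cases)
    have nz: "a \<noteq> 0" "b \<noteq> 0"
      using ab r(2) by (auto simp: fract_collapse)
    have "place_at x r = ord_at x a"
      using ab nz ord_at_eq_0_iff[OF nz(2), of x] by (simp add: place_at_Fract)
    then show "(ev_at x r = 0) = (0 < place_at x r)"
      using ab ord_at_eq_0_iff[OF nz(1), of x] ord_at_nonneg[of x a] by (auto simp: ev_at_Fract)
  qed (rule ev_at_image)
qed

lemma ev_at_to_fract: "ev_at x (to_fract f) = poly (ac f) x"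
  by (simp add: to_fract_def ev_at_Fract)

lemma to_fract_integral_at: "to_fract f \<in> place.Ov (place_at x)"
  unfolding to_fract_def by (rule Fract_integral_at) simp

lemma place_degree_at: "place_degree (place_at x) = period x"
proof -
  interpret reduction "place_at x" "ev_at x" "GF (q ^ period x)"
    by (rule reduction_at)
  interpret E: galois_field "q ^ period x" "TYPE('k alg_closure)"
    by (rule extension) (rule period_pos)
  show ?thesis
    unfolding place_degree_def
  proof (rule place_degree_eq)
    show "card (GF (q ^ period x) :: 'k alg_closure set) = CARD('k) ^ period x"
      by (simp add: E.card_GF CARD_k)
  qed (auto intro: to_fract_integral_at simp: one_pCons mult.commute simp flip: to_fract_add to_fract_mult to_fract_1)
qed

text \<open>The numerator is read off at the degree of the denominator, so fractions that vanish at
  infinity get 0 and the others the quotient of leading coefficients.\<close>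

definition ev_inf :: "'k poly fract \<Rightarrow> 'k alg_closure" where
  "ev_inf r = (SOME y. \<exists>a b. b \<noteq> 0 \<and> r = Fract a b \<and> degree a \<le> degree b \<and>
    y = to_ac (coeff a (degree b) / lead_coeff b))"

lemma ev_inf_Fract:
  assumes b: "b \<noteq> 0" "degree a \<le> degree b"
  shows "ev_inf (Fract a b) = to_ac (coeff a (degree b) / lead_coeff b)"
proof -
  define y where "y = ev_inf (Fract a b)"
  have "\<exists>c e. e \<noteq> 0 \<and> Fract a b = Fract c e \<and> degree c \<le> degree e \<and> y = to_ac (coeff c (degree e) / lead_coeff e)"
    unfolding y_def ev_inf_def by (rule someI_ex) (use b in blast)
  then obtain c e where ce: "e \<noteq> 0" "Fract a b = Fract c e" "degree c \<le> degree e"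
    "y = to_ac (coeff c (degree e) / lead_coeff e)"
    by blast
  have "a * e = c * b"
    using ce b by (simp add: eq_fract)
  then have "coeff (a * e) (degree b + degree e) = coeff (c * b) (degree e + degree b)"
    by (simp add: add.commute)
  then have "coeff a (degree b) * lead_coeff e = coeff c (degree e) * lead_coeff b"
    using b ce by (simp only: coeff_mult_bounded[OF b(2) order_refl] coeff_mult_bounded[OF ce(3) order_refl])
  then have "coeff c (degree e) / lead_coeff e = coeff a (degree b) / lead_coeff b"
    using b(1) ce(1) by (subst frac_eq_eq) auto
  then show ?thesis
    using ce(4) by (simp only: y_def)
qed

lemma integral_inf_iff: "b \<noteq> 0 \<Longrightarrow> Fract a b \<in> place.Ov place_inf \<longleftrightarrow> degree a \<le> degree b"
proof -
  interpret place place_inf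
    by (rule place_place_inf)
  assume b: "b \<noteq> 0"
  show "Fract a b \<in> Ov \<longleftrightarrow> degree a \<le> degree b"
  proof (cases "a = 0")
    case True
    then show ?thesis
      by (simp add: fract_collapse)
  next
    case False
    then have "Fract a b \<noteq> 0"
      using b by (simp add: Zero_fract_def eq_fract)
    then show ?thesis
      using False b by (auto simp: Ov_def place_inf_Fract)
  qed
qed

lemma integral_inf_cases:
  assumes "r \<in> place.Ov place_inf"
  obtains a b where "r = Fract a b" "b \<noteq> 0" "degree a \<le> degree b"
  using assms integral_inf_iff by (metis Fract_cases)

lemma reduction_inf: "reduction place_inf ev_inf (GF q)"
proof -
  interpret place place_inf
    by (rule place_place_inf)
  show ?thesis
  proof
    fix r s assume "r \<in> Ov" "s \<in> Ov"
    then obtain a b c d where rs: "r = Fract a b" "s = Fract c d" and nz: "b \<noteq> 0" "d \<noteq> 0"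
      and deg: "degree a \<le> degree b" "degree c \<le> degree d"
      by (metis integral_inf_cases)
    have bd: "b * d \<noteq> 0" "degree (b * d) = degree b + degree d"
      using nz by (auto simp: degree_mult_eq)
    have ad: "degree (a * d) \<le> degree (b * d)" and cb: "degree (c * b) \<le> degree (b * d)"
      and ac: "degree (a * c) \<le> degree (b * d)"
      using deg degree_mult_le[of a d] degree_mult_le[of c b] degree_mult_le[of a c] by (auto simp: bd(2))
    have "coeff (c * b) (degree b + degree d) = coeff c (degree d) * lead_coeff b"
      using coeff_mult_bounded[OF deg(2) order_refl[of "degree b"]] by (simp add: add.commute)
    then have "coeff (a * d + c * b) (degree (b * d)) = coeff a (degree b) * lead_coeff d + coeff c (degree d) * lead_coeff b"
      using coeff_mult_bounded[OF deg(1) order_refl[of "degree d"]] by (simp add: bd(2))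
    moreover have "lead_coeff (b * d) = lead_coeff b * lead_coeff d"
      by (rule lead_coeff_mult)
    moreover have "degree (a * d + c * b) \<le> degree (b * d)"
      using ad cb by (rule degree_add_le)
    ultimately have "ev_inf (Fract (a * d + c * b) (b * d)) =
        to_ac ((coeff a (degree b) * lead_coeff d + coeff c (degree d) * lead_coeff b) / (lead_coeff b * lead_coeff d))"
      using ev_inf_Fract[OF bd(1)] by simp
    also have "(coeff a (degree b) * lead_coeff d + coeff c (degree d) * lead_coeff b) / (lead_coeff b * lead_coeff d) =
        coeff a (degree b) / lead_coeff b + coeff c (degree d) / lead_coeff d"
      using nz by (subst add_frac_eq) auto
    finally have sum: "ev_inf (Fract (a * d + c * b) (b * d)) =
        to_ac (coeff a (degree b) / lead_coeff b) + to_ac (coeff c (degree d) / lead_coeff d)"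
      by simp
    have ev: "ev_inf r = to_ac (coeff a (degree b) / lead_coeff b)" "ev_inf s = to_ac (coeff c (degree d) / lead_coeff d)"
      by (simp_all only: rs ev_inf_Fract[OF nz(1) deg(1)] ev_inf_Fract[OF nz(2) deg(2)])
    have "r + s = Fract (a * d + c * b) (b * d)" "r * s = Fract (a * c) (b * d)"
      using nz by (simp_all add: rs)
    note ops = this
    show "ev_inf (r + s) = ev_inf r + ev_inf s"
      unfolding ops ev by (rule sum)
    have "coeff (a * c) (degree (b * d)) = coeff a (degree b) * coeff c (degree d)"
      unfolding bd(2) by (rule coeff_mult_bounded[OF deg])
    then have "ev_inf (Fract (a * c) (b * d)) = to_ac ((coeff a (degree b) * coeff c (degree d)) / (lead_coeff b * lead_coeff d))"
      using ev_inf_Fract[OF bd(1) ac] by (simp only: lead_coeff_mult)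
    then show "ev_inf (r * s) = ev_inf r * ev_inf s"
      unfolding ops ev by (simp add: times_divide_times_eq)
  next
    show "ev_inf 1 = 1"
      by (simp add: One_fract_def ev_inf_Fract)
  next
    fix r assume r: "r \<in> Ov" "r \<noteq> 0"
    obtain a b where ab: "r = Fract a b" "b \<noteq> 0" "degree a \<le> degree b"
      using r(1) by (rule integral_inf_cases)
    have a0: "a \<noteq> 0"
      using ab r(2) by (auto simp: fract_collapse)
    have "coeff a (degree b) = 0 \<longleftrightarrow> degree a < degree b"
      using ab(3) a0 by (metis coeff_eq_0 leading_coeff_0_iff le_neq_implies_less)
    then show "(ev_inf r = 0) = (0 < place_inf r)"
      using ab a0 by (simp add: ev_inf_Fract place_inf_Fract)
  next
    show "ev_inf ` Ov = GF q"
    proof (intro equalityI subsetI)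
      fix y assume "y \<in> ev_inf ` Ov"
      then obtain r where "r \<in> Ov" "y = ev_inf r"
        by auto
      then show "y \<in> GF q"
        unfolding GF_q by (metis integral_inf_cases ev_inf_Fract rangeI)
    next
      fix y :: "'k alg_closure" assume "y \<in> GF q"
      then obtain c where "y = to_ac c"
        by (auto simp: GF_q)
      then show "y \<in> ev_inf ` Ov"
        using ev_inf_Fract[of 1 "[:c:]"] integral_inf_iff[of 1 "[:c:]"]
        by (intro image_eqI[of _ _ "Fract [:c:] 1"]) auto
    qed
  qed
qed

lemma place_degree_inf: "place_degree place_inf = 1"
proof -
  interpret reduction place_inf ev_inf "GF q"
    by (rule reduction_inf)
  show ?thesis
    unfolding place_degree_def
  proof (rule place_degree_eq)
    show "card (GF q :: 'k alg_closure set) = CARD('k) ^ 1"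
      by (simp add: card_GF CARD_k)
    show "to_fract [:c:] \<in> Ov" for c
      unfolding to_fract_def by (subst integral_inf_iff) auto
  qed (auto simp: one_pCons mult.commute simp flip: to_fract_add to_fract_mult to_fract_1)
qed

end

section \<open>Minimal Weierstrass models and traces\<close>

lemma discriminant_scale:
  "discriminant (Weierstrass (a1 * u) (a2 * u ^ 2) (a3 * u ^ 3) (a4 * u ^ 4) (a6 * u ^ 6)) =
    u ^ 12 * discriminant (Weierstrass a1 a2 a3 a4 (a6 :: 'f::field))"
  by (simp add: Let_def algebra_simps power_mult_distrib eval_nat_numeral)

context
  fixes a2 a4 u r s t :: "'f::field"
  assumes u: "u \<noteq> 0"
begin

abbreviation (input) A1 where "A1 \<equiv> (0 + 2 * s) / u"
abbreviation (input) A2 where "A2 \<equiv> (a2 - s * 0 + 3 * r - s ^ 2) / u ^ 2"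
abbreviation (input) A3 where "A3 \<equiv> (0 + r * 0 + 2 * t) / u ^ 3"
abbreviation (input) A4 where "A4 \<equiv> (a4 - s * 0 + 2 * r * a2 - (t + r * s) * 0 + 3 * r ^ 2 - 2 * s * t) / u ^ 4"
abbreviation (input) A6 where "A6 \<equiv> (0 + r * a4 + r ^ 2 * a2 + r ^ 3 - t * 0 - t ^ 2 - r * t * 0) / u ^ 6"

text \<open>With \<open>u\<close> cleared, the quantities b2, b4, b6, b8 of the new equation involve
  neither \<open>s\<close> nor \<open>t\<close>, which keeps the expansion small. The weight 12 of
  the discriminant then restores \<open>u\<close>.\<close>

lemma discriminant_change_coords:
  "discriminant (change_coords u r s t (Weierstrass 0 a2 0 a4 0)) = 16 * (a4 ^ 2 * (a2 ^ 2 - 4 * a4)) / u ^ 12"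
proof -
  define b1 b2 b3 b4 b6 where "b1 = 2 * s" "b2 = a2 + 3 * r - s ^ 2" "b3 = 2 * t"
    "b4 = a4 + 2 * r * a2 + 3 * r ^ 2 - 2 * s * t" "b6 = r * a4 + r ^ 2 * a2 + r ^ 3 - t ^ 2"
  note b_def = this
  have B2: "b1 ^ 2 + 4 * b2 = 4 * a2 + 12 * r"
    by (simp add: b_def power2_eq_square algebra_simps)
  have B4: "2 * b4 + b1 * b3 = 2 * a4 + 4 * r * a2 + 6 * r ^ 2"
    by (simp add: b_def power2_eq_square algebra_simps)
  have B6: "b3 ^ 2 + 4 * b6 = 4 * (r * a4 + r ^ 2 * a2 + r ^ 3)"
    by (simp add: b_def power2_eq_square algebra_simps)
  have B8: "b1 ^ 2 * b6 + 4 * b2 * b6 - b1 * b3 * b4 + b2 * b3 ^ 2 - b4 ^ 2 =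
      - (a4 ^ 2) + 6 * r ^ 2 * a4 + 4 * r ^ 3 * a2 + 3 * r ^ 4"
    by (simp add: b_def eval_nat_numeral algebra_simps)
  have "discriminant (Weierstrass b1 b2 b3 b4 b6) = 16 * (a4 ^ 2 * (a2 ^ 2 - 4 * a4))"
    unfolding discriminant.simps Let_def B2 B4 B6 B8 by (simp add: eval_nat_numeral algebra_simps)
  moreover have "Weierstrass b1 b2 b3 b4 b6 =
      Weierstrass (A1 * u) (A2 * u ^ 2) (A3 * u ^ 3) (A4 * u ^ 4) (A6 * u ^ 6)"
    using u by (simp add: b_def)
  ultimately have "u ^ 12 * discriminant (Weierstrass A1 A2 A3 A4 A6) = 16 * (a4 ^ 2 * (a2 ^ 2 - 4 * a4))"
    unfolding discriminant_scale[symmetric] by (simp only:)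
  then show ?thesis
    unfolding change_coords.simps using u by (metis nonzero_mult_div_cancel_left power_not_zero)
qed

text \<open>The left side is the invariant c4 = b2^2 - 24 b4, of weight 4.\<close>

lemma c4_change_coords:
  "(A1 ^ 2 + 4 * A2) ^ 2 - 24 * (2 * A4 + A1 * A3) = 16 * (a2 ^ 2 - 3 * a4) / u ^ 4"
proof -
  have scale: "u ^ 4 * ((x ^ 2 + 4 * y) ^ 2 - 24 * (2 * w + x * z)) =
      ((x * u) ^ 2 + 4 * (y * u ^ 2)) ^ 2 - 24 * (2 * (w * u ^ 4) + (x * u) * (z * u ^ 3))" for x y z w
    by (simp add: eval_nat_numeral algebra_simps)
  have "((2 * s) ^ 2 + 4 * (a2 + 3 * r - s ^ 2)) ^ 2 -
      24 * (2 * (a4 + 2 * r * a2 + 3 * r ^ 2 - 2 * s * t) + (2 * s) * (2 * t)) = 16 * (a2 ^ 2 - 3 * a4)"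
    by (simp add: eval_nat_numeral algebra_simps)
  moreover have "A1 * u = 2 * s" "A2 * u ^ 2 = a2 + 3 * r - s ^ 2" "A3 * u ^ 3 = 2 * t"
    "A4 * u ^ 4 = a4 + 2 * r * a2 + 3 * r ^ 2 - 2 * s * t"
    using u by simp_all
  ultimately have "u ^ 4 * ((A1 ^ 2 + 4 * A2) ^ 2 - 24 * (2 * A4 + A1 * A3)) = 16 * (a2 ^ 2 - 3 * a4)"
    unfolding scale by (simp only:)
  then show ?thesis
    using u by (metis nonzero_mult_div_cancel_left power_not_zero)
qed

end

lemma change_coords_id: "change_coords 1 0 0 0 W = W"
  by (cases W) simp

lemma change_coords_comp:
  assumes "u \<noteq> 0" "w \<noteq> (0 :: 'f::field)"
  shows "change_coords u r s t (change_coords w 0 0 0 W) =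
    change_coords (u * w) (w ^ 2 * r) (w * s) (w ^ 3 * t) W"
  using assms by (cases W) (simp add: field_simps eval_nat_numeral)

text \<open>At infinity the given equation is not integral. Passing to a rescaled one leaves the
  class of models, and so the minimal ones, unchanged.\<close>

lemma weierstrass_isomorphic_scale:
  assumes "w \<noteq> (0 :: 'f::field)"
  shows "weierstrass_isomorphic (change_coords w 0 0 0 W) W' \<longleftrightarrow> weierstrass_isomorphic W W'"
proof
  assume "weierstrass_isomorphic (change_coords w 0 0 0 W) W'"
  then obtain u r s t where "u \<noteq> 0" "W' = change_coords u r s t (change_coords w 0 0 0 W)"
    unfolding weierstrass_isomorphic_def by blast
  then show "weierstrass_isomorphic W W'"
    using assms unfolding weierstrass_isomorphic_def change_coords_comp[OF \<open>u \<noteq> 0\<close> assms]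
    by (intro exI[of _ "u * w"] exI[of _ "w ^ 2 * r"] exI[of _ "w * s"] exI[of _ "w ^ 3 * t"]) simp
next
  assume "weierstrass_isomorphic W W'"
  then obtain u r s t where u: "u \<noteq> 0" and W': "W' = change_coords u r s t W"
    unfolding weierstrass_isomorphic_def by blast
  have "change_coords (u / w) (r / w ^ 2) (s / w) (t / w ^ 3) (change_coords w 0 0 0 W) = W'"
    using u assms unfolding W' by (subst change_coords_comp) simp_all
  then show "weierstrass_isomorphic (change_coords w 0 0 0 W) W'"
    using u assms unfolding weierstrass_isomorphic_def
    by (intro exI[of _ "u / w"] exI[of _ "r / w ^ 2"] exI[of _ "s / w"] exI[of _ "t / w ^ 3"]) simp
qed

declare discriminant.simps [simp del] change_coords.simps [simp del]

section \<open>Reduction of \<open>y^2 = x (x^2 + a2 x + a4)\<close> in odd characteristic\<close>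

locale curve_reduction = reduction v e "GF Q" + galois_field Q ty
  for v :: "'f::field \<Rightarrow> int" and e :: "'f \<Rightarrow> 'c::alg_closed_field" and Q :: nat and ty :: "'c itself"
begin

lemma v_2: "(2 :: 'f) \<noteq> 0" "v 2 = 0"
  using e_nz_iff[OF O_numeral, of "num.Bit0 num.One"] two_nz e_numeral[of "num.Bit0 num.One"] by auto

lemma v_16: "(16 :: 'f) \<noteq> 0" "v 16 = 0"
proof -
  have "(16 :: 'f) = 2 ^ 4"
    by simp
  moreover have "(2 :: 'f) ^ 4 \<noteq> 0"
    using v_2(1) by (rule power_not_zero)
  moreover have "v (2 ^ 4) = 0"
    unfolding v_power[OF v_2(1)] v_2(2) by simp
  ultimately show "(16 :: 'f) \<noteq> 0" "v 16 = 0"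
    by metis+
qed

lemma card_square_fibres:
  fixes f :: "'c \<Rightarrow> 'c"
  assumes "\<And>x. x \<in> F \<Longrightarrow> f x \<in> F"
  shows "of_nat (card {(x, y). x \<in> F \<and> y \<in> F \<and> y * y = f x}) = of_nat Q + (\<Sum>x\<in>F. quad_char Q (f x))"
proof -
  have "{(x, y). x \<in> F \<and> y \<in> F \<and> y * y = f x} = Sigma F (\<lambda>x. {y \<in> F. y ^ 2 = f x})"
    by (auto simp: power2_eq_square)
  then have "of_nat (card {(x, y). x \<in> F \<and> y \<in> F \<and> y * y = f x}) =
      (\<Sum>x\<in>F. of_nat (card {y \<in> F. y ^ 2 = f x}) :: complex)"
    by simp
  also have "\<dots> = (\<Sum>x\<in>F. 1 + quad_char Q (f x))"
    by (intro sum.cong refl card_square_roots assms)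
  finally show ?thesis
    by (simp add: sum.distrib card_GF)
qed

text \<open>As \<open>c4 = 16 * (a2 ^ 2 - 3 * a4)\<close> has weight 4, a change of coordinates that lowers the valuation of
  the discriminant lowers that of \<open>c4\<close> by at least 4; hence the condition for minimality.\<close>

context
  fixes a2 a4 :: 'f
  assumes integral: "a2 \<in> Ov" "a4 \<in> Ov"
    and nonsingular: "a4 \<noteq> 0" "a2 ^ 2 - 4 * a4 \<noteq> 0"
    and minimality: "v (a4 ^ 2 * (a2 ^ 2 - 4 * a4)) = 0 \<or> (a2 ^ 2 - 3 * a4 \<noteq> 0 \<and> v (a2 ^ 2 - 3 * a4) < 4)"
begin

abbreviation (input) W0 where "W0 \<equiv> Weierstrass 0 a2 0 a4 0"
abbreviation (input) D0 where "D0 \<equiv> 16 * (a4 ^ 2 * (a2 ^ 2 - 4 * a4))"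

lemma D0_nz: "D0 \<noteq> 0"
  using nonsingular v_16 by simp

lemma disc_W0: "discriminant W0 = D0"
  using discriminant_change_coords[of 1 0 0 0 a2 a4] by (simp only: change_coords_id) simp

lemma v_disc:
  assumes u: "u \<noteq> 0"
  shows "v (discriminant (change_coords u r s t W0)) = v D0 - 12 * v u"
  unfolding discriminant_change_coords[OF u] v_divide[OF D0_nz power_not_zero[OF u]] v_power[OF u] by simp

lemma integral_scaling:
  assumes u: "u \<noteq> 0" and int: "set_weierstrass (change_coords u r s t W0) \<subseteq> Ov"
  shows "v u \<le> 0"
proof -
  obtain b1 b2 b3 b4 b6 where b: "change_coords u r s t W0 = Weierstrass b1 b2 b3 b4 b6"
    by (cases "change_coords u r s t W0")
  have bO: "b1 \<in> Ov" "b2 \<in> Ov" "b3 \<in> Ov" "b4 \<in> Ov" "b6 \<in> Ov"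
    using int by (auto simp only: b weierstrass.set)
  have "discriminant (change_coords u r s t W0) \<in> Ov"
    unfolding b discriminant.simps Let_def by (intro O_closed bO)
  moreover have "discriminant (change_coords u r s t W0) \<noteq> 0"
    unfolding discriminant_change_coords[OF u] using u D0_nz by simp
  ultimately have 1: "0 \<le> v D0 - 12 * v u"
    using v_disc[OF u] by (simp add: Ov_def)
  \<comment> \<open>If the discriminant is a unit, its new valuation \<open>- 12 * v u\<close> gives
    the bound. Otherwise integrality of c4 gives
    \<open>4 * v u \<le> v (a2 ^ 2 - 3 * a4) < 4\<close>.\<close>
  show ?thesis
    using minimality
  proof
    assume "v (a4 ^ 2 * (a2 ^ 2 - 4 * a4)) = 0"
    then have "v D0 = 0"
      using v_16 nonsingular v_mult[of 16 "a4 ^ 2 * (a2 ^ 2 - 4 * a4)"] by simp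
    then show ?thesis
      using 1 by simp
  next
    assume c: "a2 ^ 2 - 3 * a4 \<noteq> 0 \<and> v (a2 ^ 2 - 3 * a4) < 4"
    have "(b1 ^ 2 + 4 * b2) ^ 2 - 24 * (2 * b4 + b1 * b3) \<in> Ov"
      by (intro O_closed bO)
    moreover have "(b1 ^ 2 + 4 * b2) ^ 2 - 24 * (2 * b4 + b1 * b3) = 16 * (a2 ^ 2 - 3 * a4) / u ^ 4"
      using c4_change_coords[OF u, of s a2 r a4 t] b
      unfolding change_coords.simps weierstrass.inject by (simp only:)
    ultimately have "0 \<le> v (16 * (a2 ^ 2 - 3 * a4) / u ^ 4)"
      using u c v_16 by (auto simp: Ov_def v_0)
    also have "v (16 * x / u ^ 4) = v x - 4 * v u" if "x \<noteq> 0" for x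
      using u that v_16 by (simp add: v_divide v_mult v_power)
    then have "v (16 * (a2 ^ 2 - 3 * a4) / u ^ 4) = v (a2 ^ 2 - 3 * a4) - 4 * v u"
      using c by blast
    finally show ?thesis
      using c by linarith
  qed
qed

lemma minimal_model_W0: "minimal_model v W0 W0"
  unfolding minimal_model_def
proof (intro conjI allI impI)
  show "weierstrass_isomorphic W0 W0"
    unfolding weierstrass_isomorphic_def by (intro exI[of _ 1] exI[of _ 0]) (simp add: change_coords_id)
  show "set_weierstrass W0 \<subseteq> carrier (valuation_ring v)"
    using integral by simp
  fix W'' assume "weierstrass_isomorphic W0 W''" "set_weierstrass W'' \<subseteq> carrier (valuation_ring v)"
  then obtain u r s t where "u \<noteq> 0" "W'' = change_coords u r s t W0" "v u \<le> 0"
    unfolding weierstrass_isomorphic_def using integral_scaling by auto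
  then show "v (discriminant W0) \<le> v (discriminant W'')"
    using v_disc by (simp only: disc_W0) simp
qed

text \<open>\<open>min_model\<close> is merely some minimal model. Equality of discriminant
  valuations forces \<open>u\<close> to be a unit, so its reduction can be compared with that of
  \<open>W0\<close>.\<close>

lemma minimal_model_change:
  assumes "minimal_model v W0 W''"
  obtains u r s t where "u \<noteq> 0" "W'' = change_coords u r s t W0" "v u = 0" "set_weierstrass W'' \<subseteq> Ov"
proof -
  obtain u r s t where u: "u \<noteq> 0" "W'' = change_coords u r s t W0"
    using assms unfolding minimal_model_def weierstrass_isomorphic_def by blast
  have int: "set_weierstrass W'' \<subseteq> Ov"
    using assms unfolding minimal_model_def by simp
  have "v (discriminant W'') \<le> v (discriminant W0)"
    using assms minimal_model_W0 unfolding minimal_model_def by blast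
  then have "v D0 - 12 * v u \<le> v D0"
    using v_disc[OF u(1)] u(2) by (simp only: disc_W0)
  then have "v u = 0"
    using integral_scaling[OF u(1)] int u(2) by simp
  with u int that show thesis
    by blast
qed

lemma minimal_model_disc: "minimal_model v W0 W'' \<Longrightarrow> v (discriminant W'') = v D0"
  by (elim minimal_model_change) (simp add: v_disc)

text \<open>If \<open>r\<close> had a pole, its cube would dominate and the expression would have
  valuation \<open>3 * v r < 0\<close>.\<close>

lemma integral_root_bound:
  assumes "r ^ 3 + a2 * r ^ 2 + a4 * r \<in> Ov"
  shows "r \<in> Ov"
proof (rule ccontr)
  assume "r \<notin> Ov"
  then have r: "r \<noteq> 0" "v r < 0"
    by (auto simp: Ov_def)
  define c where "c = r * (a2 + a4 / r)"
  have "inverse r \<in> Ov"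
    using r by (simp add: Ov_def v_inverse)
  then have "a2 + a4 / r \<in> Ov"
    unfolding divide_inverse using integral by (intro O_closed)
  have "1 + (a2 + a4 / r) / r \<noteq> 0 \<and> v (1 + (a2 + a4 / r) / r) = 0"
  proof (cases "a2 + a4 / r = 0")
    case False
    then have "v 1 < v ((a2 + a4 / r) / r)"
      using r \<open>a2 + a4 / r \<in> Ov\<close> by (simp add: v_divide Ov_def)
    then show ?thesis
      using False r v_add_eq[of 1 "(a2 + a4 / r) / r"] by simp
  qed simp
  moreover have "r ^ 3 + a2 * r ^ 2 + a4 * r = r ^ 3 * (1 + (a2 + a4 / r) / r)"
    using r by (simp add: field_simps eval_nat_numeral)
  ultimately have "r ^ 3 + a2 * r ^ 2 + a4 * r \<noteq> 0 \<and> v (r ^ 3 + a2 * r ^ 2 + a4 * r) = 3 * v r"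
    using r by (simp add: v_mult v_power)
  then show False
    using assms r by (auto simp: Ov_def)
qed

text \<open>As 2 is a unit, \<open>s\<close> and \<open>t\<close> are integral, and \<open>r\<close>
  is by \<open>integral_root_bound\<close>. The change of coordinates therefore reduces to an affine
  bijection of the reduced curves.\<close>

lemma card_affine_points_minimal:
  assumes "minimal_model v W0 W''"
  shows "card (affine_points (residue_field v) (map_weierstrass res W'')) =
    card {(x, y). x \<in> F \<and> y \<in> F \<and> y * y = x * (x * x + e a2 * x + e a4)}"
proof -
  obtain u r s t where u: "u \<noteq> 0" "W'' = change_coords u r s t W0" "v u = 0" and int: "set_weierstrass W'' \<subseteq> Ov"
    using assms by (rule minimal_model_change)
  obtain b1 b2 b3 b4 b6 where b: "W'' = Weierstrass b1 b2 b3 b4 b6"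
    by (cases W'')
  have bO: "b1 \<in> Ov" "b2 \<in> Ov" "b3 \<in> Ov" "b4 \<in> Ov" "b6 \<in> Ov"
    using int by (auto simp only: b weierstrass.set)
  have uO: "u \<in> Ov"
    using u by (simp add: Ov_def)
  have rel: "b1 * u = 2 * s" "b2 * u ^ 2 = a2 + 3 * r - s ^ 2" "b3 * u ^ 3 = 2 * t"
    "b4 * u ^ 4 = a4 + 2 * r * a2 + 3 * r ^ 2 - 2 * s * t" "b6 * u ^ 6 = r * a4 + r ^ 2 * a2 + r ^ 3 - t ^ 2"
    using u(1,2) b by (simp_all add: change_coords.simps)
  have "s = b1 * u / 2" "t = b3 * u ^ 3 / 2"
    using rel(1,3) v_2 by simp_all
  then have stO: "s \<in> Ov" "t \<in> Ov"
    using O_divide[OF _ v_2] bO uO O_mult O_power by metis+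
  have "r ^ 3 + a2 * r ^ 2 + a4 * r = b6 * u ^ 6 + t ^ 2"
    using rel(5) by (simp add: algebra_simps)
  moreover have "b6 * u ^ 6 + t ^ 2 \<in> Ov"
    by (intro O_closed bO uO stO)
  ultimately have rO: "r \<in> Ov"
    using integral_root_bound[of r] by (simp only:)
  define U R S T where "U = e u" "R = e r" "S = e s" "T = e t"
  note URST = this
  have U0: "U \<noteq> 0"
    using e_nz_iff[OF uO] u by (simp add: URST)
  have inF: "e x \<in> F" if "x \<in> Ov" for x
    using e_image that by blast
  have F: "U \<in> F" "R \<in> F" "S \<in> F" "T \<in> F"
    unfolding URST using inF uO rO stO by auto
  have e1: "e b1 * U = 2 * S"
    using arg_cong[OF rel(1), of e] bO uO stO by (simp add: URST e_mult e_numeral O_closed)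
  have e2: "e b2 * U ^ 2 = e a2 + 3 * R - S ^ 2"
    using arg_cong[OF rel(2), of e] bO uO stO rO integral
    by (simp add: URST e_mult e_numeral e_add e_diff e_power O_closed)
  have e3: "e b3 * U ^ 3 = 2 * T"
    using arg_cong[OF rel(3), of e] bO uO stO by (simp add: URST e_mult e_numeral e_power O_closed)
  have e4: "e b4 * U ^ 4 = e a4 + 2 * R * e a2 + 3 * R ^ 2 - 2 * S * T"
    using arg_cong[OF rel(4), of e] bO uO stO rO integral
    by (simp add: URST e_mult e_numeral e_add e_diff e_power O_closed)
  have e6: "e b6 * U ^ 6 = R * e a4 + R ^ 2 * e a2 + R ^ 3 - T ^ 2"
    using arg_cong[OF rel(5), of e] bO uO stO rO integral
    by (simp add: URST e_mult e_numeral e_add e_diff e_power O_closed)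
  \<comment> \<open>Multiplication by the nonzero \<open>U ^ 6\<close> brings in the combinations
    given by \<open>e1\<close> to \<open>e6\<close>, after which both sides agree
    identically.\<close>
  have key: "y * y + e b1 * x * y + e b3 * y = x * x * x + e b2 * x * x + e b4 * x + e b6 \<longleftrightarrow>
      (U ^ 3 * y + S * (U ^ 2 * x) + T) * (U ^ 3 * y + S * (U ^ 2 * x) + T) =
      (U ^ 2 * x + R) * ((U ^ 2 * x + R) * (U ^ 2 * x + R) + e a2 * (U ^ 2 * x + R) + e a4)" for x y
  proof -
    define m n where "m = U ^ 2 * x" "n = U ^ 3 * y"
    note mn = this
    have "U ^ 6 * ((y * y + e b1 * x * y + e b3 * y) - (x * x * x + e b2 * x * x + e b4 * x + e b6)) =
        n * n + (e b1 * U) * m * n + (e b3 * U ^ 3) * n -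
        (m * m * m + (e b2 * U ^ 2) * m * m + (e b4 * U ^ 4) * m + e b6 * U ^ 6)"
      by (simp add: mn algebra_simps eval_nat_numeral)
    also have "\<dots> = (n + S * m + T) * (n + S * m + T) - (m + R) * ((m + R) * (m + R) + e a2 * (m + R) + e a4)"
      unfolding e1 e2 e3 e4 e6 by (simp add: algebra_simps eval_nat_numeral)
    finally have "U ^ 6 * ((y * y + e b1 * x * y + e b3 * y) - (x * x * x + e b2 * x * x + e b4 * x + e b6)) =
        (n + S * m + T) * (n + S * m + T) - (m + R) * ((m + R) * (m + R) + e a2 * (m + R) + e a4)" .
    then have "y * y + e b1 * x * y + e b3 * y = x * x * x + e b2 * x * x + e b4 * x + e b6 \<longleftrightarrow>
        (n + S * m + T) * (n + S * m + T) - (m + R) * ((m + R) * (m + R) + e a2 * (m + R) + e a4) = 0"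
      using U0 by (metis (no_types) mult_eq_0_iff power_not_zero right_minus_eq)
    then show ?thesis
      unfolding mn by (simp only: right_minus_eq)
  qed
  have "card {(x, y). x \<in> F \<and> y \<in> F \<and> y * y + e b1 * x * y + e b3 * y = x * x * x + e b2 * x * x + e b4 * x + e b6} =
    card {(x, y). x \<in> F \<and> y \<in> F \<and> y * y = x * (x * x + e a2 * x + e a4)}"
  proof (rule bij_betw_same_card)
    show "bij_betw (\<lambda>(x, y). (U ^ 2 * x + R, U ^ 3 * y + S * (U ^ 2 * x) + T))
      {(x, y). x \<in> F \<and> y \<in> F \<and> y * y + e b1 * x * y + e b3 * y = x * x * x + e b2 * x * x + e b4 * x + e b6}
      {(x, y). x \<in> F \<and> y \<in> F \<and> y * y = x * (x * x + e a2 * x + e a4)}"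
    proof (rule bij_betw_byWitness[where f' = "\<lambda>(x, y). ((x - R) / U ^ 2, (y - S * (x - R) - T) / U ^ 3)"])
      show "(\<lambda>(x, y). (U ^ 2 * x + R, U ^ 3 * y + S * (U ^ 2 * x) + T)) `
        {(x, y). x \<in> F \<and> y \<in> F \<and> y * y + e b1 * x * y + e b3 * y = x * x * x + e b2 * x * x + e b4 * x + e b6} \<subseteq>
        {(x, y). x \<in> F \<and> y \<in> F \<and> y * y = x * (x * x + e a2 * x + e a4)}"
        using F by (auto simp only: key intro!: GF_add GF_mult GF_power)
      show "(\<lambda>(x, y). ((x - R) / U ^ 2, (y - S * (x - R) - T) / U ^ 3)) `
        {(x, y). x \<in> F \<and> y \<in> F \<and> y * y = x * (x * x + e a2 * x + e a4)} \<subseteq>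
        {(x, y). x \<in> F \<and> y \<in> F \<and> y * y + e b1 * x * y + e b3 * y = x * x * x + e b2 * x * x + e b4 * x + e b6}"
      proof clarify
        fix x y assume xy: "x \<in> F" "y \<in> F" "y * y = x * (x * x + e a2 * x + e a4)"
        define x' y' where "x' = (x - R) / U ^ 2" "y' = (y - S * (x - R) - T) / U ^ 3"
        have x': "x = U ^ 2 * x' + R" and y': "y = U ^ 3 * y' + S * (U ^ 2 * x') + T"
          using U0 by (simp_all add: x'_y'_def)
        have "x' \<in> F" "y' \<in> F"
          unfolding x'_y'_def using xy F by (auto intro!: GF_closed)
        then show "x' \<in> F \<and> y' \<in> F \<and> y' * y' + e b1 * x' * y' + e b3 * y' =
            x' * x' * x' + e b2 * x' * x' + e b4 * x' + e b6"
          using xy(3) unfolding key x' y' by blast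
      qed
    qed (use U0 in auto)
  qed
  then show ?thesis
    unfolding b using card_affine_points[OF bO] by simp
qed

text \<open>\<open>w\<close> records a preliminary scaling to an equation integral at the place.
  Good and bad reduction share the trace formula, which only counts points of the reduced
  cubic.\<close>

theorem
  assumes W: "w \<noteq> 0" "change_coords w 0 0 0 W = W0"
  shows good_reduction_iff: "good_reduction v W \<longleftrightarrow> e a4 \<noteq> 0 \<and> e a2 ^ 2 \<noteq> 4 * e a4"
    and frobenius_trace_eq:
      "of_int (frobenius_trace v W) = - (\<Sum>x\<in>F. quad_char Q (x * (x * x + e a2 * x + e a4)))"
proof -
  have "minimal_model v W = minimal_model v W0"
    unfolding minimal_model_def W(2)[symmetric] weierstrass_isomorphic_scale[OF W(1)] ..
  then have mm: "minimal_model v W0 (min_model v W)"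
    unfolding min_model_def using minimal_model_W0 by (metis someI)
  have D0: "D0 \<in> Ov"
    using integral by (intro O_closed)
  have "good_reduction v W \<longleftrightarrow> v D0 = 0"
    unfolding good_reduction_def minimal_model_disc[OF mm] ..
  also have "\<dots> \<longleftrightarrow> e D0 \<noteq> 0"
    using e_nz_iff[OF D0] D0_nz by simp
  also have "e D0 = 16 * (e a4 ^ 2 * (e a2 ^ 2 - 4 * e a4))"
    using integral by (simp add: e_mult e_diff e_power e_numeral O_closed)
  also have "\<dots> \<noteq> 0 \<longleftrightarrow> e a4 \<noteq> 0 \<and> e a2 ^ 2 \<noteq> 4 * e a4"
    using e_nz_iff[OF O_numeral, of "num.Bit0 (num.Bit0 (num.Bit0 (num.Bit0 num.One)))"] v_16
      e_numeral[of "num.Bit0 (num.Bit0 (num.Bit0 (num.Bit0 num.One)))"] by simp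
  finally show "good_reduction v W \<longleftrightarrow> e a4 \<noteq> 0 \<and> e a2 ^ 2 \<noteq> 4 * e a4" .
  have eF: "e a2 \<in> F" "e a4 \<in> F"
    using e_image integral by blast+
  have "of_nat (card {(x, y). x \<in> F \<and> y \<in> F \<and> y * y = x * (x * x + e a2 * x + e a4)}) =
      of_nat Q + (\<Sum>x\<in>F. quad_char Q (x * (x * x + e a2 * x + e a4)))"
    using eF by (intro card_square_fibres GF_mult GF_add)
  then show "of_int (frobenius_trace v W) = - (\<Sum>x\<in>F. quad_char Q (x * (x * x + e a2 * x + e a4)))"
    unfolding frobenius_trace_def num_points_def card_affine_points_minimal[OF mm] card_residue card_GF
    by simp
qed

end

end

section \<open>Local factors\<close>

text \<open>The factor \<open>fps_X\<close> aligns the coefficient at \<open>n\<close> with sums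
  over the field with \<open>q ^ n\<close> elements.\<close>

definition log_deriv :: "complex fps \<Rightarrow> complex fps" where
  "log_deriv f = fps_X * fps_deriv f * inverse f"

lemma log_deriv_eqI:
  assumes "fps_X * fps_deriv f = f * s" "f $ 0 \<noteq> 0"
  shows "log_deriv f = s"
proof -
  have "log_deriv f = s * (f * inverse f)"
    unfolding log_deriv_def assms(1) by (simp only: mult_ac)
  then show ?thesis
    using assms(2) by (simp add: inverse_mult_eq_1')
qed

lemma log_deriv_mult:
  assumes "f $ 0 \<noteq> 0" "g $ 0 \<noteq> 0"
  shows "log_deriv (f * g) = log_deriv f + log_deriv g"
proof (rule log_deriv_eqI)
  have "f * g * (log_deriv f + log_deriv g) =
      (f * inverse f) * (fps_X * fps_deriv f * g) + (g * inverse g) * (fps_X * fps_deriv g * f)"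
    unfolding log_deriv_def by (simp only: distrib_left mult_ac)
  then show "fps_X * fps_deriv (f * g) = f * g * (log_deriv f + log_deriv g)"
    using assms by (simp add: inverse_mult_eq_1' algebra_simps)
qed (use assms in simp)

lemma log_deriv_1 [simp]: "log_deriv 1 = 0"
  by (simp add: log_deriv_def)

lemma log_deriv_inverse:
  assumes "f $ 0 \<noteq> 0"
  shows "log_deriv (inverse f) = - log_deriv f"
proof -
  have "log_deriv (f * inverse f) = log_deriv f + log_deriv (inverse f)"
    using assms by (intro log_deriv_mult) auto
  then show ?thesis
    using assms by (simp add: inverse_mult_eq_1' eq_neg_iff_add_eq_0 add.commute)
qed

lemma log_deriv_prod:
  assumes "\<And>i. i \<in> A \<Longrightarrow> f i $ 0 = 1"
  shows "log_deriv (prod f A) = (\<Sum>i\<in>A. log_deriv (f i))" "prod f A $ 0 = 1"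
proof -
  have "log_deriv (prod f A) = (\<Sum>i\<in>A. log_deriv (f i)) \<and> prod f A $ 0 = 1"
    using assms by (induction A rule: infinite_finite_induct) (auto simp: log_deriv_mult)
  then show "log_deriv (prod f A) = (\<Sum>i\<in>A. log_deriv (f i))" "prod f A $ 0 = 1"
    by auto
qed

lemma log_deriv_nth_0 [simp]: "log_deriv f $ 0 = 0"
  by (simp add: log_deriv_def mult.assoc)

lemma log_deriv_recurrence:
  assumes "f $ 0 \<noteq> 0"
  shows "of_nat n * f $ n = (\<Sum>i<n. f $ i * log_deriv f $ (n - i))"
proof -
  have "fps_X * fps_deriv f = f * log_deriv f"
  proof -
    have "f * log_deriv f = (f * inverse f) * (fps_X * fps_deriv f)"
      unfolding log_deriv_def by (simp only: mult_ac)
    then show ?thesis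
      using assms by (simp add: inverse_mult_eq_1')
  qed
  then have "(fps_X * fps_deriv f) $ n = (f * log_deriv f) $ n"
    by simp
  moreover have "(fps_X * fps_deriv f) $ n = of_nat n * f $ n"
    by (cases n) auto
  moreover have "(f * log_deriv f) $ n = (\<Sum>i<n. f $ i * log_deriv f $ (n - i))"
    unfolding fps_mult_nth by (intro sum.mono_neutral_right) (auto simp: not_less)
  ultimately show ?thesis
    by simp
qed

text \<open>Each coefficient is determined by earlier ones, as \<open>n\<close> is invertible. The
  bound \<open>N\<close> admits partial products, which agree with the limit only up to some
  degree.\<close>

lemma fps_eq_of_log_deriv_eq:
  assumes "f $ 0 = 1" "g $ 0 = 1" and eq: "\<And>n. n \<le> N \<Longrightarrow> log_deriv f $ n = log_deriv g $ n"
    and "n \<le> N"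
  shows "f $ n = g $ n"
  using assms(4)
proof (induction n rule: less_induct)
  case (less n)
  show ?case
  proof (cases "n = 0")
    case False
    have "of_nat n * f $ n = (\<Sum>i<n. g $ i * log_deriv g $ (n - i))"
      unfolding log_deriv_recurrence[of f n, simplified assms(1), simplified]
      using less by (intro sum.cong refl) (simp add: eq)
    also have "\<dots> = of_nat n * g $ n"
      by (rule log_deriv_recurrence[symmetric]) (simp add: assms)
    finally show ?thesis
      using False by simp
  qed (simp add: assms)
qed

text \<open>The recurrence says that the logarithmic derivative of the series \<open>h\<close> has
  coefficients \<open>p\<close>. Substituting \<open>T^m\<close> moves \<open>p k\<close> to
  exponent \<open>m * k\<close> and multiplies it by \<open>m\<close>, as befits a place of degree
  \<open>m\<close>.\<close>

lemma log_deriv_stretch: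
  fixes h p :: "nat \<Rightarrow> complex"
  assumes m: "m > 0" and h0: "h 0 = 1"
    and rec: "\<And>n. of_nat n * h n = (\<Sum>r=1..n. p r * h (n - r))"
  shows "log_deriv (Abs_fps h oo fps_X ^ m) =
    Abs_fps (\<lambda>n. if 0 < n \<and> m dvd n then of_nat m * p (n div m) else 0)"
proof -
  define H where "H = Abs_fps h"
  define Pp where "Pp = Abs_fps (\<lambda>n. if n = 0 then 0 else p n)"
  define b :: "complex fps" where "b = fps_X ^ m"
  have b0: "b $ 0 = 0"
    using m by (simp add: b_def)
  have XH: "fps_X * fps_deriv H = H * Pp"
  proof (rule fps_ext)
    fix n
    have "(fps_X * fps_deriv H) $ n = of_nat n * h n"
      by (cases n) (auto simp: H_def)
    also have "\<dots> = (\<Sum>i=0..n. Pp $ i * H $ (n - i))"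
      unfolding rec by (intro sum.mono_neutral_cong_left) (auto simp: Pp_def H_def)
    also have "\<dots> = (H * Pp) $ n"
      by (simp only: fps_mult_nth[symmetric] mult.commute[of H])
    finally show "(fps_X * fps_deriv H) $ n = (H * Pp) $ n" .
  qed
  have Xb: "fps_X * fps_deriv b = of_nat m * b"
  proof -
    have "fps_X * fps_deriv b = of_nat m * (fps_X ^ (m - 1) * fps_X)"
      by (simp add: b_def fps_deriv_power' mult_ac)
    also have "fps_X ^ (m - 1) * fps_X = b"
      unfolding b_def by (rule power_minus_mult[OF m])
    finally show ?thesis .
  qed
  have "fps_X * fps_deriv (H oo b) = (H oo b) * (of_nat m * (Pp oo b))"
  proof -
    have "fps_X * fps_deriv (H oo b) = (fps_deriv H oo b) * (fps_X * fps_deriv b)"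
      using b0 by (simp add: fps_compose_deriv mult_ac)
    also have "\<dots> = of_nat m * ((fps_X * fps_deriv H) oo b)"
      unfolding Xb using b0 by (simp add: fps_compose_mult_distrib mult_ac)
    also have "\<dots> = (H oo b) * (of_nat m * (Pp oo b))"
      unfolding XH using b0 by (simp add: fps_compose_mult_distrib mult_ac)
    finally show ?thesis .
  qed
  moreover have "(H oo b) $ 0 \<noteq> 0"
    by (simp add: H_def h0)
  ultimately have "log_deriv (H oo b) = of_nat m * (Pp oo b)"
    by (rule log_deriv_eqI)
  also have "\<dots> = Abs_fps (\<lambda>n. if 0 < n \<and> m dvd n then of_nat m * p (n div m) else 0)"
  proof (rule fps_ext)
    fix n
    have "(of_nat m * (Pp oo b)) $ n = of_nat m * (Pp oo b) $ n"
      by (simp only: fps_of_nat[symmetric] fps_mult_left_const_nth)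
    then show "(of_nat m * (Pp oo b)) $ n = Abs_fps (\<lambda>n. if 0 < n \<and> m dvd n then of_nat m * p (n div m) else 0) $ n"
      using m by (auto simp: b_def fps_nth_compose_X_power Pp_def dvd_div_eq_0_iff)
  qed
  finally show ?thesis
    by (simp add: H_def b_def)
qed

lemma log_deriv_linear:
  assumes m: "m > 0"
  shows "log_deriv (1 - fps_const a * fps_X ^ m) =
    Abs_fps (\<lambda>n. if 0 < n \<and> m dvd n then - (of_nat m * a ^ (n div m)) else 0)"
proof -
  define h where "h n = (if n = 0 then 1 else if n = 1 then - a else 0)" for n :: nat
  have rec: "of_nat n * h n = (\<Sum>r=1..n. - (a ^ r) * h (n - r))" for n
  proof (cases "n \<le> 1")
    case True
    then have "n = 0 \<or> n = 1"
      by auto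
    then show ?thesis
      by (auto simp: h_def)
  next
    case False
    then obtain k where k: "n = Suc k" "k \<ge> 1"
      by (cases n) auto
    have "(\<Sum>r=1..n. - (a ^ r) * h (n - r)) = (\<Sum>r\<in>{k, n}. - (a ^ r) * h (n - r))"
      using k by (intro sum.mono_neutral_right) (auto simp: h_def)
    then show ?thesis
      using k by (simp add: h_def)
  qed
  have "Abs_fps h = 1 - fps_const a * fps_X"
    by (rule fps_ext) (auto simp: h_def)
  moreover have "(1 - fps_const a * fps_X) oo fps_X ^ m = 1 - fps_const a * fps_X ^ m"
    using m by (simp add: fps_compose_sub_distrib fps_compose_mult_distrib)
  ultimately show ?thesis
    using log_deriv_stretch[of m h "\<lambda>r. - (a ^ r)", OF m _ rec] by (simp add: h_def cong: if_cong)
qed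

context galois_field
begin

text \<open>The fibre is \<open>y^2 = x^2 (x + 1)\<close>, with a node at 0 whose tangents are
  rational: split multiplicative.\<close>

lemma legendre_sum_0: "legendre_sum 0 = - 1"
proof -
  have "legendre_sum 0 = (\<Sum>x\<in>F - {0}. quad_char Q (x * (x + 1) * (x + 0)))"
    unfolding legendre_sum_def by (simp add: sum.remove[of F 0])
  also have "\<dots> = (\<Sum>x\<in>F - {0}. quad_char Q (x + 1))"
  proof (intro sum.cong refl)
    fix x assume x: "x \<in> F - {0}"
    have "x * (x + 1) * (x + 0) = (x * x) * (x + 1)"
      by (simp add: mult_ac)
    also have "quad_char Q \<dots> = quad_char Q (x * x) * quad_char Q (x + 1)"
      using x by (intro quad_char_mult) auto
    finally show "quad_char Q (x * (x + 1) * (x + 0)) = quad_char Q (x + 1)"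
      using x by (simp add: quad_char_of_square)
  qed
  also have "\<dots> = (\<Sum>x\<in>F. quad_char Q (x + 1)) - 1"
    by (simp add: sum.remove[of F 0])
  also have "(\<Sum>x\<in>F. quad_char Q (x + 1)) = 0"
    using sum_reindex_add[OF GF_1, of "quad_char Q"] sum_quad_char by simp
  finally show ?thesis
    by simp
qed

text \<open>The node of \<open>y^2 = x (x + 1)^2\<close> lies at -1, and its tangents are rational
  exactly when -1 is a square.\<close>

lemma legendre_sum_1: "legendre_sum 1 = - quad_char Q (- 1 :: 'a)"
proof -
  have m1: "- 1 \<in> F"
    by (intro GF_closed)
  have "legendre_sum 1 = (\<Sum>x\<in>F - {- 1}. quad_char Q (x * (x + 1) * (x + 1)))"
    unfolding legendre_sum_def by (simp add: sum.remove[OF _ m1])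
  also have "\<dots> = (\<Sum>x\<in>F - {- 1}. quad_char Q x)"
  proof (intro sum.cong refl)
    fix x assume x: "x \<in> F - {- 1}"
    then have "x + 1 \<noteq> 0"
      by (auto simp: eq_neg_iff_add_eq_0)
    moreover have "quad_char Q (x * ((x + 1) * (x + 1))) = quad_char Q x * quad_char Q ((x + 1) * (x + 1))"
      using x by (intro quad_char_mult) (auto intro!: GF_closed)
    ultimately show "quad_char Q (x * (x + 1) * (x + 1)) = quad_char Q x"
      using x by (simp add: quad_char_of_square GF_add mult.assoc)
  qed
  also have "\<dots> = - quad_char Q (- 1 :: 'a)"
    using sum_quad_char by (simp add: sum.remove[OF _ m1] add_eq_0_iff2)
  finally show ?thesis .
qed

text \<open>Counterpart of \<open>legendre_local_recurrence\<close> for singular fibres: the factor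
  \<open>1 - a T\<close> with \<open>a = - legendre_sum t\<close> has these sums as logarithmic
  coefficients, so all finite places obey one formula.\<close>

lemma legendre_sum_bad:
  assumes "t = 0 \<or> t = (1 :: 'a)" and r: "r > 0"
  shows "galois_field.legendre_sum (Q ^ r) t = - ((- legendre_sum t) ^ r)"
proof -
  interpret E: galois_field "Q ^ r" ty
    by (rule extension) fact
  have "quad_char (Q ^ r) (- 1 :: 'a) = quad_char Q (- 1 :: 'a) ^ r"
  proof -
    have "quad_char (Q ^ r) (- 1 :: 'a) = quad_char Q ((- 1 :: 'a) ^ r)"
      using quad_char_norm[OF r, of "- 1"] by (simp only: minus_one_power_norm)
    then show ?thesis
      by (simp add: quad_char_power GF_closed)
  qed
  then show ?thesis
    using assms(1) by (auto simp: legendre_sum_0 legendre_sum_1 E.legendre_sum_0 E.legendre_sum_1)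
qed

end

section \<open>Euler factors of the Legendre curve\<close>

context function_field
begin

context
  fixes d :: nat
  assumes d: "d > 0"
begin

abbreviation (input) T :: "'k poly fract" where
  "T \<equiv> to_fract [:0, 1:] ^ d"

abbreviation (input) E :: "'k poly fract weierstrass" where
  "E \<equiv> Weierstrass 0 (1 + T) 0 T 0"

lemma legendre_curve_eq: "legendre_curve d = E"
  by (simp add: legendre_curve_def Let_def)

lemma T_power: "T = to_fract ([:0, 1:] ^ d)"
  by (induction d) (simp_all only: power_0 to_fract_1 power_Suc to_fract_mult)

lemma T_nz: "T \<noteq> 0"
  by simp

lemma T_neq_1: "T \<noteq> 1"
proof
  assume "T = 1"
  then have "[:0, 1:] ^ d = (1 :: 'k poly)"
    unfolding T_power by (metis to_fract_1 to_fract_eq_iff)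
  then have "degree ([:0, 1 :: 'k:] ^ d) = 0"
    by simp
  then show False
    using d by (simp add: degree_power_eq)
qed

lemma nonsingular: "(1 + T) ^ 2 - 4 * T \<noteq> 0"
proof -
  have "(1 + T) ^ 2 - 4 * T = (1 - T) ^ 2"
    by (simp add: power2_eq_square algebra_simps)
  then show ?thesis
    using T_neq_1 by simp
qed

lemma euler_factor_at:
  shows "log_deriv (euler_factor (place_at x) (legendre_curve d)) =
      Abs_fps (\<lambda>n. if 0 < n \<and> period x dvd n
        then of_nat (period x) * galois_field.legendre_sum (q ^ n) (x ^ d) else 0)"
    and "euler_factor (place_at x) (legendre_curve d) $ 0 = 1"
proof -
  define m where "m = period x"
  have m: "m > 0"
    unfolding m_def by (rule period_pos)
  interpret C: curve_reduction "place_at x" "ev_at x" "q ^ m" "TYPE('k alg_closure)"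
    unfolding m_def by (intro curve_reduction.intro reduction_at extension period_pos)
  define \<tau> where "\<tau> = x ^ d"
  have TO: "T \<in> C.Ov"
    unfolding T_power by (rule to_fract_integral_at)
  then have TO': "1 + T \<in> C.Ov"
    by (rule C.O_add[OF C.O_1])
  have eT: "ev_at x T = \<tau>"
    unfolding C.e_power[OF to_fract_integral_at] ev_at_to_fract by (simp add: \<tau>_def ac_pCons)
  have eT': "ev_at x (1 + T) = 1 + \<tau>"
    unfolding C.e_add[OF C.O_1 TO] C.e_1 eT ..
  have \<tau>F: "\<tau> \<in> C.F"
    using C.e_image TO eT by blast
  have e3: "ev_at x ((1 + t) ^ 2 - 3 * t) = (1 + ev_at x t) ^ 2 - 3 * ev_at x t"
    and e4: "ev_at x (t ^ 2 * ((1 + t) ^ 2 - 4 * t)) = ev_at x t ^ 2 * ((1 + ev_at x t) ^ 2 - 4 * ev_at x t)"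
    if "t \<in> C.Ov" for t
    using that by (simp_all add: C.e_add C.e_diff C.e_power C.e_mult C.e_numeral C.e_1 C.O_closed)
  \<comment> \<open>For \<open>\<tau>\<close> equal to 0 or 1,
    \<open>(1 + \<tau>) ^ 2 - 3 * \<tau>\<close> is 1, so c4 is a unit; otherwise the discriminant
    is.\<close>
  have minimality: "place_at x (T ^ 2 * ((1 + T) ^ 2 - 4 * T)) = 0 \<or>
      ((1 + T) ^ 2 - 3 * T \<noteq> 0 \<and> place_at x ((1 + T) ^ 2 - 3 * T) < 4)"
  proof (cases "\<tau> = 0 \<or> \<tau> = 1")
    case True
    have O: "(1 + T) ^ 2 - 3 * T \<in> C.Ov"
      by (intro C.O_closed TO)
    have "ev_at x ((1 + T) ^ 2 - 3 * T) \<noteq> 0"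
    proof -
      have "(1 + 1) ^ 2 - 3 * 1 = (1 :: 'k alg_closure)"
        by simp
      then have "(1 + \<tau>) ^ 2 - 3 * \<tau> = 1"
        using True by auto
      then show ?thesis
        unfolding e3[OF TO] eT by simp
    qed
    then show ?thesis
      using C.e_nz_iff[OF O] by auto
  next
    case False
    have O: "T ^ 2 * ((1 + T) ^ 2 - 4 * T) \<in> C.Ov"
      by (intro C.O_closed TO)
    have "ev_at x (T ^ 2 * ((1 + T) ^ 2 - 4 * T)) = \<tau> ^ 2 * ((1 + \<tau>) ^ 2 - 4 * \<tau>)"
      unfolding e4[OF TO] eT ..
    also have "(1 + \<tau>) ^ 2 - 4 * \<tau> = (1 - \<tau>) ^ 2"
      by (simp add: power2_eq_square algebra_simps)
    finally have "ev_at x (T ^ 2 * ((1 + T) ^ 2 - 4 * T)) \<noteq> 0"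
      using False by simp
    then show ?thesis
      using C.e_nz_iff[OF O] by auto
  qed
  note red = C.good_reduction_iff[OF TO' TO T_nz nonsingular minimality, where w = 1 and W = E]
    C.frobenius_trace_eq[OF TO' TO T_nz nonsingular minimality, where w = 1 and W = E]
  have sq: "(1 + \<tau>) ^ 2 \<noteq> 4 * \<tau> \<longleftrightarrow> \<tau> \<noteq> 1"
  proof -
    have "(1 + \<tau>) ^ 2 - 4 * \<tau> = (1 - \<tau>) ^ 2"
      by (simp add: power2_eq_square algebra_simps)
    then show ?thesis
      by (metis eq_iff_diff_eq_0 power2_eq_square mult_eq_0_iff)
  qed
  have good: "good_reduction (place_at x) E \<longleftrightarrow> \<tau> \<noteq> 0 \<and> \<tau> \<noteq> 1"
    using red(1) by (simp add: change_coords_id eT eT' sq)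
  have "of_int (frobenius_trace (place_at x) E) =
      - (\<Sum>x\<in>C.F. quad_char (q ^ m) (x * (x * x + (1 + \<tau>) * x + \<tau>)))"
    using red(2) by (simp add: change_coords_id eT eT')
  also have "(\<Sum>x\<in>C.F. quad_char (q ^ m) (x * (x * x + (1 + \<tau>) * x + \<tau>))) = C.legendre_sum \<tau>"
    unfolding C.legendre_sum_def by (intro sum.cong refl arg_cong[of _ _ "quad_char (q ^ m)"]) (simp add: algebra_simps)
  finally have trace: "of_int (frobenius_trace (place_at x) E) = - C.legendre_sum \<tau>" .
  have trace': "(of_int (frobenius_trace (place_at x) E) :: complex fps) = fps_const (- C.legendre_sum \<tau>)"
    unfolding trace[symmetric] by (rule fps_of_int[symmetric])
  have degree: "place_degree (place_at x) = m"
    by (simp add: place_degree_at m_def)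
  have card: "residue_card (place_at x) = q ^ m"
    by (simp add: C.card_residue C.card_GF)
  have main: "log_deriv (euler_factor (place_at x) E) =
      Abs_fps (\<lambda>n. if 0 < n \<and> m dvd n then of_nat m * galois_field.legendre_sum (q ^ n) \<tau> else 0) \<and>
    euler_factor (place_at x) E $ 0 = 1"
  proof (cases "\<tau> \<noteq> 0 \<and> \<tau> \<noteq> 1")
    case True
    define h where "h n = (if n = 0 then 1 else if n = 1 then C.legendre_sum \<tau> else if n = 2 then of_nat (q ^ m) else (0 :: complex))" for n :: nat
    define p where "p r = galois_field.legendre_sum ((q ^ m) ^ r) \<tau>" for r
    have p: "p r = (\<Sum>z\<in>GF ((q ^ m) ^ r). quad_char ((q ^ m) ^ r) (z * (z + 1) * (z + \<tau>)))" if "r > 0" for r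
      unfolding p_def by (rule galois_field.legendre_sum_def[OF C.extension[OF that]])
    have "of_nat n * h n = (\<Sum>r=1..n. p r * h (n - r))" for n
      using C.legendre_local_recurrence[OF \<tau>F, of n] True
      by (simp only: h_def) (simp add: p cong: sum.cong_simp)
    then have ld: "log_deriv (Abs_fps h oo fps_X ^ m) =
        Abs_fps (\<lambda>n. if 0 < n \<and> m dvd n then of_nat m * p (n div m) else 0)"
      by (intro log_deriv_stretch m) (auto simp: h_def)
    have "Abs_fps h = 1 + fps_const (C.legendre_sum \<tau>) * fps_X + fps_const (of_nat (q ^ m)) * fps_X ^ 2"
      by (rule fps_ext) (auto simp: h_def fps_X_power_iff)
    then have "Abs_fps h oo fps_X ^ m =
        1 + fps_const (C.legendre_sum \<tau>) * fps_X ^ m + fps_const (of_nat (q ^ m)) * (fps_X ^ m) ^ 2"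
      using m by (simp add: fps_compose_add_distrib fps_compose_mult_distrib fps_compose_power[symmetric])
    also have "\<dots> = euler_factor (place_at x) E"
      unfolding euler_factor_def degree card trace' using True good
      by (simp add: power_mult[symmetric] mult.commute flip: fps_const_neg fps_of_nat of_nat_power)
    finally have eq: "Abs_fps h oo fps_X ^ m = euler_factor (place_at x) E" .
    have "(Abs_fps h oo fps_X ^ m) $ 0 = 1"
      by (simp add: h_def)
    moreover have "p (n div m) = galois_field.legendre_sum (q ^ n) \<tau>" if "m dvd n" for n
      using that by (simp add: p_def flip: power_mult)
    ultimately show ?thesis
      using ld unfolding eq by (simp cong: if_cong)
  next
    case False
    define a where "a = - C.legendre_sum \<tau>"
    have eq: "euler_factor (place_at x) E = 1 - fps_const a * fps_X ^ m"
      unfolding euler_factor_def degree trace' using False good by (auto simp: a_def)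
    have "- (of_nat m * a ^ (n div m)) = of_nat m * galois_field.legendre_sum (q ^ n) \<tau>"
      if n: "0 < n" "m dvd n" for n
    proof -
      have "n div m > 0"
        using n m by (simp add: dvd_imp_le div_greater_zero_iff)
      then have "galois_field.legendre_sum ((q ^ m) ^ (n div m)) \<tau> = - (a ^ (n div m))"
        unfolding a_def using False by (intro C.legendre_sum_bad) auto
      moreover have "(q ^ m) ^ (n div m) = q ^ n"
        using n by (simp flip: power_mult)
      ultimately show ?thesis
        by simp
    qed
    then have "log_deriv (euler_factor (place_at x) E) =
      Abs_fps (\<lambda>n. if 0 < n \<and> m dvd n then of_nat m * galois_field.legendre_sum (q ^ n) \<tau> else 0)"
      unfolding eq log_deriv_linear[OF m] by (auto simp: fps_eq_iff)
    moreover have "euler_factor (place_at x) E $ 0 = 1"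
      unfolding eq using m by simp
    ultimately show ?thesis
      by blast
  qed
  show "log_deriv (euler_factor (place_at x) (legendre_curve d)) =
      Abs_fps (\<lambda>n. if 0 < n \<and> period x dvd n
        then of_nat (period x) * galois_field.legendre_sum (q ^ n) (x ^ d) else 0)"
    "euler_factor (place_at x) (legendre_curve d) $ 0 = 1"
    using main unfolding legendre_curve_eq m_def \<tau>_def by auto
qed

text \<open>After rescaling, \<open>a4\<close> reduces to 0. For even \<open>d\<close> the
  coefficient \<open>a2\<close> reduces to 1, giving the split node
  \<open>y^2 = x^2 (x + 1)\<close>; for odd \<open>d\<close> it reduces to 0, giving the cusp
  \<open>y^2 = x^3\<close>.\<close>

lemma euler_factor_inf:
  shows "log_deriv (euler_factor place_inf (legendre_curve d)) =
      Abs_fps (\<lambda>n. if 0 < n then (if even d then - 1 else 0) else 0)"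
    and "euler_factor place_inf (legendre_curve d) $ 0 = 1"
proof -
  interpret C: curve_reduction place_inf ev_inf q "TYPE('k alg_closure)"
    by (intro curve_reduction.intro reduction_inf galois_field_axioms)
  define u :: "'k poly fract" where "u = to_fract [:0, 1:]"
  \<comment> \<open>\<open>d/2\<close> rounded up is the least exponent that makes
    \<open>(1 + T) / w ^ 2\<close> integral at infinity.\<close>
  define k where "k = (d + 1) div 2"
  define w where "w = u ^ k"
  have u: "u \<noteq> 0" "place_inf u = - 1"
    by (simp_all add: u_def) (simp add: to_fract_def place_inf_Fract)
  have w: "w \<noteq> 0" "place_inf w = - int k"
    using u C.v_power[of u k] by (simp_all add: w_def)
  have T: "T \<noteq> 0" "place_inf T = - int d"
    using u C.v_power[of u d] by (simp_all add: u_def)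
  have T1: "T + 1 \<noteq> 0" "place_inf (T + 1) = - int d"
    using C.v_add_eq[of T 1] T d by auto
  define a2 a4 where "a2 = (1 + T) / w ^ 2" "a4 = T / w ^ 4"
  note a_def = this
  have w2: "w ^ 2 \<noteq> 0" "place_inf (w ^ 2) = - 2 * int k" "w ^ 4 \<noteq> 0" "place_inf (w ^ 4) = - 4 * int k"
    using w C.v_power[of w 2] C.v_power[of w 4] by auto
  have a2: "a2 \<noteq> 0" "place_inf a2 = 2 * int k - int d"
    unfolding a_def using C.v_divide[of "T + 1" "w ^ 2"] T1 w2 by (auto simp: add.commute)
  have a4: "a4 \<noteq> 0" "place_inf a4 = 4 * int k - int d"
    unfolding a_def using C.v_divide[of T "w ^ 4"] T w2 by auto
  have kd: "2 * int k = int d + (if even d then 0 else 1)"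
    unfolding k_def by (cases "even d") (auto elim!: evenE oddE)
  have a2O: "a2 \<in> C.Ov" and a4O: "a4 \<in> C.Ov"
    using a2 a4 kd d by (auto simp: C.Ov_def split: if_splits)
  have W: "change_coords w 0 0 0 E = Weierstrass 0 a2 0 a4 0"
    by (simp add: change_coords.simps a_def)
  have nonsing: "a2 ^ 2 - 4 * a4 \<noteq> 0"
  proof -
    have "a2 ^ 2 - 4 * a4 = ((1 + T) ^ 2 - 4 * T) / w ^ 4"
      using w(1) by (simp add: a_def power_divide diff_divide_distrib flip: power_mult)
    then show ?thesis
      using nonsingular w2 by simp
  qed
  have e4: "ev_inf a4 = 0"
  proof -
    have "place_inf a4 > 0"
      unfolding a4(2) using kd d by (cases "even d") auto
    then show ?thesis
      using C.e_eq_0_iff[OF a4O a4(1)] by simp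
  qed
  have e2: "ev_inf a2 = (if even d then 1 else 0)"
  proof (cases "even d")
    case True
    then have "2 * k = d"
      unfolding k_def by auto
    then have "w ^ 2 = T"
      by (simp add: w_def u_def mult.commute flip: power_mult)
    then have "a2 = 1 / T + 1"
      using T by (simp add: a_def add_divide_distrib)
    moreover have "1 / T \<noteq> 0" "place_inf (1 / T) = int d"
      using C.v_divide[of 1 T] T by auto
    then have "1 / T \<in> C.Ov" "ev_inf (1 / T) = 0"
      using C.e_eq_0_iff[of "1 / T"] d by (auto simp: C.Ov_def)
    ultimately show ?thesis
      using True C.e_add[of "1 / T" 1] by (simp add: C.e_1)
  next
    case False
    then show ?thesis
      using C.e_eq_0_iff[OF a2O] a2 kd by auto
  qed
  \<comment> \<open>For even \<open>d\<close> this is a unit. For odd \<open>d\<close> it has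
    valuation 2, as \<open>a2\<close> has valuation 1 and \<open>a4\<close> has valuation
    \<open>d + 2\<close>; in characteristic 3 the second term disappears.\<close>
  have minimality: "a2 ^ 2 - 3 * a4 \<noteq> 0 \<and> place_inf (a2 ^ 2 - 3 * a4) < 4"
  proof (cases "even d")
    case True
    have O: "a2 ^ 2 - 3 * a4 \<in> C.Ov"
      by (intro C.O_closed a2O a4O)
    have "ev_inf (a2 ^ 2 - 3 * a4) = 1"
      using a2O a4O True by (simp add: C.e_diff C.e_power C.e_mult C.e_numeral C.O_closed e2 e4)
    then show ?thesis
      using C.e_nz_iff[OF O] by auto
  next
    case False
    have sq: "a2 ^ 2 \<noteq> 0" "place_inf (a2 ^ 2) = 2"
      using a2 C.v_power[of a2 2] kd False by auto
    show ?thesis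
    proof (cases "3 * a4 = 0")
      case True
      then show ?thesis
        unfolding True using sq by simp
    next
      case False
      then have three: "(3 :: 'k poly fract) \<noteq> 0"
        by auto
      have "place_inf (- (3 * a4)) = place_inf 3 + place_inf a4"
        using three a4 by (simp add: C.v_minus C.v_mult)
      moreover have "place_inf (3 :: 'k poly fract) \<ge> 0"
        using C.O_numeral[of "num.Bit1 num.One"] three by (auto simp: C.Ov_def)
      ultimately have "place_inf (a2 ^ 2) < place_inf (- (3 * a4))"
        using sq a4 kd d \<open>odd d\<close> by auto
      then show ?thesis
        using C.v_add_eq[of "a2 ^ 2" "- (3 * a4)"] sq False by auto
    qed
  qed
  note red = C.good_reduction_iff[OF a2O a4O a4(1) nonsing disjI2[OF minimality] w(1) W]
    C.frobenius_trace_eq[OF a2O a4O a4(1) nonsing disjI2[OF minimality] w(1) W]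
  have bad: "\<not> good_reduction place_inf E"
    using red(1) e4 by simp
  have trace: "of_int (frobenius_trace place_inf E) = (if even d then 1 else 0 :: complex)"
  proof (cases "even d")
    case True
    have "(\<Sum>x\<in>F. quad_char q (x * (x * x + 1 * x + 0))) = legendre_sum 0"
      unfolding legendre_sum_def by (intro sum.cong refl arg_cong[of _ _ "quad_char q"]) (simp add: algebra_simps)
    then show ?thesis
      using red(2) True by (simp add: e2 e4 legendre_sum_0)
  next
    case False
    have "(\<Sum>x\<in>F. quad_char q (x * (x * x + 0 * x + 0))) = (\<Sum>x\<in>F. quad_char q x)"
    proof (intro sum.cong refl)
      fix x assume x: "x \<in> F"
      show "quad_char q (x * (x * x + 0 * x + 0)) = quad_char q x"
        using x quad_char_of_square[OF x] by (cases "x = 0") (simp_all add: quad_char_mult GF_mult)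
    qed
    then show ?thesis
      using red(2) False by (simp add: e2 e4 sum_quad_char)
  qed
  have eq: "euler_factor place_inf E = 1 - fps_const (if even d then 1 else 0) * fps_X ^ 1"
  proof -
    have "(of_int (frobenius_trace place_inf E) :: complex fps) = fps_const (if even d then 1 else 0)"
      unfolding trace[symmetric] by (rule fps_of_int[symmetric])
    then show ?thesis
      unfolding euler_factor_def place_degree_inf using bad by simp
  qed
  show "log_deriv (euler_factor place_inf (legendre_curve d)) =
      Abs_fps (\<lambda>n. if 0 < n then (if even d then - 1 else 0) else 0)"
    unfolding legendre_curve_eq eq log_deriv_linear[OF zero_less_one]
    by (auto simp: fps_eq_iff)
  show "euler_factor place_inf (legendre_curve d) $ 0 = 1"
    unfolding legendre_curve_eq eq by simp
qed

end

end

section \<open>The L-function\<close>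

lemma orbit_singleton:
  assumes "[q = 1] (mod d)" "i < (d :: nat)"
  shows "range (\<lambda>n. (q ^ n * i) mod d) = {i}"
proof -
  have "(q ^ n * i) mod d = i" for n
  proof -
    have "[q ^ n * i = 1 ^ n * i] (mod d)"
      using assms(1) by (intro cong_mult cong_pow cong_refl)
    then show ?thesis
      using assms(2) by (simp add: cong_def)
  qed
  then show ?thesis
    by auto
qed

context function_field
begin

theorem hasse_weil_L_legendre:
  fixes d :: nat and P :: "complex set"
  assumes d: "d > 0" "coprime d CHAR('k)" and P: "prime_over P CHAR('k)"
  shows "hasse_weil_L (legendre_curve d :: 'k poly fract weierstrass) =
    (\<Prod>orbit\<in>admissible_orbits q d. 1 - fps_const ((J_orbit CHAR('k) P q d orbit)\<^sup>2) * fps_X ^ card orbit)"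
proof -
  define W where "W = (legendre_curve d :: 'k poly fract weierstrass)"
  define R where "R = (\<Prod>orbit\<in>admissible_orbits q d. 1 - fps_const ((J_orbit CHAR('k) P q d orbit)\<^sup>2) * fps_X ^ card orbit)"
  obtain \<Theta> :: "'k alg_closure \<Rightarrow> complex" where \<Theta>: "galois_characters q d \<Theta>"
    and J: "\<And>m i. 0 < m \<Longrightarrow> m \<le> d \<Longrightarrow> 0 < i \<Longrightarrow> i < d \<Longrightarrow> d dvd (q ^ m - 1) * i \<Longrightarrow>
      J_lambda_chi CHAR('k) P d (q ^ m) i = galois_field.jacobi (q ^ m) (torsion_char (q ^ m) d \<Theta> i)"
    using exists_characters[where ?'a = "'k alg_closure", of q P d] galois_field_axioms P d
    by auto
  interpret G: galois_characters q "TYPE('k alg_closure)" d \<Theta>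
    by (rule \<Theta>)
  have orbit: "card orbit > 0" "J_orbit CHAR('k) P q d orbit = G.jac (card orbit) (SOME i. i \<in> orbit)"
    if orbit: "orbit \<in> admissible_orbits q d" for orbit
  proof -
    obtain i where i: "orbit = G.orb i" "i < d" "i \<noteq> 0" "2 * i \<noteq> d"
      using orbit by (auto simp: G.admissible_orbits_eq)
    show pos: "card orbit > 0"
      using G.orb_period_pos by (simp add: i(1) G.card_orb)
    define j where "j = (SOME i. i \<in> orbit)"
    have j: "j \<in> orbit"
      unfolding j_def using G.self_in_orb[OF i(2)] i(1) by (metis someI)
    have oj: "G.orb j = orbit" "j < d"
      using G.orb_eq[OF i(2)] G.orb_less j i(1) by auto
    have "i \<in> orbit"
      using G.self_in_orb[OF i(2)] i(1) by simp
    then have "j \<noteq> 0"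
      using oj(1) i(3) G.orb_0 by (metis singletonD)
    moreover have "card orbit \<le> d"
      using card_mono[of "{..<d}" orbit] G.orb_less i(1) by auto
    moreover have "d dvd (q ^ card orbit - 1) * j"
      unfolding G.orb_period_dvd_iff using G.card_orb[of j] oj(1) by simp
    ultimately show "J_orbit CHAR('k) P q d orbit = G.jac (card orbit) (SOME i. i \<in> orbit)"
      unfolding J_orbit_def G.jac_def j_def[symmetric] using J pos oj(2) by simp
  qed
  have fact1: "(1 - fps_const ((J_orbit CHAR('k) P q d orbit)\<^sup>2) * fps_X ^ card orbit) $ 0 = 1"
    if "orbit \<in> admissible_orbits q d" for orbit
    using orbit(1)[OF that] by simp
  note fin = G.finite_admissible_orbits
  have R0: "R $ 0 = 1"
    unfolding R_def by (intro log_deriv_prod(2) fact1)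
  have R_ld: "log_deriv R $ n = (if even d then 1 else 0) -
      (\<Sum>x\<in>(GF (q ^ n) :: 'k alg_closure set). galois_field.legendre_sum (q ^ n) (x ^ d))" if n: "n > 0" for n
  proof -
    have "log_deriv R = (\<Sum>orbit\<in>admissible_orbits q d.
        log_deriv (1 - fps_const ((J_orbit CHAR('k) P q d orbit)\<^sup>2) * fps_X ^ card orbit))"
      unfolding R_def by (intro log_deriv_prod(1) fact1)
    then have "log_deriv R $ n = (\<Sum>orbit\<in>admissible_orbits q d.
        if card orbit dvd n then - (of_nat (card orbit) * (J_orbit CHAR('k) P q d orbit)\<^sup>2 ^ (n div card orbit)) else 0)"
      using n by (simp add: fps_sum_nth log_deriv_linear orbit(1) cong: sum.cong)
    also have "\<dots> = (\<Sum>orbit\<in>{orbit \<in> admissible_orbits q d. card orbit dvd n}.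
        - (of_nat (card orbit) * (G.jac (card orbit) (SOME i. i \<in> orbit))\<^sup>2 ^ (n div card orbit)))"
      using fin by (subst sum.inter_filter[symmetric]) (auto simp: orbit(2) intro!: sum.cong)
    also have "\<dots> = - ((\<Sum>x\<in>(GF (q ^ n) :: 'k alg_closure set). galois_field.legendre_sum (q ^ n) (x ^ d)) -
        (if even d then 1 else 0))"
      using G.global_count[OF n] by (simp add: sum_negf)
    finally show ?thesis
      by simp
  qed
  define A where "A = {v :: 'k poly fract \<Rightarrow> int. is_place v}"
  have A: "A = insert place_inf (range place_at)"
    using place_classification is_place_place_at is_place_place_inf by (auto simp: A_def)
  have E0: "euler_factor v W $ 0 = 1" if "v \<in> A" for v
    using that euler_factor_at(2)[OF d(1)] euler_factor_inf(2)[OF d(1)] by (auto simp: A W_def)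
  define places where "places n = place_at ` (GF (q ^ n) :: 'k alg_closure set)" for n
  have GF_iff: "x \<in> GF (q ^ n) \<longleftrightarrow> period x dvd n" for x :: "'k alg_closure" and n
    by (simp add: GF_def period_dvd_iff[OF periodic])
  have fin_GF: "finite (GF (q ^ n) :: 'k alg_closure set)" if "n > 0" for n
    by (rule finite_GF_ext[OF that])
  \<comment> \<open>Apart from infinity, coefficient \<open>n\<close> sees only places whose degree
    divides \<open>n\<close>, that is, the Frobenius orbits inside \<open>GF (q ^ n)\<close>;
    further places in \<open>S\<close> contribute 0.\<close>
  have local_sum: "(\<Sum>v\<in>S. log_deriv (euler_factor v W) $ n) =
      (\<Sum>x\<in>(GF (q ^ n) :: 'k alg_closure set). galois_field.legendre_sum (q ^ n) (x ^ d)) - (if even d then 1 else 0)"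
    if S: "finite S" "S \<subseteq> A" "place_inf \<in> S" "places n \<subseteq> S" and n: "n > 0" for S n
  proof -
    have val: "log_deriv (euler_factor (place_at x) W) $ n =
        (if period x dvd n then of_nat (period x) * galois_field.legendre_sum (q ^ n) (x ^ d) else 0)" for x
      using n by (simp add: W_def euler_factor_at(1)[OF d(1)])
    have inf: "log_deriv (euler_factor place_inf W) $ n = - (if even d then 1 else 0)"
      using n by (simp add: W_def euler_factor_inf(1)[OF d(1)])
    have "(\<Sum>v\<in>S - {place_inf}. log_deriv (euler_factor v W) $ n) =
        (\<Sum>v\<in>places n. log_deriv (euler_factor v W) $ n)"
    proof (rule sum.mono_neutral_right)
      show "places n \<subseteq> S - {place_inf}"
        using S(4) place_inf_neq_place_at by (auto simp: places_def)
      show "\<forall>v\<in>S - {place_inf} - places n. log_deriv (euler_factor v W) $ n = 0"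
      proof
        fix v assume v: "v \<in> S - {place_inf} - places n"
        then obtain x where x: "v = place_at x"
          using S(2) A by auto
        then have "\<not> period x dvd n"
          using v GF_iff by (auto simp: places_def)
        then show "log_deriv (euler_factor v W) $ n = 0"
          by (simp add: x val)
      qed
    qed (use S in simp)
    also have "\<dots> = (\<Sum>v\<in>places n. \<Sum>x\<in>{x. x \<in> GF (q ^ n) \<and> place_at x = v}. galois_field.legendre_sum (q ^ n) (x ^ d))"
    proof (rule sum.cong[OF refl])
      fix v assume "v \<in> places n"
      then obtain y where y: "v = place_at y" "y \<in> GF (q ^ n)"
        by (auto simp: places_def)
      have per: "period x = period y" if "place_at x = place_at y" for x
        using card_place_at_fibre[of x] card_place_at_fibre[of y] that by simp
      have set_eq: "{x. x \<in> GF (q ^ n) \<and> place_at x = v} = {x. place_at x = place_at y}"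
        unfolding y(1) using per y(2) by (intro Collect_cong) (metis GF_iff)
      \<comment> \<open>The coefficient belonging to a place is shared equally among the
        \<open>period y\<close> elements of its orbit.\<close>
      have "of_nat (period y) * galois_field.legendre_sum (q ^ n) (x ^ d) = log_deriv (euler_factor v W) $ n"
        if "place_at x = place_at y" for x
        unfolding y(1) that[symmetric] using val[of x] per[OF that] y(2) by (simp add: GF_iff)
      then have "galois_field.legendre_sum (q ^ n) (x ^ d) = log_deriv (euler_factor v W) $ n / of_nat (period y)"
        if "place_at x = place_at y" for x
        using that period_pos[of y] by (simp add: field_simps)
      then have "(\<Sum>x\<in>{x. place_at x = place_at y}. galois_field.legendre_sum (q ^ n) (x ^ d)) =
          (\<Sum>x\<in>{x. place_at x = place_at y}. log_deriv (euler_factor v W) $ n / of_nat (period y))"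
        by (intro sum.cong refl) simp
      also have "\<dots> = log_deriv (euler_factor v W) $ n"
        using period_pos[of y] by (simp add: card_place_at_fibre)
      finally show "log_deriv (euler_factor v W) $ n =
          (\<Sum>x\<in>{x. x \<in> GF (q ^ n) \<and> place_at x = v}. galois_field.legendre_sum (q ^ n) (x ^ d))"
        unfolding set_eq ..
    qed
    also have "\<dots> = (\<Sum>x\<in>(GF (q ^ n) :: 'k alg_closure set). galois_field.legendre_sum (q ^ n) (x ^ d))"
      unfolding places_def by (rule sum.image_gen[symmetric]) (rule fin_GF[OF n])
    finally have "(\<Sum>v\<in>S - {place_inf}. log_deriv (euler_factor v W) $ n) =
        (\<Sum>x\<in>(GF (q ^ n) :: 'k alg_closure set). galois_field.legendre_sum (q ^ n) (x ^ d))" .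
    then show ?thesis
      using inf sum.remove[OF S(1,3), of "\<lambda>v. log_deriv (euler_factor v W) $ n"] by simp
  qed
  \<comment> \<open>The coefficient at \<open>n\<close> is final once \<open>S\<close> contains
    infinity and all places of degree at most \<open>n\<close>. Such eventual equality of
    coefficients is convergence of power series.\<close>
  have partial: "(\<Prod>v\<in>S. inverse (euler_factor v W)) $ n = R $ n"
    if S: "finite S" "S \<subseteq> A" "place_inf \<in> S" "(\<Union>l\<in>{1..n}. places l) \<subseteq> S" for S n
  proof (rule fps_eq_of_log_deriv_eq[where N = n])
    have inv0: "inverse (euler_factor v W) $ 0 = 1" if "v \<in> S" for v
      using E0[of v] S(2) that by auto
    show "(\<Prod>v\<in>S. inverse (euler_factor v W)) $ 0 = 1"
      by (intro log_deriv_prod(2) inv0)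
    have ld: "log_deriv (\<Prod>v\<in>S. inverse (euler_factor v W)) = (\<Sum>v\<in>S. - log_deriv (euler_factor v W))"
      using E0 S(2) by (subst log_deriv_prod(1)[OF inv0]) (auto intro!: sum.cong log_deriv_inverse)
    fix l assume "l \<le> n"
    show "log_deriv (\<Prod>v\<in>S. inverse (euler_factor v W)) $ l = log_deriv R $ l"
    proof (cases "l = 0")
      case False
      then have "places l \<subseteq> S"
        using S(4) \<open>l \<le> n\<close> by force
      then have "(\<Sum>v\<in>S. log_deriv (euler_factor v W) $ l) =
          (\<Sum>x\<in>(GF (q ^ l) :: 'k alg_closure set). galois_field.legendre_sum (q ^ l) (x ^ d)) - (if even d then 1 else 0)"
        using S False by (intro local_sum) auto
      then show ?thesis
        using R_ld[of l] False by (simp add: ld fps_sum_nth sum_negf)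
    qed simp
  qed (use R0 in auto)
  have "((\<lambda>S. \<Prod>v\<in>S. inverse (euler_factor v W)) \<longlongrightarrow> R) (finite_subsets_at_top A)"
    unfolding tendsto_fps_iff
  proof
    fix n
    have "finite (insert place_inf (\<Union>l\<in>{1..n}. places l))"
      by (auto simp: places_def intro!: finite_imageI fin_GF)
    moreover have "insert place_inf (\<Union>l\<in>{1..n}. places l) \<subseteq> A"
      by (auto simp: A places_def)
    ultimately show "\<forall>\<^sub>F S in finite_subsets_at_top A. (\<Prod>v\<in>S. inverse (euler_factor v W)) $ n = R $ n"
      unfolding eventually_finite_subsets_at_top
      by (intro exI[of _ "insert place_inf (\<Union>l\<in>{1..n}. places l)"] conjI allI impI partial) auto
  qed
  then have "Lim (finite_subsets_at_top A) (\<lambda>S. \<Prod>v\<in>S. inverse (euler_factor v W)) = R"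
    by (intro tendsto_Lim) (auto simp: finite_subsets_at_top_neq_bot)
  then show ?thesis
    by (simp add: hasse_weil_L_def A_def R_def W_def)
qed

end

theorem theorem3p2p1:
  fixes p q d :: nat and P :: "complex set"
  assumes "prime p" and "odd p"
    and "\<exists>n>0. q = p ^ n"
    and "d > 2" and "coprime d p"
    and "CARD('k::{field,finite}) = q"
    and "primeideal P algebraic_integers" and "of_nat p \<in> P"
  shows "hasse_weil_L (legendre_curve d :: 'k poly fract weierstrass) =
      (\<Prod>orb \<in> admissible_orbits q d. 1 - fps_const ((J_orbit p P q d orb)\<^sup>2) * fps_X ^ card orb)
    \<and> ([q = 1] (mod d) \<longrightarrow>
      hasse_weil_L (legendre_curve d :: 'k poly fract weierstrass) =
      (\<Prod>i \<in> {i \<in> {1..d - 1}. 2 * i \<noteq> d}. 1 - fps_const ((J_lambda_chi p P d q i)\<^sup>2) * fps_X))"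
proof -
  have CHAR: "CHAR('k) = p"
  proof -
    have "prime CHAR('k)"
      by (rule prime_CHAR_semidom) (simp add: finite_imp_CHAR_pos)
    moreover have "CHAR('k) dvd q"
      using CHAR_dvd_CARD[where ?'a = 'k] assms(6) by simp
    moreover obtain n where "q = p ^ n"
      using assms(3) by blast
    ultimately show ?thesis
      using assms(1) by (metis prime_dvd_power primes_dvd_imp_eq)
  qed
  interpret function_field "TYPE('k)" q
    by unfold_locales (use assms CHAR in auto)
  have "prime_over P CHAR('k)"
    using assms CHAR by (intro prime_over.intro) auto
  then have L: "hasse_weil_L (legendre_curve d :: 'k poly fract weierstrass) =
      (\<Prod>orb \<in> admissible_orbits q d. 1 - fps_const ((J_orbit p P q d orb)\<^sup>2) * fps_X ^ card orb)"
    using hasse_weil_L_legendre[of d P] assms CHAR by simp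
  have "(\<Prod>orb \<in> admissible_orbits q d. 1 - fps_const ((J_orbit p P q d orb)\<^sup>2) * fps_X ^ card orb) =
      (\<Prod>i \<in> {i \<in> {1..d - 1}. 2 * i \<noteq> d}. 1 - fps_const ((J_lambda_chi p P d q i)\<^sup>2) * fps_X)"
    if q1: "[q = 1] (mod d)"
  proof -
    have orbits: "mult_orbits q d = (\<lambda>i. {i}) ` {0..<d}"
      unfolding mult_orbits_def by (intro image_cong refl orbit_singleton[OF q1]) auto
    have "admissible_orbits q d = (\<lambda>i. {i}) ` {i \<in> {1..d - 1}. 2 * i \<noteq> d}"
      unfolding admissible_orbits_def orbits using assms(4) by (auto elim!: evenE)
    then show ?thesis
      by (simp add: prod.reindex J_orbit_def)
  qed
  with L show ?thesis
    by simp
qed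

end
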